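(* Fix $p>0$, $s\in(0,2)$ and a branch of the argument. There exists a homeomorphism $f:\mathbb{C}\to\mathbb{C}$ with $p$-exponentially integrable distortion and a set $A\subset\mathbb{C}$ with Hausdorff dimension $s$ such that for each point $z\in A$ there exists a sequence of complex numbers $\lambda_{z,n}$, for which $|\lambda_{z,n}|\to0$ when $n\to\infty$, satisfying $$|f(z+\lambda_{z,n})-f(z)|\le e^{-\frac{C_1(2-s)^2}{p}\log^2\left(\frac{1}{|\lambda_{z,n}|}\right)}$$ and $$|\arg(f(z+\lambda_{z,n})-f(z))|\ge\frac{C_2(2-s)^2}{p}\log^2\left(\frac{1}{|\lambda_{z,n}|}\right),$$ where $C_1,C_2>0$ are constants whose values are not specified and which depend on each other.
   Context: A sense-preserving homeomorphism $f:\mathbb{C}\to\mathbb{C}$ has finite distortion if $f\in W^{1,1}_{\mathrm{loc}}(\mathbb{C})$, its Jacobian satisfies $J_f\in L^1_{\mathrm{loc}}(\mathbb{C})$, and $|Df(z)|^2\le K(z)J_f(z)$ almost everywhere for some measurable $K\ge 1$ that is finite almost everywhere; here $|Df(z)|=\max\{|Df(z)e|: e\in\mathbb{C},\,|e|=1\}$. The smallest such function is denoted $K_f$ and called the distortion of $f$. For $p>0$, $f$ has $p$-exponentially integrable distortion if it has finite distortion and $e^{pK_f}\in L^1_{\mathrm{loc}}$. The argument is understood as varying continuously along rays: for a point $z$ and a direction $\theta\in[0,2\pi)$, one follows $\arg(f(z+te^{i\theta})-f(z))$ continuously as $t$ decreases from $1$ to a small $r$, so that its change measures the winding of the path $f([z+re^{i\theta},z+e^{i\theta}])$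 around $f(z)$. Fixing a branch means fixing the choice of the argument, which is otherwise determined only up to multiples of $2\pi$. *)

theory Defs
  imports "HOL-Complex_Analysis.Complex_Analysis"
begin

section \<open>Local integrability and weak derivatives in the plane\<close>

definition loc_integrable :: "(complex \<Rightarrow> 'a :: {banach, second_countable_topology}) \<Rightarrow> bool"
  where "loc_integrable f \<longleftrightarrow> (\<forall>S. compact S \<longrightarrow> set_integrable lebesgue S f)"

fun k_times_cont_diff :: "nat \<Rightarrow> (complex \<Rightarrow> real) \<Rightarrow> bool" where
  "k_times_cont_diff 0 \<phi> \<longleftrightarrow> continuous_on UNIV \<phi>"
| "k_times_cont_diff (Suc k) \<phi> \<longleftrightarrow>
     (\<forall>z. \<phi> differentiable (at z)) \<and>
     (\<forall>e. k_times_cont_diff k (\<lambda>z. frechet_derivative \<phi> (at z) e))"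

definition test_function :: "(complex \<Rightarrow> real) \<Rightarrow> bool"
  where "test_function \<phi> \<longleftrightarrow>
    (\<forall>k. k_times_cont_diff k \<phi>) \<and> compact (closure {z. \<phi> z \<noteq> 0})"

text \<open>\<open>D z\<close> is the real-linear differential at \<open>z\<close>, so \<open>\<lambda>z. D z e\<close> is the weak directional
  derivative of \<open>f\<close> in the direction \<open>e\<close>.  The function \<open>D\<close> is determined by \<open>f\<close> only up to a
  null set.\<close>

definition weak_derivative :: "(complex \<Rightarrow> complex) \<Rightarrow> (complex \<Rightarrow> complex \<Rightarrow> complex) \<Rightarrow> bool"
  where "weak_derivative f D \<longleftrightarrow>
    (\<forall>z. linear (D z)) \<and>
    (\<forall>e. loc_integrable (\<lambda>z. D z e)) \<and>
    (\<forall>e \<phi>. test_function \<phi> \<longrightarrow>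
      (LINT z|lebesgue. frechet_derivative \<phi> (at z) e *\<^sub>R f z)
        = - (LINT z|lebesgue. \<phi> z *\<^sub>R D z e))"

text \<open>The Sobolev condition \<open>f \<in> W\<^sup>1\<^sup>,\<^sup>1\<^sub>l\<^sub>o\<^sub>c\<close>, with weak derivative \<open>D\<close>.\<close>

definition sobolev_11_loc :: "(complex \<Rightarrow> complex) \<Rightarrow> (complex \<Rightarrow> complex \<Rightarrow> complex) \<Rightarrow> bool"
  where "sobolev_11_loc f D \<longleftrightarrow> loc_integrable f \<and> weak_derivative f D"

definition jacobian_det :: "(complex \<Rightarrow> complex) \<Rightarrow> real"
  where "jacobian_det L = Re (L 1) * Im (L \<i>) - Re (L \<i>) * Im (L 1)"


section \<open>Homeomorphisms of finite distortion\<close>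

text \<open>Sense-preserving: the local degree is \<open>1\<close> at every point.\<close>

definition sense_preserving_homeo :: "(complex \<Rightarrow> complex) \<Rightarrow> bool"
  where "sense_preserving_homeo f \<longleftrightarrow>
    (\<exists>g. homeomorphism UNIV UNIV f g) \<and>
    (\<forall>z r. 0 < r \<longrightarrow> winding_number (f \<circ> circlepath z r) (f z) = 1)"

text \<open>A function \<open>K \<ge> 1\<close> that is finite almost everywhere is represented by a real-valued one,
  which loses nothing since the distortion inequality is required only almost everywhere.\<close>

definition distortion_bound :: "(complex \<Rightarrow> complex \<Rightarrow> complex) \<Rightarrow> (complex \<Rightarrow> real) \<Rightarrow> bool"
  where "distortion_bound D K \<longleftrightarrow>
    K \<in> borel_measurable lebesgue \<and> (\<forall>z. 1 \<le> K z) \<and>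
    (AE z in lebesgue. (onorm (D z))\<^sup>2 \<le> K z * jacobian_det (D z))"

text \<open>The smallest distortion bound; it is unique up to a null set.\<close>

definition is_distortion :: "(complex \<Rightarrow> complex \<Rightarrow> complex) \<Rightarrow> (complex \<Rightarrow> real) \<Rightarrow> bool"
  where "is_distortion D K \<longleftrightarrow>
    distortion_bound D K \<and>
    (\<forall>K'. distortion_bound D K' \<longrightarrow> (AE z in lebesgue. K z \<le> K' z))"

definition finite_distortion ::
    "(complex \<Rightarrow> complex) \<Rightarrow> (complex \<Rightarrow> complex \<Rightarrow> complex) \<Rightarrow> bool"
  where "finite_distortion f D \<longleftrightarrow>
    sense_preserving_homeo f \<and> sobolev_11_loc f D \<and>
    loc_integrable (\<lambda>z. jacobian_det (D z)) \<and> (\<exists>K. distortion_bound D K)"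

definition exp_integrable_distortion :: "real \<Rightarrow> (complex \<Rightarrow> complex) \<Rightarrow> bool"
  where "exp_integrable_distortion p f \<longleftrightarrow>
    (\<exists>D K. finite_distortion f D \<and> is_distortion D K \<and> loc_integrable (\<lambda>z. exp (p * K z)))"


section \<open>Hausdorff dimension\<close>

text \<open>The covering sets have to be bounded explicitly because \<^const>\<open>diameter\<close> is not meaningful
  on unbounded sets.  The measures are used for exponents \<open>d > 0\<close> only, where empty covering sets
  contribute \<open>0\<close>.\<close>

definition hausdorff_pre_measure :: "real \<Rightarrow> real \<Rightarrow> 'a::metric_space set \<Rightarrow> ennreal"
  where "hausdorff_pre_measure d \<delta> A =
    (INF U \<in> {U :: nat \<Rightarrow> 'a set. A \<subseteq> (\<Union>n. U n) \<and> (\<forall>n. bounded (U n) \<and> diameter (U n) \<le> \<delta>)}.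
       \<Sum>n. ennreal (diameter (U n) powr d))"

definition hausdorff_measure :: "real \<Rightarrow> 'a::metric_space set \<Rightarrow> ennreal"
  where "hausdorff_measure d A = (SUP \<delta> \<in> {0<..}. hausdorff_pre_measure d \<delta> A)"

definition hausdorff_dim :: "'a::metric_space set \<Rightarrow> ereal"
  where "hausdorff_dim A = (INF d \<in> {d. 0 < d \<and> hausdorff_measure d A = 0}. ereal d)"


section \<open>The argument along rays\<close>

text \<open>A branch selects one argument of each nonzero number, with all values in one interval of
  length \<open>2 * pi\<close>; on the ray where both endpoints are possible the choice is left open.\<close>

definition arg_branch :: "(complex \<Rightarrow> real) \<Rightarrow> bool"
  where "arg_branch b \<longleftrightarrow>
    (\<exists>\<alpha>. \<forall>w. w \<noteq> 0 \<longrightarrow> is_Arg w (b w) \<and> \<alpha> \<le> b w \<and> b w \<le> \<alpha> + 2 * pi)"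

text \<open>\<open>is_ray_lift b f z u r \<phi>\<close>: for a unit vector \<open>u\<close>, \<open>\<phi>\<close> is the continuous argument of
  \<open>f (z + t u) - f z\<close> for \<open>t\<close> between \<open>r\<close> and \<open>1\<close>, starting at \<open>t = 1\<close> from the value given by
  the branch \<open>b\<close>.\<close>

definition is_ray_lift ::
    "(complex \<Rightarrow> real) \<Rightarrow> (complex \<Rightarrow> complex) \<Rightarrow> complex \<Rightarrow> complex \<Rightarrow> real \<Rightarrow> (real \<Rightarrow> real) \<Rightarrow> bool"
  where "is_ray_lift b f z u r \<phi> \<longleftrightarrow>
    continuous_on {r..1} \<phi> \<and>
    (\<forall>t\<in>{r..1}. is_Arg (f (z + of_real t * u) - f z) (\<phi> t)) \<and>
    \<phi> 1 = b (f (z + u) - f z)"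

text \<open>The value \<open>arg (f (z + l) - f z)\<close>, for \<open>0 < cmod l \<le> 1\<close>.\<close>

definition ray_arg :: "(complex \<Rightarrow> real) \<Rightarrow> (complex \<Rightarrow> complex) \<Rightarrow> complex \<Rightarrow> complex \<Rightarrow> real"
  where "ray_arg b f z l =
    (THE a. \<exists>\<phi>. is_ray_lift b f z (sgn l) (cmod l) \<phi> \<and> \<phi> (cmod l) = a)"

text \<open>The description defining \<^const>\<open>ray_arg\<close> is well-posed for a homeomorphism \<open>f\<close>.\<close>

lemma is_Arg_unique_mod_2pi:
  assumes "is_Arg w a" "is_Arg w b" "w \<noteq> 0"
  obtains k :: int where "b = a + 2 * of_int k * pi"
proof -
  have "exp (\<i> * of_real b) = exp (\<i> * of_real a)"
    using assms unfolding is_Arg_def by (metis mult_cancel_left norm_eq_zero of_real_eq_0_iff)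
  then obtain k :: int
    where "\<i> * of_real b = \<i> * of_real a + of_real (of_int (2 * k) * pi) * \<i>"
    unfolding exp_eq by blast
  then have "b = a + 2 * of_int k * pi"
    by (simp add: complex_eq_iff)
  then show thesis by (rule that)
qed

lemma is_ray_lift_exists:
  assumes "continuous_on UNIV f" "inj f" "cmod u = 1" "0 < r" "r \<le> 1" "arg_branch b"
  shows "\<exists>\<phi>. is_ray_lift b f z u r \<phi>"
proof -
  define g where "g = (\<lambda>t::real. f (z + of_real t * u) - f z)"
  have nz: "g t \<noteq> 0" if "t \<in> {r..1}" for t
  proof -
    have "u \<noteq> 0" "t \<noteq> 0" using that assms(3,4) by auto
    then show ?thesis unfolding g_def by (simp add: inj_eq[OF assms(2)])
  qed
  have "continuous_on {r..1} g"
    unfolding g_def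
    by (intro continuous_intros continuous_on_compose2[OF assms(1)]) auto
  then obtain h where h: "continuous_on {r..1} h" "\<And>t. t \<in> {r..1} \<Longrightarrow> g t = exp (h t)"
    by (rule continuous_logarithm_on_contractible)
      (use nz in \<open>auto intro: convex_imp_contractible\<close>)
  have A: "is_Arg (g t) (Im (h t))" if "t \<in> {r..1}" for t
    unfolding is_Arg_def h(2)[OF that] norm_exp_eq_Re
    by (subst exp_eq_polar) (simp add: cis_conv_exp)
  have "is_Arg (g 1) (Im (h 1))" "g 1 \<noteq> 0"
    using nz[of 1] A[of 1] assms(5) by simp_all
  moreover from this have "is_Arg (g 1) (b (g 1))"
    using assms(6) unfolding arg_branch_def by blast
  ultimately obtain k :: int where k: "b (g 1) = Im (h 1) + 2 * of_int k * pi"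
    using is_Arg_unique_mod_2pi by blast
  have "is_Arg (g t) (Im (h t) + 2 * of_int k * pi)" if "t \<in> {r..1}" for t
    using A[OF that] is_Arg_2pi_iff[of "g t" "Im (h t)" k]
    by (simp add: mult_ac)
  moreover have "continuous_on {r..1} (\<lambda>t. Im (h t) + 2 * of_int k * pi)"
    by (intro continuous_intros h)
  ultimately have "is_ray_lift b f z u r (\<lambda>t. Im (h t) + 2 * of_int k * pi)"
    using k unfolding is_ray_lift_def g_def by simp
  then show ?thesis by blast
qed

lemma is_ray_lift_unique:
  assumes "inj f" "cmod u = 1" "0 < r" "r \<le> 1"
    and \<phi>: "is_ray_lift b f z u r \<phi>" and \<psi>: "is_ray_lift b f z u r \<psi>" and t: "t \<in> {r..1}"
  shows "\<phi> t = \<psi> t"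
proof -
  define d where "d = (\<lambda>t. (\<psi> t - \<phi> t) / (2 * pi))"
  have "continuous_on {r..1} d"
    using \<phi> \<psi> unfolding d_def is_ray_lift_def by (intro continuous_intros) auto
  moreover have int: "d t \<in> \<int>" if "t \<in> {r..1}" for t
  proof -
    have "f (z + of_real t * u) - f z \<noteq> 0"
    proof -
      have "u \<noteq> 0" "t \<noteq> 0" using that assms(2,3) by auto
      then show ?thesis by (simp add: inj_eq[OF assms(1)])
    qed
    moreover have "is_Arg (f (z + of_real t * u) - f z) (\<phi> t)"
      "is_Arg (f (z + of_real t * u) - f z) (\<psi> t)"
      using \<phi> \<psi> that by (auto simp: is_ray_lift_def)
    ultimately obtain k :: int where "\<psi> t = \<phi> t + 2 * of_int k * pi"
      using is_Arg_unique_mod_2pi by blast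
    then show ?thesis by (simp add: d_def)
  qed
  ultimately have "d constant_on {r..1}"
  proof (intro continuous_discrete_range_constant)
    fix x assume x: "x \<in> {r..1}"
    have "1 \<le> norm (d y - d x)" if "y \<in> {r..1}" "d y \<noteq> d x" for y
      using Ints_nonzero_abs_ge1[OF Ints_diff[OF int[OF that(1)] int[OF x]]] that(2) by simp
    then show "\<exists>e>0. \<forall>y. y \<in> {r..1} \<and> d y \<noteq> d x \<longrightarrow> e \<le> norm (d y - d x)"
      by (intro exI[of _ 1]) auto
  qed auto
  then have "d t = d 1"
    using t assms by (auto simp: constant_on_def)
  also have "d 1 = 0" using \<phi> \<psi> by (simp add: d_def is_ray_lift_def)
  finally show ?thesis by (simp add: d_def)
qed

lemma ray_arg_eq:
  assumes "inj f" "0 < cmod l" "cmod l \<le> 1" "is_ray_lift b f z (sgn l) (cmod l) \<phi>"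
  shows "ray_arg b f z l = \<phi> (cmod l)"
proof -
  have u: "cmod (sgn l) = 1" using assms by (auto simp: norm_sgn)
  show ?thesis
    unfolding ray_arg_def
  proof (rule the_equality)
    show "\<exists>\<phi>'. is_ray_lift b f z (sgn l) (cmod l) \<phi>' \<and> \<phi>' (cmod l) = \<phi> (cmod l)"
      using assms(4) by blast
    fix a assume "\<exists>\<phi>'. is_ray_lift b f z (sgn l) (cmod l) \<phi>' \<and> \<phi>' (cmod l) = a"
    then obtain \<phi>' where \<phi>': "is_ray_lift b f z (sgn l) (cmod l) \<phi>'" "\<phi>' (cmod l) = a"
      by blast
    have "\<phi>' (cmod l) = \<phi> (cmod l)"
      by (rule is_ray_lift_unique[OF assms(1) u assms(2,3) \<phi>'(1) assms(4)]) (use assms(3) in simp)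
    then show "a = \<phi> (cmod l)" using \<phi>'(2) by simp
  qed
qed

end

theory Submission
  imports Defs
begin

text \<open>In the discs of generation \<open>n\<close> of a Cantor set with inner radii \<open>r\<close> and outer radii \<open>R\<close>,
  the identity is replaced by the logarithmic spiral stretch with factor \<open>|x / R|\<^bsup>k(1 + i)\<^esup>\<close>, whose distortion
  is at most \<open>2(1 + k)\<close>. If the scales decrease so fast that earlier generations do not matter, a set
  of dimension \<open>s\<close> consists of about \<open>r\<^bsup>-s\<^esup>\<close> discs of generation \<open>n\<close> that are about \<open>r\<^bsup>s/2\<^esup>\<close> apart, and \<open>R\<close>
  is taken as the geometric mean of this distance and \<open>r\<close>. The annuli have total area about
  \<open>r\<^bsup>1 - s/2\<^esup>\<close>, so \<open>k\<close> may be a multiple of \<open>(2 - s) log (1/r) / p\<close>, and one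
  annulus both contracts and rotates by \<open>k log (R/r)\<close>, which is of order \<open>(2 - s)\<^sup>2 log\<^sup>2 (1/r) / p\<close>.

  The image of an inner disc is so small that later twists contribute little to the Lipschitz constant: the
  limit map is Lipschitz, and it is differentiable off an explicit null set. This makes its weak
  derivative accessible through difference quotients.\<close>

section \<open>Lipschitz maps that are differentiable almost everywhere\<close>

text \<open>The argument is the obstacle. A ray from a point of \<open>A\<close> may cross many
  foreign discs, and the winding picked up there cannot be read off the discs that contain the
  point. Instead, consecutive approximations \<open>F n\<close> are compared: the increment of
  \<open>F (Suc n)\<close> seen from the point, divided by that of \<open>F n\<close> and by the
  twist factor of the one disc around the point, stays in the right half-plane along the whole ray.
  The error is therefore linear in the number of generations, whereas the main term is quadratic in
  the logarithm of the scale and absorbs both this error and the branch.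

  The maps \<open>F n\<close> have two descriptions. As partial sums of displacements they converge
  and have controlled Lipschitz constants; as compositions of single generations they are injective
  and their differentials are computable. The two agree because each approximation is affine on the
  discs in which the next generation acts.

  The exponent \<open>k(1 + i)\<close> has equal real and imaginary parts, so contraction and
  rotation proceed at the same rate, and the two final constants differ only by what the errors
  cost.\<close>

lemma sense_preserving_homeoI:
  assumes cont: "continuous_on UNIV f" and inj: "inj f"
    and id: "\<And>z. 1 \<le> cmod z \<Longrightarrow> f z = z"
  shows "sense_preserving_homeo f"
proof -
  have op: "open (range f)"
    using cont inj by (intro invariance_of_domain) auto
  \<comment> \<open>A compact image together with the exterior, where \<open>f\<close> is the
    identity: the range is closed as well as open.\<close>
  have eq: "range f = f ` cball 0 1 \<union> - ball 0 1"
  proof (intro equalityI subsetI)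
    fix y assume "y \<in> range f"
    then obtain x where x: "y = f x" by auto
    show "y \<in> f ` cball 0 1 \<union> - ball 0 1"
      using id[of x] x by (cases "cmod x \<le> 1") auto
  next
    fix y assume "y \<in> f ` cball 0 1 \<union> - ball 0 1"
    then show "y \<in> range f" using id[of y] by (auto simp: image_iff) (metis)
  qed
  have "compact (f ` cball 0 1)"
    by (rule compact_continuous_image) (auto intro: continuous_on_subset[OF cont])
  then have "closed (range f)"
    unfolding eq by (intro closed_Un) (auto simp: compact_imp_closed closed_Compl)
  with op have surj: "range f = UNIV"
    using connected_UNIV[where 'a=complex] unfolding connected_clopen
    by (metis UNIV_not_empty closed_closedin image_is_empty open_openin subtopology_UNIV
        topspace_euclidean)
  obtain g where g: "homeomorphism UNIV (range f) f g"
    using invariance_of_domain_homeomorphism[OF open_UNIV cont] inj by auto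
  have "winding_number (f \<circ> circlepath z r) (f z) = 1" if r: "0 < r" for z r
  proof -
    \<comment> \<open>A circle this large lies where \<open>f\<close> is the identity and encloses
      \<open>f z\<close>. It is homotopic to the given circle off \<open>z\<close>, and injectivity
      keeps the image of the homotopy off \<open>f z\<close>.\<close>
    define M where "M = r + cmod z + cmod (f z) + 1"
    have M: "0 < M" "r \<le> M" unfolding M_def using r by (auto simp: add_nonneg_pos)
    have "homotopic_loops (- {z}) (circlepath z r) (circlepath z M)"
    proof (rule homotopic_loops_linear)
      fix t :: real assume "t \<in> {0..1}"
      show "closed_segment (circlepath z r t) (circlepath z M t) \<subseteq> - {z}"
      proof
        fix y assume "y \<in> closed_segment (circlepath z r t) (circlepath z M t)"
        then obtain u where u: "0 \<le> u" "u \<le> 1"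
            "y = (1 - u) *\<^sub>R circlepath z r t + u *\<^sub>R circlepath z M t"
          by (auto simp: closed_segment_def)
        have "y - z = of_real ((1 - u) * r + u * M) * exp (2 * of_real pi * \<i> * of_real t)"
          using u(3) by (simp add: circlepath scaleR_conv_of_real algebra_simps)
        moreover have "(1 - u) * r + u * M > 0"
        proof -
          have "(1 - u) * r + u * M = r + u * (M - r)" by (simp add: algebra_simps)
          then show ?thesis using u r M by (simp add: add_pos_nonneg)
        qed
        ultimately have "y - z \<noteq> 0"
          by (metis exp_not_eq_zero less_irrefl mult_eq_0_iff of_real_eq_0_iff)
        then show "y \<in> - {z}" by auto
      qed
    qed auto
    then have "homotopic_loops (- {f z}) (f \<circ> circlepath z r) (f \<circ> circlepath z M)"
      by (rule homotopic_loops_continuous_image)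
        (auto intro: continuous_on_subset[OF cont] simp: inj_eq[OF inj])
    then have "winding_number (f \<circ> circlepath z r) (f z)
        = winding_number (f \<circ> circlepath z M) (f z)"
      by (rule winding_number_homotopic_loops)
    also have "f \<circ> circlepath z M = circlepath z M"
    proof
      fix t
      have "cmod (circlepath z M t - z) = M"
        using M by (simp add: circlepath norm_mult)
      then have "M \<le> cmod (circlepath z M t) + cmod z"
        by (metis norm_triangle_ineq4)
      then have "1 \<le> cmod (circlepath z M t)"
        using r norm_ge_zero[of "f z"] unfolding M_def by linarith
      then show "(f \<circ> circlepath z M) t = circlepath z M t" by (simp add: id)
    qed
    also have "winding_number (circlepath z M) (f z) = 1"
    proof (rule winding_number_circlepath)
      have "cmod (f z - z) \<le> cmod (f z) + cmod z" by (rule norm_triangle_ineq4)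
      then show "cmod (f z - z) < M" using r unfolding M_def by linarith
    qed
    finally show ?thesis .
  qed
  then show ?thesis using g surj unfolding sense_preserving_homeo_def by auto
qed

section \<open>Weak derivatives from difference quotients\<close>

lemma has_derivative_difference_quotient:
  fixes f :: "'a :: real_normed_vector \<Rightarrow> 'b :: real_normed_vector"
  assumes "(f has_derivative D) (at z)"
  shows "(\<lambda>n. real (Suc n) *\<^sub>R (f (z + (1 / real (Suc n)) *\<^sub>R e) - f z)) \<longlonglongrightarrow> D e"
proof (cases "e = 0")
  case True
  then show ?thesis
    using linear_0[OF has_derivative_linear[OF assms]] by simp
next
  case False
  define h where "h = (\<lambda>n. (1 / real (Suc n)) *\<^sub>R e)"
  have "h \<longlonglongrightarrow> 0 *\<^sub>R e"
    unfolding h_def by (intro tendsto_intros LIMSEQ_Suc[OF lim_1_over_n])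
  then have "filterlim h (at 0) sequentially"
    using False by (auto simp: filterlim_at h_def)
  moreover have "((\<lambda>h. norm (f (z + h) - f z - D h) / norm h) \<longlongrightarrow> 0) (at 0)"
    using assms by (simp add: has_derivative_at)
  ultimately have "(\<lambda>n. norm (f (z + h n) - f z - D (h n)) / norm (h n)) \<longlonglongrightarrow> 0"
    by (rule filterlim_compose[rotated])
  then have "(\<lambda>n. norm e * (norm (f (z + h n) - f z - D (h n)) / norm (h n))) \<longlonglongrightarrow> norm e * 0"
    by (intro tendsto_intros)
  moreover have "norm e * (norm (f (z + h n) - f z - D (h n)) / norm (h n))
      = norm (real (Suc n) *\<^sub>R (f (z + h n) - f z) - D e)" for n
  proof -
    have "D (h n) = (1 / real (Suc n)) *\<^sub>R D e"
      unfolding h_def by (rule linear_scale[OF has_derivative_linear[OF assms]])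
    then have "real (Suc n) *\<^sub>R (f (z + h n) - f z) - D e
        = real (Suc n) *\<^sub>R (f (z + h n) - f z - D (h n))"
      by (simp add: scaleR_diff_right del: of_nat_Suc)
    then have 1: "norm (real (Suc n) *\<^sub>R (f (z + h n) - f z) - D e)
        = real (Suc n) * norm (f (z + h n) - f z - D (h n))"
      by (metis abs_of_nat norm_scaleR)
    have 2: "norm (h n) = norm e / real (Suc n)" by (simp add: h_def)
    show ?thesis unfolding 1 2 using False by (simp del: of_nat_Suc)
  qed
  ultimately have "(\<lambda>n. norm (real (Suc n) *\<^sub>R (f (z + h n) - f z) - D e)) \<longlonglongrightarrow> 0" by simp
  then have "(\<lambda>n. real (Suc n) *\<^sub>R (f (z + h n) - f z)) \<longlonglongrightarrow> D e"
    by (rule LIM_zero_cancel[OF tendsto_norm_zero_cancel])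
  then show ?thesis by (simp add: h_def)
qed

lemma lborel_integral_translate:
  fixes f :: "'a::euclidean_space \<Rightarrow> 'b::{banach, second_countable_topology}"
  assumes "f \<in> borel_measurable borel"
  shows "(LINT x|lborel. f (x + c)) = (LINT x|lborel. f x)"
proof -
  have "(LINT x|lborel. f x) = (LINT x|distr lborel borel ((+) c). f x)"
    by (simp add: lborel_distr_plus)
  also have "\<dots> = (LINT x|lborel. f (c + x))"
    using assms by (intro integral_distr) auto
  finally show ?thesis by (simp add: add.commute)
qed

lemma integrable_continuous_compact_support:
  fixes f :: "'a::euclidean_space \<Rightarrow> 'b::{banach, second_countable_topology}"
  assumes "continuous_on UNIV f" "compact S" "\<And>x. x \<notin> S \<Longrightarrow> f x = 0"
  shows "integrable lborel f"
proof -
  have "integrable lborel (\<lambda>x. indicator S x *\<^sub>R f x)"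
    by (intro borel_integrable_compact assms continuous_on_subset[OF assms(1)]) auto
  also have "(\<lambda>x. indicator S x *\<^sub>R f x) = f"
    using assms(3) by (auto simp: indicator_def fun_eq_iff)
  finally show ?thesis .
qed

lemma test_function_has_derivative:
  assumes "test_function \<phi>"
  shows "(\<phi> has_derivative frechet_derivative \<phi> (at z)) (at z)"
proof -
  have "k_times_cont_diff (Suc 0) \<phi>" using assms unfolding test_function_def by blast
  then show ?thesis by (auto simp: frechet_derivative_works)
qed

lemma test_function_derivative_continuous:
  assumes "test_function \<phi>"
  shows "continuous_on UNIV (\<lambda>z. frechet_derivative \<phi> (at z) e)"
proof -
  have "k_times_cont_diff (Suc 0) \<phi>" using assms unfolding test_function_def by blast
  then show ?thesis by auto
qed

lemma test_function_support:
  assumes "test_function \<phi>"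
  obtains \<rho> where "0 < \<rho>" "\<And>z. \<rho> \<le> cmod z \<Longrightarrow> \<phi> z = 0"
proof -
  have "bounded (closure {z. \<phi> z \<noteq> 0})"
    using assms by (simp add: test_function_def compact_imp_bounded)
  then obtain B where B: "\<And>z. z \<in> closure {z. \<phi> z \<noteq> 0} \<Longrightarrow> cmod z \<le> B" "0 < B"
    by (auto simp: bounded_pos)
  show thesis
  proof (rule that[of "B + 1"])
    fix z assume "B + 1 \<le> cmod z"
    then show "\<phi> z = 0" using B(1)[of z] closure_subset[of "{z. \<phi> z \<noteq> 0}"] by force
  qed (use B in simp)
qed

text \<open>Each directional derivative is continuous and vanishes off a ball, hence is bounded; by
  linearity the directions \<open>1\<close> and \<open>\<i>\<close> control the operator norm. The
  constant dominates the difference quotients of \<open>\<phi>\<close> in the integration by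
  parts.\<close>

lemma test_function_lipschitz:
  assumes "test_function \<phi>"
  obtains L where "0 \<le> L" "\<And>x y. \<bar>\<phi> x - \<phi> y\<bar> \<le> L * cmod (x - y)"
proof -
  obtain \<rho> where \<rho>: "0 < \<rho>" "\<And>z. \<rho> \<le> cmod z \<Longrightarrow> \<phi> z = 0"
    using test_function_support[OF assms] by blast
  have "\<exists>B. 0 \<le> B \<and> (\<forall>z. \<bar>frechet_derivative \<phi> (at z) e\<bar> \<le> B)" for e
  proof -
    have "compact ((\<lambda>z. frechet_derivative \<phi> (at z) e) ` cball 0 \<rho>)"
      by (intro compact_continuous_image
            continuous_on_subset[OF test_function_derivative_continuous[OF assms]]) auto
    then obtain B where B: "\<And>z. cmod z \<le> \<rho> \<Longrightarrow> \<bar>frechet_derivative \<phi> (at z) e\<bar> \<le> B"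
      by (force dest: compact_imp_bounded simp: bounded_iff)
    have "frechet_derivative \<phi> (at z) e = 0" if z: "\<rho> < cmod z" for z
    proof -
      have "open (- cball 0 \<rho> :: complex set)" by auto
      moreover have "z \<in> - cball 0 \<rho>" using z by auto
      ultimately have "(\<phi> has_derivative (\<lambda>_. 0)) (at z)"
        by (rule has_derivative_transform_within_open[OF has_derivative_const[of 0]])
          (use \<rho>(2) in auto)
      then show ?thesis using test_function_has_derivative[OF assms] has_derivative_unique
        by metis
    qed
    then have "\<bar>frechet_derivative \<phi> (at z) e\<bar> \<le> max B 0" for z
      using B[of z] by (cases "cmod z \<le> \<rho>") auto
    then show ?thesis by (meson max.cobounded2)
  qed
  then obtain B where B: "\<And>e. 0 \<le> B e" "\<And>e z. \<bar>frechet_derivative \<phi> (at z) e\<bar> \<le> B e"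
    by metis
  have "norm (\<phi> x - \<phi> y) \<le> (B 1 + B \<i>) * norm (x - y)" for x y
  proof (rule differentiable_bound[OF convex_UNIV])
    fix z :: complex
    show "(\<phi> has_derivative frechet_derivative \<phi> (at z)) (at z within UNIV)"
      by (simp add: test_function_has_derivative[OF assms])
    show "onorm (frechet_derivative \<phi> (at z)) \<le> B 1 + B \<i>"
    proof (rule onorm_le)
      fix e :: complex
      have lin: "linear (frechet_derivative \<phi> (at z))"
        by (rule has_derivative_linear[OF test_function_has_derivative[OF assms]])
      have "e = Re e *\<^sub>R 1 + Im e *\<^sub>R \<i>" by (simp add: complex_eq_iff)
      then have "frechet_derivative \<phi> (at z) e
          = Re e *\<^sub>R frechet_derivative \<phi> (at z) 1 + Im e *\<^sub>R frechet_derivative \<phi> (at z) \<i>"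
        by (metis linear_add[OF lin] linear_scale[OF lin])
      then have "norm (frechet_derivative \<phi> (at z) e)
          \<le> \<bar>Re e\<bar> * \<bar>frechet_derivative \<phi> (at z) 1\<bar> + \<bar>Im e\<bar> * \<bar>frechet_derivative \<phi> (at z) \<i>\<bar>"
        by (metis abs_mult norm_triangle_ineq real_norm_def real_scaleR_def)
      also have "\<dots> \<le> cmod e * B 1 + cmod e * B \<i>"
        by (intro add_mono mult_mono B abs_Re_le_cmod abs_Im_le_cmod) auto
      finally show "norm (frechet_derivative \<phi> (at z) e) \<le> (B 1 + B \<i>) * norm e"
        by (simp add: algebra_simps)
    qed
  qed auto
  then show thesis using B(1) that[of "B 1 + B \<i>"] by auto
qed

text \<open>Integration by parts at the level of difference quotients, followed by dominated
  convergence on both sides.\<close>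

lemma weak_derivative_lipschitz:
  fixes f :: "complex \<Rightarrow> complex"
  assumes lip: "\<And>x y. cmod (f x - f y) \<le> L * cmod (x - y)"
    and G: "G \<in> sets borel" "- G \<in> null_sets lborel"
    and D: "\<And>z. z \<in> G \<Longrightarrow> (f has_derivative D z) (at z)"
    and D': "\<And>z. z \<notin> G \<Longrightarrow> D z = id"
  shows "(\<lambda>z. D z e) \<in> borel_measurable borel"
    and "cmod (D z e) \<le> (L + 1) * cmod e"
    and "weak_derivative f D"
proof -
  have L: "0 \<le> L" using order_trans[OF norm_ge_zero lip[of 1 0]] by simp
  have cf: "continuous_on UNIV f"
    by (rule lipschitz_on_continuous_on[of L], rule lipschitz_onI) (auto simp: dist_norm lip L)
  then have mf[measurable]: "f \<in> borel_measurable borel"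
    by (rule borel_measurable_continuous_onI)
  have lim: "(\<lambda>n. real (Suc n) *\<^sub>R (f (z + (1 / real (Suc n)) *\<^sub>R e) - f z)) \<longlonglongrightarrow> D z e"
    if "z \<in> G" for z e
    by (rule has_derivative_difference_quotient[OF D[OF that]])
  have meas: "(\<lambda>z. D z e) \<in> borel_measurable borel" for e
  proof -
    have [measurable]: "G \<in> sets borel" by (rule G)
    \<comment> \<open>A pointwise limit of Borel functions; off \<open>G\<close> the constant
      sequence \<open>e\<close> reproduces the value \<open>id\<close>.\<close>
    have eq: "(\<lambda>z. D z e) = (\<lambda>z. lim (\<lambda>n. if z \<in> G then real (Suc n) *\<^sub>R (f (z + (1 / real (Suc n)) *\<^sub>R e) - f z) else e))"
    proof
      fix z :: complex
      show "D z e = lim (\<lambda>n. if z \<in> G then real (Suc n) *\<^sub>R (f (z + (1 / real (Suc n)) *\<^sub>R e) - f z) else e)"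
        using limI[OF lim[of z e]] D'[of z] by (cases "z \<in> G") auto
    qed
    show ?thesis unfolding eq by measurable
  qed
  have quot: "cmod (real (Suc n) *\<^sub>R (f (z + (1 / real (Suc n)) *\<^sub>R e) - f z)) \<le> L * cmod e" for n z e
  proof -
    have "cmod (real (Suc n) *\<^sub>R (f (z + (1 / real (Suc n)) *\<^sub>R e) - f z))
        \<le> real (Suc n) * (L * cmod ((1 / real (Suc n)) *\<^sub>R e))"
      unfolding norm_scaleR abs_of_nat
      using lip[of "z + (1 / real (Suc n)) *\<^sub>R e" z] by (intro mult_left_mono) (auto simp del: of_nat_Suc)
    also have "\<dots> = L * cmod e" by (simp del: of_nat_Suc)
    finally show ?thesis .
  qed
  \<comment> \<open>The \<open>1\<close> accounts for the value \<open>id\<close> off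
    \<open>G\<close>, since the estimate is claimed at every point.\<close>
  have bound: "cmod (D z e) \<le> (L + 1) * cmod e" for z e
  proof (cases "z \<in> G")
    case True
    have "cmod (D z e) \<le> L * cmod e"
      by (rule tendsto_upperbound[OF tendsto_norm[OF lim[OF True]] always_eventually[OF allI]])
        (rule quot, simp)
    then show ?thesis using norm_ge_zero[of e] unfolding distrib_right mult_1 by linarith
  next
    case False
    then show ?thesis using L D'[OF False] by (simp add: algebra_simps)
  qed
  show "(\<lambda>z. D z e) \<in> borel_measurable borel" by (rule meas)
  show "cmod (D z e) \<le> (L + 1) * cmod e" by (rule bound)
  show "weak_derivative f D"
    unfolding weak_derivative_def
  proof (intro conjI allI impI)
    fix z show "linear (D z)"
      using has_derivative_linear[OF D[of z]] D'[of z] by (cases "z \<in> G") (auto simp: id_def linear_iff)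
  next
    fix e :: complex show "loc_integrable (\<lambda>z. D z e)"
      unfolding loc_integrable_def set_integrable_def
    proof (intro allI impI)
      fix S :: "complex set" assume S: "compact S"
      have "integrable lborel (\<lambda>z. indicator S z *\<^sub>R D z e)"
      proof (rule integrableI_bounded_set_indicator[where B="(L+1) * cmod e"])
        show "emeasure lborel S < \<infinity>" using S by (rule emeasure_compact_finite)
      qed (use S meas bound in \<open>auto intro: borel_compact\<close>)
      then show "integrable lebesgue (\<lambda>z. indicator S z *\<^sub>R D z e)"
        by (simp add: integrable_completion borel_measurable_integrable)
    qed
  next
    fix e :: complex and \<phi> :: "complex \<Rightarrow> real" assume \<phi>: "test_function \<phi>"
    obtain \<rho> where \<rho>: "0 < \<rho>" "\<And>z. \<rho> \<le> cmod z \<Longrightarrow> \<phi> z = 0"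
      using test_function_support[OF \<phi>] by blast
    obtain B where B: "0 \<le> B" "\<And>x y. \<bar>\<phi> x - \<phi> y\<bar> \<le> B * cmod (x - y)"
      using test_function_lipschitz[OF \<phi>] by blast
    have c\<phi>: "continuous_on UNIV \<phi>"
      by (rule lipschitz_on_continuous_on[of B], rule lipschitz_onI) (auto simp: dist_norm B)
    then have m\<phi>[measurable]: "\<phi> \<in> borel_measurable borel"
      by (rule borel_measurable_continuous_onI)
    define h where "h = (\<lambda>n. (1 / real (Suc n)) *\<^sub>R e)"
    have hle: "cmod (h n) \<le> cmod e" for n
    proof -
      have "cmod e * 1 \<le> cmod e * real (Suc n)" by (intro mult_left_mono) auto
      then show ?thesis unfolding h_def by (simp add: divide_le_eq)
    qed
    define P where "P = (\<lambda>n. LINT z|lborel. \<phi> z *\<^sub>R (real (Suc n) *\<^sub>R (f (z + h n) - f z)))"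
    have "P \<longlonglongrightarrow> (LINT z|lborel. \<phi> z *\<^sub>R D z e)"
      unfolding P_def
    proof (rule integral_dominated_convergence[where w="\<lambda>z. \<bar>\<phi> z\<bar> * (L * cmod e)"])
      show "(\<lambda>z. \<phi> z *\<^sub>R D z e) \<in> borel_measurable lborel" using meas[of e] by simp
      show "integrable lborel (\<lambda>z. \<bar>\<phi> z\<bar> * (L * cmod e))"
        using \<rho> by (intro integrable_continuous_compact_support[where S="cball 0 \<rho>"] continuous_intros c\<phi>) auto
      have "AE z in lborel. z \<in> G"
        using G(2) by (auto intro: AE_I'[of "- G"])
      then show "AE z in lborel. (\<lambda>n. \<phi> z *\<^sub>R (real (Suc n) *\<^sub>R (f (z + h n) - f z))) \<longlonglongrightarrow> \<phi> z *\<^sub>R D z e"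
        unfolding h_def by eventually_elim (intro tendsto_intros lim)
      show "AE z in lborel. cmod (\<phi> z *\<^sub>R (real (Suc n) *\<^sub>R (f (z + h n) - f z))) \<le> \<bar>\<phi> z\<bar> * (L * cmod e)" for n
        unfolding norm_scaleR[of "\<phi> _"] h_def by (intro AE_I2 mult_left_mono quot abs_ge_zero)
    qed (simp add: measurable_lborel2)
    moreover have "P \<longlonglongrightarrow> (LINT z|lborel. (- frechet_derivative \<phi> (at z) e) *\<^sub>R f z)"
    proof -
      have "P n = (LINT z|lborel. (real (Suc n) * (\<phi> (z - h n) - \<phi> z)) *\<^sub>R f z)" for n
      proof -
        have int: "integrable lborel (\<lambda>z. \<phi> z *\<^sub>R f (z + c))" for c
          using \<rho> by (intro integrable_continuous_compact_support[where S="cball 0 \<rho>"] continuous_intros c\<phi>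
              continuous_on_compose2[OF cf]) auto
        have int': "integrable lborel (\<lambda>z. \<phi> (z - h n) *\<^sub>R f z)"
        proof (rule integrable_continuous_compact_support[where S="cball 0 (\<rho> + cmod (h n))"])
          fix z :: complex assume "z \<notin> cball 0 (\<rho> + cmod (h n))"
          then have "\<rho> \<le> cmod (z - h n)" using norm_triangle_ineq2[of z "h n"] by auto
          then show "\<phi> (z - h n) *\<^sub>R f z = 0" by (simp add: \<rho>)
        qed (auto intro!: continuous_intros continuous_on_compose2[OF c\<phi>] cf)
        have "P n = real (Suc n) *\<^sub>R (LINT z|lborel. \<phi> z *\<^sub>R f (z + h n) - \<phi> z *\<^sub>R f z)"
          unfolding P_def by (subst integral_scaleR_right[symmetric])
            (auto intro!: Bochner_Integration.integral_cong simp: algebra_simps)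
        also have "(LINT z|lborel. \<phi> z *\<^sub>R f (z + h n) - \<phi> z *\<^sub>R f z)
            = (LINT z|lborel. \<phi> z *\<^sub>R f (z + h n)) - (LINT z|lborel. \<phi> z *\<^sub>R f z)"
          using int[of "h n"] int[of 0] by (intro Bochner_Integration.integral_diff) auto
        also have "(LINT z|lborel. \<phi> z *\<^sub>R f (z + h n)) = (LINT z|lborel. \<phi> (z - h n) *\<^sub>R f z)"
          using lborel_integral_translate[of "\<lambda>z. \<phi> (z - h n) *\<^sub>R f z" "h n"] by simp
        also have "\<dots> - (LINT z|lborel. \<phi> z *\<^sub>R f z) = (LINT z|lborel. \<phi> (z - h n) *\<^sub>R f z - \<phi> z *\<^sub>R f z)"
          using int' int[of 0] by (intro Bochner_Integration.integral_diff[symmetric]) auto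
        also have "real (Suc n) *\<^sub>R \<dots> = (LINT z|lborel. (real (Suc n) * (\<phi> (z - h n) - \<phi> z)) *\<^sub>R f z)"
          by (subst integral_scaleR_right[symmetric])
            (auto intro!: Bochner_Integration.integral_cong simp: algebra_simps)
        finally show ?thesis .
      qed
      moreover have "(\<lambda>n. LINT z|lborel. (real (Suc n) * (\<phi> (z - h n) - \<phi> z)) *\<^sub>R f z)
          \<longlonglongrightarrow> (LINT z|lborel. (- frechet_derivative \<phi> (at z) e) *\<^sub>R f z)"
      \<comment> \<open>After the translation the supports move with \<open>n\<close>. As
        \<open>h n\<close> is never longer than \<open>e\<close>, one fixed ball contains them
        all.\<close>
      proof (rule integral_dominated_convergence
          [where w="\<lambda>z. indicator (cball 0 (\<rho> + cmod e)) z *\<^sub>R (B * cmod e * cmod (f z))"])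
        show "(\<lambda>z. (- frechet_derivative \<phi> (at z) e) *\<^sub>R f z) \<in> borel_measurable lborel"
          using borel_measurable_continuous_onI[OF test_function_derivative_continuous[OF \<phi>, of e]] by simp
        show "integrable lborel (\<lambda>z. indicator (cball 0 (\<rho> + cmod e)) z *\<^sub>R (B * cmod e * cmod (f z)))"
          by (intro borel_integrable_compact continuous_intros continuous_on_subset[OF cf]) auto
        show "AE z in lborel. (\<lambda>n. (real (Suc n) * (\<phi> (z - h n) - \<phi> z)) *\<^sub>R f z)
            \<longlonglongrightarrow> (- frechet_derivative \<phi> (at z) e) *\<^sub>R f z"
        proof (intro AE_I2 tendsto_intros)
          fix z :: complex
          have "frechet_derivative \<phi> (at z) (- e) = - frechet_derivative \<phi> (at z) e"
            by (rule linear_neg[OF has_derivative_linear[OF test_function_has_derivative[OF \<phi>]]])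
          then show "(\<lambda>n. real (Suc n) * (\<phi> (z - h n) - \<phi> z)) \<longlonglongrightarrow> - frechet_derivative \<phi> (at z) e"
            using has_derivative_difference_quotient[OF test_function_has_derivative[OF \<phi>, of z], of "- e"]
            by (simp add: h_def)
        qed
        show "AE z in lborel. cmod ((real (Suc n) * (\<phi> (z - h n) - \<phi> z)) *\<^sub>R f z)
            \<le> indicator (cball 0 (\<rho> + cmod e)) z *\<^sub>R (B * cmod e * cmod (f z))" for n
        proof (intro AE_I2)
          fix z :: complex
          show "cmod ((real (Suc n) * (\<phi> (z - h n) - \<phi> z)) *\<^sub>R f z)
            \<le> indicator (cball 0 (\<rho> + cmod e)) z *\<^sub>R (B * cmod e * cmod (f z))"
          proof (cases "z \<in> cball 0 (\<rho> + cmod e)")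
            case True
            have "real (Suc n) * \<bar>\<phi> (z - h n) - \<phi> z\<bar> \<le> real (Suc n) * (B * cmod (h n))"
              using B(2)[of "z - h n" z] by (intro mult_left_mono) auto
            also have "\<dots> = B * cmod e" by (simp add: h_def del: of_nat_Suc)
            finally have "\<bar>real (Suc n) * (\<phi> (z - h n) - \<phi> z)\<bar> * cmod (f z) \<le> B * cmod e * cmod (f z)"
              unfolding abs_mult abs_of_nat by (rule mult_right_mono) simp
            then show ?thesis using True by simp
          next
            case False
            then have "\<rho> + cmod e < cmod z" by simp
            then have "\<rho> \<le> cmod (z - h n)" "\<rho> \<le> cmod z"
              using norm_triangle_ineq2[of z "h n"] hle[of n] norm_ge_zero[of e] by linarith+
            then show ?thesis using False by (simp add: \<rho>)
          qed
        qed
      qed (simp add: measurable_lborel2)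
      ultimately show ?thesis by presburger
    qed
    ultimately have "(LINT z|lborel. \<phi> z *\<^sub>R D z e) = (LINT z|lborel. (- frechet_derivative \<phi> (at z) e) *\<^sub>R f z)"
      by (rule LIMSEQ_unique)
    also have "\<dots> = - (LINT z|lborel. frechet_derivative \<phi> (at z) e *\<^sub>R f z)"
      by (simp flip: integral_minus)
    finally have "(LINT z|lborel. frechet_derivative \<phi> (at z) e *\<^sub>R f z) = - (LINT z|lborel. \<phi> z *\<^sub>R D z e)"
      by simp
    then show "(LINT z|lebesgue. frechet_derivative \<phi> (at z) e *\<^sub>R f z) = - (LINT z|lebesgue. \<phi> z *\<^sub>R D z e)"
      using meas[of e] borel_measurable_continuous_onI[OF test_function_derivative_continuous[OF \<phi>, of e]]
      by (simp add: integral_completion measurable_lborel2)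
  qed
qed

section \<open>Real-linear maps in Wirtinger form, and a criterion for exponentially integrable
  distortion\<close>

lemma onorm_wirtinger: "onorm (\<lambda>e. a * e + b * cnj e) = cmod a + cmod b"
proof (rule antisym)
  show "onorm (\<lambda>e. a * e + b * cnj e) \<le> cmod a + cmod b"
  proof (rule onorm_le)
    fix e show "cmod (a * e + b * cnj e) \<le> (cmod a + cmod b) * cmod e"
      using norm_triangle_ineq[of "a * e" "b * cnj e"] by (simp add: norm_mult algebra_simps)
  qed
  \<comment> \<open>In this direction \<open>a * e\<close> and \<open>b * cnj e\<close> have the
    same argument, so the triangle inequality becomes an equality.\<close>
  define e where "e = cis ((Arg b - Arg a) / 2)"
  have "a * e = of_real (cmod a) * cis ((Arg a + Arg b) / 2)"
    by (subst rcis_cmod_Arg[of a, symmetric]) (simp add: e_def rcis_def cis_mult field_simps)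
  moreover have "b * cnj e = of_real (cmod b) * cis ((Arg a + Arg b) / 2)"
    by (subst rcis_cmod_Arg[of b, symmetric])
      (simp add: e_def rcis_def cis_mult field_simps cis_cnj)
  ultimately have "a * e + b * cnj e = of_real (cmod a + cmod b) * cis ((Arg a + Arg b) / 2)"
    by (simp add: algebra_simps)
  then have "cmod (a * e + b * cnj e) = cmod a + cmod b"
    by (simp add: norm_mult flip: of_real_add)
  moreover have "bounded_linear (\<lambda>e. a * e + b * cnj e)"
    by (intro bounded_linear_add bounded_linear_mult_right
        bounded_linear_compose[OF bounded_linear_mult_right bounded_linear_cnj])
  from onorm[OF this, of e] have "cmod (a * e + b * cnj e) \<le> onorm (\<lambda>e. a * e + b * cnj e)"
    by (simp add: e_def)
  ultimately show "cmod a + cmod b \<le> onorm (\<lambda>e. a * e + b * cnj e)" by simp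
qed

lemma jacobian_wirtinger:
  "jacobian_det (\<lambda>e. a * e + b * cnj e) = (cmod a)\<^sup>2 - (cmod b)\<^sup>2"
  unfolding cmod_power2 by (simp add: jacobian_det_def power2_eq_square algebra_simps)

text \<open>The coefficients are the two Wirtinger derivatives. They are Borel functions of the
  point once \<open>D z 1\<close> and \<open>D z \<i>\<close> are, and so are the operator norm and
  the Jacobian expressed through them.\<close>

lemma linear_eq_wirtinger:
  fixes D :: "complex \<Rightarrow> complex"
  assumes "linear D"
  shows "D = (\<lambda>e. (D 1 - \<i> * D \<i>) / 2 * e + (D 1 + \<i> * D \<i>) / 2 * cnj e)"
proof
  fix e
  have "e = Re e *\<^sub>R 1 + Im e *\<^sub>R \<i>" by (simp add: complex_eq_iff)
  then have "D e = of_real (Re e) * D 1 + of_real (Im e) * D \<i>"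
    by (metis linear_add[OF assms] linear_scale[OF assms] scaleR_conv_of_real)
  also have "\<dots> = (D 1 - \<i> * D \<i>) / 2 * e + (D 1 + \<i> * D \<i>) / 2 * cnj e"
    by (simp add: complex_eq_iff field_simps)
  finally show "D e = (D 1 - \<i> * D \<i>) / 2 * e + (D 1 + \<i> * D \<i>) / 2 * cnj e" .
qed

text \<open>Reduces the analytic claim to areas. At a point of \<open>G\<close> the distortion is
  \<open>1\<close> or at most \<open>q n\<close> for some \<open>S n\<close> containing the point,
  so \<open>exp (p * K)\<close> is dominated by \<open>exp p\<close> plus the sum of the
  \<open>exp (p * q n)\<close> on the \<open>S n\<close>, which may overlap.\<close>

lemma exp_integrable_distortionI:
  fixes f :: "complex \<Rightarrow> complex" and q :: "nat \<Rightarrow> real"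
  assumes homeo: "sense_preserving_homeo f"
    and lip: "\<And>x y. cmod (f x - f y) \<le> L * cmod (x - y)"
    and G: "G \<in> sets borel" "- G \<in> null_sets lborel"
    and S: "\<And>n. S n \<in> sets borel"
    and p: "0 < p"
    and q: "\<And>n. 1 \<le> q n"
    and diff: "\<And>z. z \<in> G \<Longrightarrow> \<exists>D. (f has_derivative D) (at z) \<and>
        ((onorm D)\<^sup>2 \<le> jacobian_det D \<or> (\<exists>n. z \<in> S n \<and> (onorm D)\<^sup>2 \<le> q n * jacobian_det D))"
    and sum: "(\<Sum>n. ennreal (exp (p * q n)) * emeasure lborel (S n)) < \<infinity>"
  shows "exp_integrable_distortion p f"
proof -
  define D where "D = (\<lambda>z. if z \<in> G then frechet_derivative f (at z) else id)"
  have D_der: "(f has_derivative D z) (at z)" if "z \<in> G" for z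
    using diff[OF that] unfolding D_def by (auto simp: that dest: frechet_derivative_at)
  have D_id: "D z = id" if "z \<notin> G" for z using that by (simp add: D_def)
  note weak = weak_derivative_lipschitz[OF lip G D_der D_id]
  have L: "0 \<le> L" using order_trans[OF norm_ge_zero lip[of 1 0]] by simp
  define \<alpha> where "\<alpha> = (\<lambda>z. (D z 1 - \<i> * D z \<i>) / 2)"
  define \<beta> where "\<beta> = (\<lambda>z. (D z 1 + \<i> * D z \<i>) / 2)"
  have lin: "linear (D z)" for z using weak(3) by (simp add: weak_derivative_def)
  have D_eq: "D z = (\<lambda>e. \<alpha> z * e + \<beta> z * cnj e)" for z
    unfolding \<alpha>_def \<beta>_def by (rule linear_eq_wirtinger[OF lin])
  have on: "onorm (D z) = cmod (\<alpha> z) + cmod (\<beta> z)" for z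
    unfolding D_eq by (rule onorm_wirtinger)
  have jac: "jacobian_det (D z) = (cmod (\<alpha> z))\<^sup>2 - (cmod (\<beta> z))\<^sup>2" for z
    unfolding D_eq by (rule jacobian_wirtinger)
  have [measurable]: "\<alpha> \<in> borel_measurable borel" "\<beta> \<in> borel_measurable borel"
    unfolding \<alpha>_def \<beta>_def using weak(1)[of 1] weak(1)[of \<i>] by auto
  have mon[measurable]: "(\<lambda>z. onorm (D z)) \<in> borel_measurable borel" unfolding on by measurable
  have mjac[measurable]: "(\<lambda>z. jacobian_det (D z)) \<in> borel_measurable borel"
    unfolding jac by measurable
  have [measurable]: "G \<in> sets borel" by (rule G)
  have AEG: "AE z in lebesgue. z \<in> G"
    using G(2) by (intro AE_completion) (auto intro: AE_I'[of "- G"])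
  \<comment> \<open>Division by zero gives \<open>0\<close>, so \<open>K\<close> is \<open>1\<close>
    where the Jacobian vanishes. The distortion inequality survives there, because the assumption on
    the differential forces its norm to vanish too.\<close>
  define K where "K = (\<lambda>z. if z \<in> G then max 1 ((onorm (D z))\<^sup>2 / jacobian_det (D z)) else 1)"
  have mK[measurable]: "K \<in> borel_measurable borel" unfolding K_def by measurable
  have q': "(onorm (D z))\<^sup>2 \<le> jacobian_det (D z) \<or>
      (\<exists>n. z \<in> S n \<and> (onorm (D z))\<^sup>2 \<le> q n * jacobian_det (D z))" if "z \<in> G" for z
  proof -
    obtain D' where D': "(f has_derivative D') (at z)"
        "(onorm D')\<^sup>2 \<le> jacobian_det D' \<or> (\<exists>n. z \<in> S n \<and> (onorm D')\<^sup>2 \<le> q n * jacobian_det D')"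
      using diff[OF \<open>z \<in> G\<close>] by blast
    then have "D' = D z" using D_der[OF that] has_derivative_unique by blast
    then show ?thesis using D' by simp
  qed
  have jac0: "0 \<le> jacobian_det (D z)" if z: "z \<in> G" for z
  proof (rule ccontr)
    assume neg: "\<not> 0 \<le> jacobian_det (D z)"
    have "q n * jacobian_det (D z) < 0" for n
      using neg q[of n] by (intro mult_pos_neg) auto
    then show False using q'[OF z] neg
      by (meson less_le_trans not_le zero_le_power2)
  qed
  have K1: "1 \<le> K z" for z by (simp add: K_def)
  have KD: "(onorm (D z))\<^sup>2 \<le> K z * jacobian_det (D z)" if z: "z \<in> G" for z
  proof (cases "jacobian_det (D z) = 0")
    case True
    then show ?thesis using q'[OF z] by auto
  next
    case False
    with jac0[OF z] have "0 < jacobian_det (D z)" by simp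
    then show ?thesis using z by (simp add: K_def max_mult_distrib_right)
  qed
  have bound: "distortion_bound D K"
    unfolding distortion_bound_def
    using mK K1 AEG by (auto intro: measurable_completion simp: KD measurable_lborel2)
  have dist: "is_distortion D K"
    unfolding is_distortion_def
  proof (intro conjI allI impI bound)
    fix K' assume K': "distortion_bound D K'"
    then have "AE z in lebesgue. (onorm (D z))\<^sup>2 \<le> K' z * jacobian_det (D z)"
      and 1: "\<And>z. 1 \<le> K' z" by (auto simp: distortion_bound_def)
    from this(1) AEG show "AE z in lebesgue. K z \<le> K' z"
    proof eventually_elim
      case (elim z)
      show ?case
      proof (cases "jacobian_det (D z) = 0")
        case True
        then show ?thesis by (simp add: K_def 1)
      next
        case False
        with jac0[OF elim(2)] have "0 < jacobian_det (D z)" by simp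
        then show ?thesis using elim 1 by (simp add: K_def divide_le_eq)
      qed
    qed
  qed
  have "loc_integrable f"
    unfolding loc_integrable_def set_integrable_def
  proof (intro allI impI)
    fix T :: "complex set" assume T: "compact T"
    have "continuous_on UNIV f"
      by (rule lipschitz_on_continuous_on[of L], rule lipschitz_onI) (auto simp: dist_norm lip L)
    then have "integrable lborel (\<lambda>z. indicator T z *\<^sub>R f z)"
      using T by (intro borel_integrable_compact) (auto intro: continuous_on_subset)
    then show "integrable lebesgue (\<lambda>z. indicator T z *\<^sub>R f z)"
      by (simp add: integrable_completion borel_measurable_integrable)
  qed
  then have sob: "sobolev_11_loc f D" using weak(3) by (simp add: sobolev_11_loc_def)
  have "loc_integrable (\<lambda>z. jacobian_det (D z))"
    unfolding loc_integrable_def set_integrable_def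
  proof (intro allI impI)
    fix T :: "complex set" assume T: "compact T"
    have "integrable lborel (\<lambda>z. indicator T z *\<^sub>R jacobian_det (D z))"
    proof (rule integrableI_bounded_set_indicator[where B="(L + 1)\<^sup>2"])
      show "emeasure lborel T < \<infinity>" using T by (rule emeasure_compact_finite)
      show "AE z in lborel. z \<in> T \<longrightarrow> norm (jacobian_det (D z)) \<le> (L + 1)\<^sup>2"
      proof (intro AE_I2 impI)
        fix z
        have "cmod (\<alpha> z) + cmod (\<beta> z) \<le> L + 1"
          unfolding on[symmetric] by (rule onorm_le) (rule weak(2))
        then have "(cmod (\<alpha> z))\<^sup>2 \<le> (L + 1)\<^sup>2" "(cmod (\<beta> z))\<^sup>2 \<le> (L + 1)\<^sup>2"
          using norm_ge_zero[of "\<alpha> z"] norm_ge_zero[of "\<beta> z"]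
          by (intro power_mono; linarith)+
        then show "norm (jacobian_det (D z)) \<le> (L + 1)\<^sup>2"
          unfolding jac real_norm_def abs_le_iff
          using zero_le_power2[of "cmod (\<alpha> z)"] zero_le_power2[of "cmod (\<beta> z)"] by linarith
      qed
    qed (use T in \<open>auto intro: borel_compact\<close>)
    then show "integrable lebesgue (\<lambda>z. indicator T z *\<^sub>R jacobian_det (D z))"
      by (simp add: integrable_completion borel_measurable_integrable)
  qed
  then have fin: "finite_distortion f D"
    unfolding finite_distortion_def using homeo sob bound by blast
  have "loc_integrable (\<lambda>z. exp (p * K z))"
    unfolding loc_integrable_def set_integrable_def
  proof (intro allI impI)
    fix T :: "complex set" assume T: "compact T"
    then have [measurable]: "T \<in> sets borel" by (rule borel_compact)
    have [measurable]: "S n \<in> sets borel" for n by (rule S)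
    have Kq: "K z \<le> 1 \<or> (\<exists>n. z \<in> S n \<and> K z \<le> q n)" for z
    proof (cases "z \<in> G \<and> jacobian_det (D z) \<noteq> 0")
      case True
      with jac0[of z] have "0 < jacobian_det (D z)" by simp
      then show ?thesis using q'[of z] q True
        by (auto simp: K_def divide_le_eq)
    qed (auto simp: K_def)
    have le: "ennreal (norm (indicator T z *\<^sub>R exp (p * K z)))
        \<le> ennreal (exp p) * indicator T z + (\<Sum>n. ennreal (exp (p * q n)) * indicator (S n) z)" for z
    proof (cases "z \<in> T")
      case True
      show ?thesis
      proof (cases "K z \<le> 1")
        case le1: True
        have "ennreal (exp (p * K z)) \<le> ennreal (exp p)"
          using le1 p mult_left_mono[of "K z" 1 p] by (intro ennreal_leI) simp
        then show ?thesis using True by (simp add: add_increasing2)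
      next
        case False
        then obtain n where n: "z \<in> S n" "K z \<le> q n" using Kq[of z] by blast
        have "ennreal (exp (p * K z)) \<le> ennreal (exp (p * q n)) * indicator (S n) z"
          using n p mult_left_mono[of "K z" "q n" p] by (simp add: ennreal_leI)
        also have "\<dots> = (\<Sum>k\<in>{n}. ennreal (exp (p * q k)) * indicator (S k) z)"
          by (simp only: sum.insert[OF finite.emptyI] empty_iff not_False_eq_True sum.empty add_0_right)
        also have "\<dots> \<le> (\<Sum>n. ennreal (exp (p * q n)) * indicator (S n) z)"
          by (rule sum_le_suminf) auto
        finally show ?thesis using True by (simp add: add_increasing)
      qed
    qed simp
    have "integrable lborel (\<lambda>z. indicator T z *\<^sub>R exp (p * K z))"
    proof (rule integrableI_bounded)
      show "(\<lambda>z. indicator T z *\<^sub>R exp (p * K z)) \<in> borel_measurable lborel" by measurable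
      have "(\<integral>\<^sup>+z. ennreal (norm (indicator T z *\<^sub>R exp (p * K z))) \<partial>lborel)
          \<le> (\<integral>\<^sup>+z. (ennreal (exp p) * indicator T z
              + (\<Sum>n. ennreal (exp (p * q n)) * indicator (S n) z)) \<partial>lborel)"
        by (rule nn_integral_mono) (rule le)
      also have "\<dots> = ennreal (exp p) * emeasure lborel T
          + (\<Sum>n. ennreal (exp (p * q n)) * emeasure lborel (S n))"
        by (subst nn_integral_add) (auto simp: nn_integral_suminf nn_integral_cmult_indicator)
      also have "\<dots> < \<infinity>"
        using sum emeasure_compact_finite[OF T] by (simp add: ennreal_mult_less_top)
      finally show "(\<integral>\<^sup>+z. ennreal (norm (indicator T z *\<^sub>R exp (p * K z))) \<partial>lborel) < \<infinity>" .
    qed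
    then show "integrable lebesgue (\<lambda>z. indicator T z *\<^sub>R exp (p * K z))"
      by (simp add: integrable_completion borel_measurable_integrable)
  qed
  then show ?thesis unfolding exp_integrable_distortion_def using fin dist by blast
qed

section \<open>Logarithmic twists of a disc\<close>

text \<open>Clamping \<open>t\<close> to the interval from \<open>a\<close> to \<open>b\<close> puts
  inner disc, annulus and exterior into one formula, so monotonicity and continuity need no
  gluing.\<close>

definition twist_log :: "real \<Rightarrow> real \<Rightarrow> real \<Rightarrow> real"
  where "twist_log a b t = ln (max a (min t b) / b)"

definition twist_factor :: "real \<Rightarrow> real \<Rightarrow> real \<Rightarrow> real \<Rightarrow> complex"
  where "twist_factor k a b t = exp (of_real (k * twist_log a b t) * (1 + \<i>))"

text \<open>The map \<open>z |z / b|\<^bsup>k(1 + i)\<^esup>\<close> in the annulus \<open>a < |z| < b\<close>, continued by a linear map inside and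
  by the identity outside.\<close>

definition twist :: "real \<Rightarrow> real \<Rightarrow> real \<Rightarrow> complex \<Rightarrow> complex"
  where "twist k a b v = v * twist_factor k a b (cmod v)"

text \<open>The derivative of \<open>exp\<close> has modulus at most \<open>1\<close> on the closed
  left half-plane, which is convex. Twist exponents lie there because \<open>twist_log\<close> is
  nonpositive.\<close>

lemma norm_exp_diff_le:
  fixes z w :: complex
  assumes "Re z \<le> 0" "Re w \<le> 0"
  shows "cmod (exp z - exp w) \<le> cmod (z - w)"
proof -
  have "cmod (exp z - exp w) \<le> 1 * cmod (z - w)"
  proof (rule field_differentiable_bound[where S="{x. Re x \<le> 0}" and f'=exp])
    show "convex {x. Re x \<le> 0}" by (rule convex_halfspace_Re_le)
  qed (use assms in \<open>auto intro!: derivative_eq_intros\<close>)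
  then show ?thesis by simp
qed

text \<open>Up to common and unimodular factors, \<open>1 + g\<close> and \<open>g\<close> are the
  Wirtinger coefficients of the twist. Their Jacobian is \<open>1 + k\<close>, and the norm is at
  most \<open>1 + 2 * cmod g\<close> with \<open>(cmod g)\<^sup>2 = k\<^sup>2 / 2\<close>, so the
  distortion grows only linearly in \<open>k\<close>.\<close>

lemma norm_wirtinger_twist_le:
  assumes "0 \<le> (k::real)"
  defines "g \<equiv> of_real (k / 2) * (1 + \<i>)"
  shows "(cmod (1 + g) + cmod g)\<^sup>2 \<le> 2 * (1 + k) * ((cmod (1 + g))\<^sup>2 - (cmod g)\<^sup>2)"
proof -
  have g2: "(cmod g)\<^sup>2 = k\<^sup>2 / 2"
    unfolding cmod_power2 by (simp add: g_def power2_eq_square)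
  have "(cmod g)\<^sup>2 \<le> k\<^sup>2" unfolding g2 by simp
  then have gk: "cmod g \<le> k" using assms(1) by (rule power2_le_imp_le)
  have diff: "(cmod (1 + g))\<^sup>2 - (cmod g)\<^sup>2 = 1 + k"
    unfolding cmod_power2 by (simp add: g_def power2_eq_square field_simps)
  have "cmod (1 + g) + cmod g \<le> 1 + 2 * cmod g"
    using norm_triangle_ineq[of 1 g] by simp
  then have "(cmod (1 + g) + cmod g)\<^sup>2 \<le> (1 + 2 * cmod g)\<^sup>2"
    by (intro power_mono) auto
  also have "\<dots> = 1 + 4 * cmod g + 2 * k\<^sup>2"
    using g2 by (simp add: power2_eq_square algebra_simps)
  also have "\<dots> \<le> 2 * (1 + k) * (1 + k)"
    using gk by (simp add: power2_eq_square algebra_simps)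
  finally show ?thesis unfolding diff .
qed

context
  fixes k a b :: real
  assumes k: "0 \<le> k" and a: "0 < a" and ab: "a \<le> b"
begin

lemma twist_log_mono: "s \<le> t \<Longrightarrow> twist_log a b s \<le> twist_log a b t"
  using a ab unfolding twist_log_def by (auto intro!: divide_right_mono simp: max_def min_def)

lemma twist_log_outer: "b \<le> t \<Longrightarrow> twist_log a b t = 0"
  using a ab by (simp add: twist_log_def)

lemma twist_log_inner: "t \<le> a \<Longrightarrow> twist_log a b t = ln (a / b)"
  using a ab by (simp add: twist_log_def)

lemma twist_log_nonpos: "twist_log a b t \<le> 0"
  using a ab by (auto simp: twist_log_def)

lemma continuous_on_twist_log: "continuous_on S g \<Longrightarrow> continuous_on S (\<lambda>x. twist_log a b (g x))"
  using a ab unfolding twist_log_def by (intro continuous_intros) (auto simp: max_def)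

text \<open>Clamping can only bring the ratio of two radii closer to \<open>1\<close>; the rest is
  \<open>ln x \<le> x - 1\<close>.\<close>

lemma twist_log_diff_le:
  assumes "0 < s" "s \<le> t"
  shows "twist_log a b t - twist_log a b s \<le> (t - s) / s"
proof -
  have "max a (min t b) * s \<le> max a (min s b) * t"
  proof (cases "t \<le> a")
    case True
    then show ?thesis using assms a ab by simp
  next
    case False
    show ?thesis
    proof (cases "b \<le> s")
      case True
      then show ?thesis using assms a ab by (simp add: mult_left_mono)
    next
      case nb: False
      have "max a (min t b) \<le> t" "s \<le> max a (min s b)" using False nb by auto
      then have "max a (min t b) * s \<le> t * max a (min s b)"
        using assms a by (intro mult_mono) auto
      then show ?thesis by (simp add: mult.commute)
    qed
  qed
  then have "max a (min t b) / max a (min s b) \<le> t / s"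
    using assms a by (simp add: divide_simps less_max_iff_disj mult.commute)
  moreover have "0 < max a (min t b)" "0 < max a (min s b)" "0 < b" using a ab by auto
  ultimately have "ln (max a (min t b) / max a (min s b)) \<le> ln (t / s)"
    by (intro ln_mono) auto
  moreover have "ln (t / s) \<le> t / s - 1" using assms by (intro ln_le_minus_one) auto
  moreover have "twist_log a b t - twist_log a b s = ln (max a (min t b) / max a (min s b))"
    using a ab unfolding twist_log_def by (subst ln_div ; auto simp: ln_div less_max_iff_disj)+
  ultimately show ?thesis using assms by (simp add: diff_divide_distrib)
qed

lemma norm_twist_factor: "cmod (twist_factor k a b t) = exp (k * twist_log a b t)"
  by (simp add: twist_factor_def norm_exp_eq_Re)

lemma norm_twist_factor_le: "cmod (twist_factor k a b t) \<le> 1"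
  using k twist_log_nonpos[of t] by (simp add: norm_twist_factor mult_nonneg_nonpos)

lemma norm_twist_factor_mono: "s \<le> t \<Longrightarrow> cmod (twist_factor k a b s) \<le> cmod (twist_factor k a b t)"
  using k twist_log_mono[of s t] by (simp add: norm_twist_factor mult_left_mono)

lemma twist_factor_nonzero: "twist_factor k a b t \<noteq> 0"
  by (simp add: twist_factor_def)

lemma twist_factor_outer: "b \<le> t \<Longrightarrow> twist_factor k a b t = 1"
  by (simp add: twist_factor_def twist_log_outer)

lemma twist_factor_inner: "t \<le> a \<Longrightarrow> twist_factor k a b t = twist_factor k a b a"
  by (simp add: twist_factor_def twist_log_inner)

lemma twist_outer: "b \<le> cmod v \<Longrightarrow> twist k a b v = v"
  by (simp add: twist_def twist_factor_outer)

lemma twist_inner: "cmod v \<le> a \<Longrightarrow> twist k a b v = twist_factor k a b a * v"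
  using twist_factor_inner[of "cmod v"] by (simp add: twist_def mult.commute)

lemma norm_twist_le: "cmod (twist k a b v) \<le> cmod v"
  using norm_twist_factor_le[of "cmod v"] by (simp add: twist_def norm_mult mult_left_le)

lemma norm_twist_strict_mono: "cmod v < cmod w \<Longrightarrow> cmod (twist k a b v) < cmod (twist k a b w)"
  unfolding twist_def norm_mult
  by (intro mult_less_le_imp_less norm_twist_factor_mono) (auto simp: twist_factor_nonzero)

lemma norm_twist_ge: "cmod (twist_factor k a b a) * cmod v \<le> cmod (twist k a b v)"
proof -
  have "cmod (twist_factor k a b a) \<le> cmod (twist_factor k a b (cmod v))"
    using norm_twist_factor_mono[of a "cmod v"] twist_factor_inner[of "cmod v"]
    by (cases "a \<le> cmod v") auto
  then show ?thesis by (simp add: twist_def norm_mult mult.commute mult_left_mono)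
qed

text \<open>The modulus increases strictly, so equal values come from equal moduli, and then the
  same nonzero factor cancels.\<close>

lemma twist_inject: "twist k a b v = twist k a b w \<Longrightarrow> v = w"
  by (metis linorder_neqE_linordered_idom mult_right_cancel norm_twist_strict_mono order_less_irrefl
      twist_def twist_factor_nonzero)

text \<open>With \<open>cmod w \<le> cmod v\<close> the difference is split so that the change of
  the twist factor is multiplied by the smaller modulus. This cancels the denominator in
  \<open>twist_log_diff_le\<close>, and the constant becomes independent of the radii.\<close>

lemma twist_lipschitz: "cmod (twist k a b v - twist k a b w) \<le> (1 + 2 * k) * cmod (v - w)"
proof (induction "cmod w" "cmod v" arbitrary: v w rule: linorder_wlog)
  case (le v w)
  show ?case
  proof (cases "w = 0")
    case True
    then show ?thesis
      using norm_twist_le[of v] k by (auto simp: twist_def algebra_simps intro: order_trans)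
  next
    case False
    define d where "d = twist_log a b (cmod v) - twist_log a b (cmod w)"
    have d: "0 \<le> d" "d \<le> (cmod v - cmod w) / cmod w"
      using twist_log_mono[OF le] twist_log_diff_le[OF _ le] False by (auto simp: d_def)
    have "cmod (twist_factor k a b (cmod v) - twist_factor k a b (cmod w)) \<le>
        cmod (of_real (k * twist_log a b (cmod v)) * (1 + \<i>) - of_real (k * twist_log a b (cmod w)) * (1 + \<i>))"
      unfolding twist_factor_def
      using k twist_log_nonpos by (intro norm_exp_diff_le) (auto simp: mult_nonneg_nonpos)
    also have "\<dots> = cmod (of_real (k * d) * (1 + \<i>))" by (simp add: d_def algebra_simps)
    also have "\<dots> = k * d * cmod (1 + \<i>)"
      unfolding norm_mult norm_of_real using k d by simp
    also have "\<dots> \<le> k * d * 2"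
      using k d norm_triangle_ineq[of 1 \<i>] by (intro mult_left_mono) auto
    finally have 1: "cmod (twist_factor k a b (cmod v) - twist_factor k a b (cmod w)) \<le> 2 * k * d"
      by (simp add: mult_ac)
    have "twist k a b v - twist k a b w = (v - w) * twist_factor k a b (cmod v)
        + w * (twist_factor k a b (cmod v) - twist_factor k a b (cmod w))"
      by (simp add: twist_def algebra_simps)
    then have "cmod (twist k a b v - twist k a b w) \<le> cmod (v - w) * cmod (twist_factor k a b (cmod v))
        + cmod w * cmod (twist_factor k a b (cmod v) - twist_factor k a b (cmod w))"
      by (metis norm_mult norm_triangle_ineq)
    also have "\<dots> \<le> cmod (v - w) * 1 + cmod w * (2 * k * ((cmod v - cmod w) / cmod w))"
      using 1 d k by (intro add_mono mult_left_mono norm_twist_factor_le order_trans[OF 1]) auto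
    also have "\<dots> = cmod (v - w) + 2 * k * (cmod v - cmod w)" using False by simp
    also have "\<dots> \<le> cmod (v - w) + 2 * k * cmod (v - w)"
      using k by (intro add_left_mono mult_left_mono norm_triangle_ineq2) auto
    finally show ?thesis by (simp add: algebra_simps)
  qed
next
  case (sym v w)
  then show ?case by (metis norm_minus_commute)
qed

lemma twist_has_derivative:
  assumes v: "a < cmod v" "cmod v < b"
  obtains \<alpha> \<beta> where "(twist k a b has_derivative (\<lambda>e. \<alpha> * e + \<beta> * cnj e)) (at v)"
    "(cmod \<alpha> + cmod \<beta>)\<^sup>2 \<le> 2 * (1 + k) * ((cmod \<alpha>)\<^sup>2 - (cmod \<beta>)\<^sup>2)"
proof -
  define g where "g = of_real (k / 2) * (1 + \<i>)"
  define h where "h = exp (of_real (k * ln (cmod v / b)) * (1 + \<i>))"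
  have v0: "v \<noteq> 0" "0 < b" using v a ab by auto
  have "((\<lambda>u. ln (cmod u / b)) has_derivative (\<lambda>e. (e \<bullet> sgn v) / cmod v)) (at v)"
    using v0 by (auto intro!: derivative_eq_intros has_derivative_norm simp: field_simps)
  then have "((\<lambda>u. of_real (k * ln (cmod u / b)) * (1 + \<i>)) has_derivative
      (\<lambda>e. of_real (k * ((e \<bullet> sgn v) / cmod v)) * (1 + \<i>))) (at v)"
    by (intro has_derivative_mult_left has_derivative_of_real has_derivative_mult_right)
  from has_derivative_compose[OF this DERIV_exp[unfolded has_field_derivative_def]]
  have "((\<lambda>u. exp (of_real (k * ln (cmod u / b)) * (1 + \<i>))) has_derivative
      (\<lambda>e. of_real (k * ((e \<bullet> sgn v) / cmod v)) * (1 + \<i>) * h)) (at v)"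
    by (simp add: h_def mult.commute)
  then have "((\<lambda>u. u * exp (of_real (k * ln (cmod u / b)) * (1 + \<i>))) has_derivative
      (\<lambda>e. v * (of_real (k * ((e \<bullet> sgn v) / cmod v)) * (1 + \<i>) * h) + e * h)) (at v)"
    unfolding h_def by (rule has_derivative_mult[OF has_derivative_ident])
  \<comment> \<open>Writing \<open>e \<bullet> v\<close> as
    \<open>(cnj v * e + v * cnj e) / 2\<close> splits the differential into its Wirtinger
    parts.\<close>
  moreover have "v * (of_real (k * ((e \<bullet> sgn v) / cmod v)) * (1 + \<i>) * h) + e * h
        = h * (1 + g) * e + h * g * (v / cnj v) * cnj e" for e
  proof -
    have 1: "(e \<bullet> sgn v) / cmod v = (e \<bullet> v) / (cmod v)\<^sup>2"
      using v0 by (simp add: sgn_div_norm field_simps power2_eq_square)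
    have 2: "of_real (e \<bullet> v) = (cnj v * e + v * cnj e) / 2"
      by (simp add: complex_eq_iff inner_complex_def algebra_simps)
    have 3: "complex_of_real ((cmod v)\<^sup>2) = v * cnj v" by (rule complex_norm_square)
    show ?thesis
      unfolding 1 of_real_mult of_real_divide 2 3 g_def using v0 by (simp add: field_simps)
  qed
  ultimately have "((\<lambda>u. u * exp (of_real (k * ln (cmod u / b)) * (1 + \<i>))) has_derivative
      (\<lambda>e. h * (1 + g) * e + h * g * (v / cnj v) * cnj e)) (at v)"
    by simp
  then have "(twist k a b has_derivative (\<lambda>e. h * (1 + g) * e + h * g * (v / cnj v) * cnj e)) (at v)"
  proof (rule has_derivative_transform_within_open[where s="{u. a < cmod u} \<inter> {u. cmod u < b}"])
    show "open ({u. a < cmod u} \<inter> {u. cmod u < b})"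
      by (intro open_Int open_Collect_less continuous_intros)
  qed (use v in \<open>auto simp: twist_def twist_factor_def twist_log_def\<close>)
  moreover have "(cmod (h * (1 + g)) + cmod (h * g * (v / cnj v)))\<^sup>2
      \<le> 2 * (1 + k) * ((cmod (h * (1 + g)))\<^sup>2 - (cmod (h * g * (v / cnj v)))\<^sup>2)"
  proof -
    have *: "cmod (h * (1 + g)) = cmod h * cmod (1 + g)" "cmod (h * g * (v / cnj v)) = cmod h * cmod g"
      using v0 by (auto simp: norm_mult norm_divide)
    have "(cmod h)\<^sup>2 * (cmod (1 + g) + cmod g)\<^sup>2
        \<le> (cmod h)\<^sup>2 * (2 * (1 + k) * ((cmod (1 + g))\<^sup>2 - (cmod g)\<^sup>2))"
      unfolding g_def by (intro mult_left_mono norm_wirtinger_twist_le k) auto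
    then show ?thesis unfolding * by (simp add: power2_eq_square algebra_simps)
  qed
  ultimately show thesis by (rule that)
qed

end

section \<open>Twists along a tree of discs\<close>

text \<open>\<open>W n\<close> are the centres of generation \<open>n\<close>: the disc of radius \<open>r n\<close> about each of them contains
  a square grid of \<open>(m n)\<^sup>2\<close> points with spacing \<open>d n\<close>, the centres of generation \<open>Suc n\<close>, and around
  these the annuli with radii \<open>r (Suc n)\<close> and \<open>R n\<close> are twisted with exponent \<open>k n\<close>.\<close>

locale twist_tree =
  fixes m :: "nat \<Rightarrow> nat" and d R r k :: "nat \<Rightarrow> real"
  assumes m_pos: "0 < m n" and k_nonneg: "0 \<le> k n" and r_pos: "0 < r n"
    and r_0: "r 0 = 1"
    and block: "16 * d n * m n \<le> r n"
    and R_le: "16 * R n \<le> d n"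
    and r_Suc_le: "16 * r (Suc n) \<le> R n"
begin

primrec W :: "nat \<Rightarrow> complex set" where
  "W 0 = {0}"
| "W (Suc n) = (\<lambda>(w, i, j). w + of_real (d n) * Complex (real i) (real j)) ` (W n \<times> {..<m n} \<times> {..<m n})"

declare W.simps(2) [simp del]

definition tw :: "nat \<Rightarrow> complex \<Rightarrow> complex"
  where "tw n = twist (k n) (r (Suc n)) (R n)"

definition tf :: "nat \<Rightarrow> real \<Rightarrow> complex"
  where "tf n = twist_factor (k n) (r (Suc n)) (R n)"

definition c :: "nat \<Rightarrow> complex"
  where "c n = tf n (r (Suc n))"

text \<open>The slope of \<open>F n\<close> on the discs of radius \<open>r n\<close> about the
  centres of generation \<open>n\<close>: each twist multiplies its inner disc by
  \<open>c n\<close>, and these factors accumulate.\<close>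

definition C :: "nat \<Rightarrow> complex"
  where "C n = (\<Prod>i<n. c i)"

definition \<psi> :: "nat \<Rightarrow> complex \<Rightarrow> complex"
  where "\<psi> n x = (\<Sum>w\<in>W (Suc n). tw n (x - w) - (x - w))"

text \<open>In effect the composition of the first \<open>n\<close> generations, the latest applied
  first. Where the displacement \<open>\<psi> n\<close> lives, the earlier map is affine with slope
  \<open>C n\<close>, so precomposition with generation \<open>n\<close> just adds
  \<open>C n * \<psi> n\<close>.\<close>

definition F :: "nat \<Rightarrow> complex \<Rightarrow> complex"
  where "F n x = x + (\<Sum>i<n. C i * \<psi> i x)"

definition f :: "complex \<Rightarrow> complex"
  where "f x = x + (\<Sum>i. C i * \<psi> i x)"

text \<open>The combined displacement by the generations from \<open>n\<close> on, measured before
  \<open>F n\<close> is applied; hence the division by \<open>C n\<close>.\<close>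

definition off :: "nat \<Rightarrow> complex \<Rightarrow> complex"
  where "off n x = (\<Sum>i. C (n + i) / C n * \<psi> (n + i) x)"

text \<open>The factor \<open>1 / 4\<close> leaves room: whatever is within \<open>r n / 2\<close>
  of a point of \<open>A\<close> is still in a disc of radius \<open>r n\<close>, where
  \<open>F n\<close> is affine.\<close>

definition A :: "complex set"
  where "A = {z. \<forall>n. \<exists>w\<in>W n. cmod (z - w) \<le> r n / 4}"

section \<open>Scales and positions of the discs\<close>

lemma R_pos: "0 < R n" using r_Suc_le[of n] r_pos[of "Suc n"] by linarith

lemma d_pos: "0 < d n" using R_le[of n] R_pos[of n] by linarith

lemma d_le: "16 * d n \<le> r n"
proof -
  have "d n * 1 \<le> d n * real (m n)" using m_pos[of n] d_pos[of n] by (intro mult_left_mono) auto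
  then show ?thesis using block[of n] by linarith
qed

lemma R_le_r: "256 * R n \<le> r n" using R_le[of n] d_le[of n] by linarith

lemma r_Suc_le_r: "4096 * r (Suc n) \<le> r n" using R_le_r[of n] r_Suc_le[of n] by linarith

lemma r_Suc_le_R: "r (Suc n) \<le> R n" using r_Suc_le[of n] r_pos[of "Suc n"] by linarith

lemma R_Suc_le: "4096 * R (Suc n) \<le> R n" using R_le_r[of "Suc n"] r_Suc_le[of n] by linarith

lemma r_le_1: "r n \<le> 1"
proof (induction n)
  case (Suc n)
  then show ?case using r_Suc_le_r[of n] r_pos[of "Suc n"] by linarith
qed (simp add: r_0)

lemma r_antimono: "r (n + j) \<le> r n"
proof (induction j)
  case (Suc j)
  then show ?case using r_Suc_le_r[of "n + j"] r_pos[of "Suc (n + j)"] by simp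
qed simp

lemma R_geometric: "R (n + j) \<le> R n * (1 / 4) ^ j"
proof (induction j)
  case (Suc j)
  then show ?case using R_Suc_le[of "n + j"] R_pos[of "Suc (n + j)"] by simp
qed simp

lemma r_tendsto_0: "r \<longlonglongrightarrow> 0"
proof -
  have "r n \<le> (1 / 2) ^ n" for n
  proof (induction n)
    case (Suc n)
    then show ?case using r_Suc_le_r[of n] r_pos[of "Suc n"] by simp
  qed (simp add: r_0)
  then show ?thesis
    by (intro tendsto_sandwich[OF _ _ tendsto_const LIMSEQ_power_zero[of "1 / 2 :: real"]] always_eventually allI)
      (auto intro: less_imp_le[OF r_pos])
qed

lemmas tw_params = k_nonneg r_pos[of "Suc _"] r_Suc_le_R

lemma finite_W: "finite (W n)"
  by (induction n) (auto simp: W.simps(2))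

lemma card_W_le: "card (W n) \<le> (\<Prod>i<n. m i)\<^sup>2"
proof (induction n)
  case (Suc n)
  have "card (W (Suc n)) \<le> card (W n \<times> {..<m n} \<times> {..<m n})"
    unfolding W.simps by (rule card_image_le) (simp add: finite_W)
  also have "\<dots> = card (W n) * (m n)\<^sup>2" by (simp add: card_cartesian_product power2_eq_square)
  also have "\<dots> \<le> (\<Prod>i<n. m i)\<^sup>2 * (m n)\<^sup>2" by (intro mult_right_mono Suc) auto
  finally show ?case by (simp add: power_mult_distrib)
qed simp

lemma W_parent:
  assumes "w \<in> W (Suc n)"
  obtains v where "v \<in> W n" "cmod (w - v) \<le> r n / 8"
proof -
  obtain v i j where v: "v \<in> W n" "i < m n" "j < m n"
      "w = v + of_real (d n) * Complex (real i) (real j)"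
    using assms by (auto simp: W.simps(2))
  have "cmod (w - v) = d n * cmod (Complex (real i) (real j))"
    using v d_pos[of n] by (simp add: norm_mult)
  also have "\<dots> \<le> d n * (real i + real j)"
    using d_pos[of n] cmod_le[of "Complex (real i) (real j)"] by (intro mult_left_mono) auto
  also have "\<dots> \<le> d n * (real (m n) + real (m n))"
    using d_pos[of n] v by (intro mult_left_mono) auto
  also have "\<dots> \<le> r n / 8" using block[of n] by (simp add: algebra_simps)
  finally show thesis using v that by blast
qed

text \<open>Siblings differ by \<open>d n\<close> times a nonzero integer vector. For different
  parents, the distance \<open>r n\<close> between them far exceeds the difference of the two grid
  offsets, which is at most \<open>r n / 8\<close>.\<close>

lemma W_separated_step:
  assumes IH: "\<And>v v'. v \<in> W n \<Longrightarrow> v' \<in> W n \<Longrightarrow> v \<noteq> v' \<Longrightarrow> r n \<le> cmod (v - v')"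
    and w: "w \<in> W (Suc n)" "w' \<in> W (Suc n)" "w \<noteq> w'"
  shows "d n \<le> cmod (w - w')"
proof -
  obtain v i j where v: "v \<in> W n" "i < m n" "j < m n"
      "w = v + of_real (d n) * Complex (real i) (real j)"
    using w by (auto simp: W.simps(2))
  obtain v' i' j' where v': "v' \<in> W n" "i' < m n" "j' < m n"
      "w' = v' + of_real (d n) * Complex (real i') (real j')"
    using w by (auto simp: W.simps(2))
  define e where "e = Complex (real i - real i') (real j - real j')"
  have ww: "w - w' = (v - v') + of_real (d n) * e"
    by (simp add: v v' e_def complex_eq_iff algebra_simps)
  show ?thesis
  proof (cases "v = v'")
    case True
    then have "i \<noteq> i' \<or> j \<noteq> j'" using w v v' by auto
    then have "1 \<le> \<bar>real i - real i'\<bar> \<or> 1 \<le> \<bar>real j - real j'\<bar>" by linarith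
    then have "1 \<le> cmod e"
      using abs_Re_le_cmod[of e] abs_Im_le_cmod[of e] unfolding e_def by auto
    then show ?thesis using True d_pos[of n] unfolding ww by (simp add: norm_mult)
  next
    case False
    have "\<bar>real i - real i'\<bar> \<le> real (m n)" "\<bar>real j - real j'\<bar> \<le> real (m n)"
      using v v' by auto
    then have "cmod e \<le> 2 * real (m n)" using cmod_le[of e] by (simp add: e_def)
    then have "d n * cmod e \<le> d n * (2 * real (m n))"
      using d_pos[of n] by (intro mult_left_mono) auto
    moreover have "cmod (of_real (d n) * e) = d n * cmod e"
      using d_pos[of n] by (simp add: norm_mult)
    ultimately have "cmod (of_real (d n) * e) \<le> r n / 8"
      using block[of n] by linarith
    moreover have "r n \<le> cmod (v - v')" using IH v v' False by blast
    moreover have "cmod (v - v') \<le> cmod (w - w') + cmod (of_real (d n) * e)"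
      unfolding ww by (metis add_diff_cancel_right' norm_triangle_ineq4)
    ultimately show ?thesis using d_le[of n] r_pos[of n] by linarith
  qed
qed

lemma W_far: "w \<in> W n \<Longrightarrow> w' \<in> W n \<Longrightarrow> w \<noteq> w' \<Longrightarrow> r n \<le> cmod (w - w')"
proof (induction n arbitrary: w w')
  case (Suc n)
  have "d n \<le> cmod (w - w')" using W_separated_step[OF Suc.IH Suc.prems] by blast
  then show ?case using r_Suc_le[of n] R_le[of n] R_pos[of n] r_pos[of "Suc n"] by linarith
qed simp

lemma W_separated: "w \<in> W (Suc n) \<Longrightarrow> w' \<in> W (Suc n) \<Longrightarrow> w \<noteq> w' \<Longrightarrow> d n \<le> cmod (w - w')"
  using W_separated_step[OF W_far] by blast

text \<open>Carrying the remaining room \<open>r (n + j) / 6\<close> along makes the induction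
  close: a child is within an eighth of the radius from its parent, and the next radius is
  negligible against the gap between an eighth and a sixth.\<close>

lemma W_ancestor:
  assumes "w \<in> W (n + j)"
  shows "\<exists>v\<in>W n. cmod (w - v) + r (n + j) / 6 \<le> r n / 6"
  using assms
proof (induction j arbitrary: w)
  case 0
  then show ?case by (auto intro!: bexI[of _ w])
next
  case (Suc j)
  then obtain u where u: "u \<in> W (n + j)" "cmod (w - u) \<le> r (n + j) / 8"
    using W_parent[of w "n + j"] by auto
  obtain v where v: "v \<in> W n" "cmod (u - v) + r (n + j) / 6 \<le> r n / 6"
    using Suc.IH[OF u(1)] by blast
  have "cmod (w - v) \<le> cmod (w - u) + cmod (u - v)" using norm_triangle_ineq[of "w - u" "u - v"] by simp
  then show ?case using u v r_Suc_le_r[of "n + j"] r_pos[of "n + j"] by (intro bexI[OF _ v(1)]) simp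
qed

subsection \<open>A single generation\<close>

lemma tw_outer: "R n \<le> cmod v \<Longrightarrow> tw n v = v"
  unfolding tw_def by (rule twist_outer[OF tw_params])

lemma tw_inner: "cmod v \<le> r (Suc n) \<Longrightarrow> tw n v = c n * v"
  unfolding tw_def c_def tf_def by (rule twist_inner[OF tw_params])

lemma norm_tw_le: "cmod (tw n v) \<le> cmod v"
  unfolding tw_def by (rule norm_twist_le[OF tw_params])

lemma norm_tw_ge: "cmod (c n) * cmod v \<le> cmod (tw n v)"
  unfolding tw_def c_def tf_def by (rule norm_twist_ge[OF tw_params])

lemma tw_inject: "tw n v = tw n w \<Longrightarrow> v = w"
  unfolding tw_def by (rule twist_inject[OF tw_params])

lemma tw_0 [simp]: "tw n 0 = 0"
  using norm_tw_le[of n 0] by simp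

lemma tw_eq: "tw n v = v * tf n (cmod v)"
  by (simp add: tw_def tf_def twist_def)

lemma norm_c_le: "cmod (c n) \<le> 1"
  unfolding c_def tf_def by (rule norm_twist_factor_le[OF tw_params])

lemma c_nonzero: "c n \<noteq> 0"
  unfolding c_def tf_def by (rule twist_factor_nonzero[OF tw_params])

lemma norm_c: "cmod (c n) = exp (- (k n * ln (R n / r (Suc n))))"
proof -
  have "ln (r (Suc n) / R n) = - ln (R n / r (Suc n))"
    using r_pos[of "Suc n"] R_pos[of n] by (simp add: ln_div)
  then show ?thesis
    unfolding c_def tf_def norm_twist_factor[OF tw_params]
    by (subst twist_log_inner[OF tw_params]) auto
qed

lemma C_Suc: "C (Suc n) = C n * c n" by (simp add: C_def)

lemma C_0 [simp]: "C 0 = 1" by (simp add: C_def)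

lemma C_nonzero: "C n \<noteq> 0" by (simp add: C_def c_nonzero)

lemma norm_C_Suc_le: "cmod (C (Suc n)) \<le> cmod (C n)"
  unfolding C_Suc norm_mult by (rule mult_left_le[OF norm_c_le norm_ge_zero])

lemma norm_C_antimono: "cmod (C (n + j)) \<le> cmod (C n)"
proof (induction j)
  case (Suc j)
  then show ?case using norm_C_Suc_le[of "n + j"] by simp
qed simp

lemma norm_C_le: "cmod (C n) \<le> 1"
  using norm_C_antimono[of 0 n] by simp

lemma norm_C_Suc_le_c: "cmod (C (Suc n)) \<le> cmod (c n)"
  using norm_C_le[of n] by (simp add: C_Suc norm_mult mult_left_le_one_le)

lemma other_disc_far:
  assumes "w \<in> W (Suc n)" "w' \<in> W (Suc n)" "w \<noteq> w'" "cmod (x - w) \<le> R n"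
  shows "15 * R n \<le> cmod (x - w')"
proof -
  have "cmod (w - w') \<le> cmod (x - w) + cmod (x - w')"
    using norm_triangle_ineq4[of "x - w'" "x - w"] by simp
  then show ?thesis using W_separated[OF assms(1-3)] R_le[of n] assms(4) by linarith
qed

lemma \<psi>_inside:
  assumes "w \<in> W (Suc n)" "cmod (x - w) \<le> R n"
  shows "\<psi> n x = tw n (x - w) - (x - w)"
proof -
  have "tw n (x - w') - (x - w') = 0" if "w' \<in> W (Suc n) - {w}" for w'
    using other_disc_far[OF assms(1) _ _ assms(2), of w'] that R_pos[of n] tw_outer[of n "x - w'"] by auto
  then have "(\<Sum>w'\<in>W (Suc n) - {w}. tw n (x - w') - (x - w')) = 0" by (rule sum.neutral[OF ballI])
  then show ?thesis
    unfolding \<psi>_def by (subst sum.remove[OF finite_W assms(1)]) simp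
qed

lemma \<psi>_outside:
  assumes "\<And>w. w \<in> W (Suc n) \<Longrightarrow> R n \<le> cmod (x - w)"
  shows "\<psi> n x = 0"
  unfolding \<psi>_def by (rule sum.neutral) (use assms tw_outer in auto)

lemma \<psi>_nonzero:
  assumes "\<psi> n x \<noteq> 0"
  obtains w where "w \<in> W (Suc n)" "cmod (x - w) < R n" "\<psi> n x = tw n (x - w) - (x - w)"
  using \<psi>_outside[of n x] \<psi>_inside[of _ n x] assms by (meson less_imp_le not_le)

lemma norm_tw_diff_le: "cmod (tw n v - v) \<le> 2 * cmod v"
  using norm_triangle_ineq4[of "tw n v" v] norm_tw_le[of n v] by linarith

lemma norm_\<psi>_le: "cmod (\<psi> n x) \<le> 2 * R n"
proof (cases "\<psi> n x = 0")
  case False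
  then obtain w where w: "w \<in> W (Suc n)" "cmod (x - w) < R n" "\<psi> n x = tw n (x - w) - (x - w)"
    by (rule \<psi>_nonzero)
  then show ?thesis using norm_tw_diff_le[of n "x - w"] by simp
qed (use R_pos[of n] in simp)

lemma tw_diff_lipschitz:
  "cmod ((tw n v - v) - (tw n w - w)) \<le> (2 + 2 * k n) * cmod (v - w)"
proof -
  have "cmod (tw n v - tw n w) \<le> (1 + 2 * k n) * cmod (v - w)"
    unfolding tw_def by (rule twist_lipschitz[OF tw_params])
  moreover have "cmod ((tw n v - v) - (tw n w - w)) \<le> cmod (tw n v - tw n w) + cmod (v - w)"
    using norm_triangle_ineq4[of "tw n v - tw n w" "v - w"] by (simp add: algebra_simps)
  ultimately show ?thesis by (simp add: algebra_simps)
qed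

text \<open>Two points of one disc are compared by its twist. Otherwise the disc of a moved point
  misses the other point, where its twist displaces nothing, so each displacement alone is bounded
  by the distance. This doubles the constant, whatever the number of discs.\<close>

lemma \<psi>_lipschitz: "cmod (\<psi> n x - \<psi> n y) \<le> (4 + 4 * k n) * cmod (x - y)"
proof -
  define H where "H = (\<lambda>w u. tw n (u - w) - (u - w))"
  have H: "cmod (H w u - H w u') \<le> (2 + 2 * k n) * cmod (u - u')" for w u u'
    using tw_diff_lipschitz[of n "u - w" "u' - w"] by (simp add: H_def)
  have one: "cmod (\<psi> n u) \<le> (2 + 2 * k n) * cmod (u - u')"
    if w: "w \<in> W (Suc n)" "cmod (u - w) < R n" "R n \<le> cmod (u' - w)" for u u' w
  proof -
    have "H w u' = 0" using w(3) by (simp add: H_def tw_outer)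
    moreover have "\<psi> n u = H w u" using \<psi>_inside w by (simp add: H_def)
    ultimately show ?thesis using H[of w u u'] by simp
  qed
  have le: "(2 + 2 * k n) * cmod (x - y) \<le> (4 + 4 * k n) * cmod (x - y)"
    using k_nonneg[of n] by (intro mult_right_mono) auto
  show ?thesis
  proof (cases "\<exists>w\<in>W (Suc n). cmod (x - w) < R n \<and> cmod (y - w) < R n")
    case True
    then obtain w where w: "w \<in> W (Suc n)" "cmod (x - w) < R n" "cmod (y - w) < R n" by blast
    then have "\<psi> n x = H w x" "\<psi> n y = H w y" using \<psi>_inside by (auto simp: H_def)
    then show ?thesis using H[of w x y] le by simp
  next
    case False
    have "cmod (\<psi> n x) \<le> (2 + 2 * k n) * cmod (x - y)"
    proof (cases "\<psi> n x = 0")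
      case nz: False
      then obtain w where "w \<in> W (Suc n)" "cmod (x - w) < R n" by (rule \<psi>_nonzero)
      then show ?thesis using one[of w x y] False by force
    qed (use k_nonneg[of n] in simp)
    moreover have "cmod (\<psi> n y) \<le> (2 + 2 * k n) * cmod (x - y)"
    proof (cases "\<psi> n y = 0")
      case nz: False
      then obtain w where "w \<in> W (Suc n)" "cmod (y - w) < R n" by (rule \<psi>_nonzero)
      then show ?thesis using one[of w y x] False by (force simp: norm_minus_commute)
    qed (use k_nonneg[of n] in simp)
    ultimately have "cmod (\<psi> n x - \<psi> n y) \<le> (2 + 2 * k n) * cmod (x - y) + (2 + 2 * k n) * cmod (x - y)"
      using norm_triangle_ineq4[of "\<psi> n x" "\<psi> n y"] by linarith
    then show ?thesis by (simp add: algebra_simps)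
  qed
qed

lemma step_in_disc:
  "w \<in> W (Suc n) \<Longrightarrow> cmod (x - w) \<le> R n \<Longrightarrow> x + \<psi> n x = w + tw n (x - w)"
  by (simp add: \<psi>_inside)

text \<open>A point that moves does so inside another disc, which its twist maps into itself and
  which is far from the disc of \<open>w\<close>.\<close>

lemma step_outside_disc:
  assumes "w \<in> W (Suc n)" "R n < cmod (x - w)"
  shows "R n < cmod (x + \<psi> n x - w)"
proof (cases "\<psi> n x = 0")
  case False
  then obtain w' where w': "w' \<in> W (Suc n)" "cmod (x - w') < R n" by (rule \<psi>_nonzero)
  then have "w' \<noteq> w" using assms by auto
  have "x + \<psi> n x - w' = tw n (x - w')" using step_in_disc[OF w'(1), of x] w' by simp
  then have "cmod (x + \<psi> n x - w') \<le> R n" using norm_tw_le[of n "x - w'"] w' by simp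
  from other_disc_far[OF w'(1) assms(1) \<open>w' \<noteq> w\<close> this] show ?thesis using R_pos[of n] by simp
qed (use assms in simp)

text \<open>The step preserves each disc and its complement. If one of two points with the same
  image is moved, both lie in the same disc, where the twist is injective.\<close>

lemma step_inj:
  assumes eq: "x + \<psi> n x = y + \<psi> n y"
  shows "x = y"
proof -
  have *: "u = u'" if w: "w \<in> W (Suc n)" "cmod (u - w) \<le> R n" and e: "u + \<psi> n u = u' + \<psi> n u'" for u u' w
  proof -
    have 1: "u + \<psi> n u = w + tw n (u - w)" by (rule step_in_disc[OF w])
    then have "cmod (u' + \<psi> n u' - w) \<le> R n" using e w norm_tw_le[of n "u - w"] by simp
    then have "cmod (u' - w) \<le> R n" using step_outside_disc[OF w(1), of u'] by force
    then have "u' + \<psi> n u' = w + tw n (u' - w)" by (rule step_in_disc[OF w(1)])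
    then have "tw n (u - w) = tw n (u' - w)" using 1 e by simp
    then show ?thesis using tw_inject by fastforce
  qed
  show ?thesis
  proof (cases "\<psi> n x = 0 \<and> \<psi> n y = 0")
    case True
    then show ?thesis using eq by simp
  next
    case False
    then consider "\<psi> n x \<noteq> 0" | "\<psi> n y \<noteq> 0" by blast
    then show ?thesis
    proof cases
      case 1
      then obtain w where "w \<in> W (Suc n)" "cmod (x - w) < R n" by (rule \<psi>_nonzero)
      then show ?thesis using *[of w x y] eq by simp
    next
      case 2
      then obtain w where "w \<in> W (Suc n)" "cmod (y - w) < R n" by (rule \<psi>_nonzero)
      then show ?thesis using *[of w y x] eq by simp
    qed
  qed
qed


subsection \<open>The limit map\<close>

lemma F_Suc: "F (Suc n) x = F n x + C n * \<psi> n x"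
  by (simp add: F_def)

text \<open>A disc of generation \<open>Suc n\<close> lies in a disc of generation \<open>n\<close>,
  where the induction hypothesis applies, and in the inner disc of its own twist, which fixes the
  centre and multiplies by \<open>c n\<close>.\<close>

lemma F_affine:
  assumes "w \<in> W n" "cmod (x - w) \<le> r n"
  shows "F n x = F n w + C n * (x - w)"
  using assms
proof (induction n arbitrary: w x)
  case 0
  then show ?case by (simp add: F_def)
next
  case (Suc n)
  obtain v where v: "v \<in> W n" "cmod (w - v) \<le> r n / 8" using W_parent Suc.prems by blast
  have "cmod (x - v) \<le> r n"
    using norm_triangle_ineq[of "x - w" "w - v"] Suc.prems v r_Suc_le_r[of n] r_pos[of "Suc n"] by simp
  then have 1: "F n x = F n v + C n * (x - v)" by (rule Suc.IH[OF v(1)])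
  have 2: "F n w = F n v + C n * (w - v)"
    using v r_pos[of n] by (intro Suc.IH) auto
  have 3: "\<psi> n x = c n * (x - w) - (x - w)"
    using Suc.prems r_Suc_le_R[of n] by (subst \<psi>_inside[of w]) (auto simp: tw_inner)
  have 4: "\<psi> n w = 0"
    using R_pos[of n] by (subst \<psi>_inside[OF Suc.prems(1)]) auto
  show ?case unfolding F_Suc C_Suc 1 2 3 4 by (simp add: algebra_simps)
qed

lemma F_affine_diff:
  assumes "w \<in> W n" "cmod (x - w) \<le> r n" "cmod (y - w) \<le> r n"
  shows "F n x - F n y = C n * (x - y)"
  unfolding F_affine[OF assms(1,2)] F_affine[OF assms(1,3)] by (simp add: algebra_simps)

text \<open>Turns the additive definition into a composition: a moved point and its new position lie
  in one disc of generation \<open>n\<close>, on which \<open>F n\<close> is affine.\<close>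

lemma F_Suc_step: "F (Suc n) x = F n (x + \<psi> n x)"
proof (cases "\<psi> n x = 0")
  case False
  then obtain w where w: "w \<in> W (Suc n)" "cmod (x - w) < R n" by (rule \<psi>_nonzero)
  obtain v where v: "v \<in> W n" "cmod (w - v) \<le> r n / 8" using W_parent w by blast
  have 1: "cmod (x - v) \<le> R n + r n / 8"
    using norm_triangle_ineq[of "x - w" "w - v"] w v by simp
  have "cmod (x + \<psi> n x - v) \<le> cmod (x - v) + cmod (\<psi> n x)"
    using norm_triangle_ineq[of "x - v" "\<psi> n x"] by (simp add: algebra_simps)
  then have "cmod (x + \<psi> n x - v) \<le> r n" "cmod (x - v) \<le> r n"
    using 1 norm_\<psi>_le[of n x] R_le_r[of n] r_pos[of n] by linarith+
  from F_affine_diff[OF v(1) this] show ?thesis by (simp add: F_Suc algebra_simps)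
qed (simp add: F_Suc)

lemma F_inj: "F n x = F n y \<Longrightarrow> x = y"
proof (induction n arbitrary: x y)
  case 0
  then show ?case by (simp add: F_def)
next
  case (Suc n)
  then show ?case unfolding F_Suc_step by (blast intro: step_inj)
qed

lemma \<psi>_support:
  assumes "\<psi> (n + j) x \<noteq> 0"
  shows "\<exists>w\<in>W n. cmod (x - w) < r n / 4"
proof -
  obtain w where w: "w \<in> W (Suc (n + j))" "cmod (x - w) < R (n + j)"
    using assms by (rule \<psi>_nonzero)
  then obtain v where v: "v \<in> W n" "cmod (w - v) + r (n + Suc j) / 6 \<le> r n / 6"
    using W_ancestor[of w n "Suc j"] by auto
  have "cmod (x - v) \<le> cmod (x - w) + cmod (w - v)"
    using norm_triangle_ineq[of "x - w" "w - v"] by simp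
  moreover have "256 * R (n + j) \<le> r n" using R_le_r[of "n + j"] r_antimono[of n j] by linarith
  ultimately have "cmod (x - v) < r n / 4"
    using w v r_pos[of "n + Suc j"] r_pos[of n] by linarith
  then show ?thesis using v by blast
qed

lemma norm_term_le: "cmod (C (n + i) / C n * \<psi> (n + i) x) \<le> 2 * R n * (1 / 4) ^ i"
proof -
  have "cmod (C (n + i) / C n) \<le> 1"
    using norm_C_antimono[of n i] C_nonzero[of n] by (simp add: norm_divide)
  then have "cmod (C (n + i) / C n * \<psi> (n + i) x) \<le> 1 * (2 * R (n + i))"
    unfolding norm_mult by (intro mult_mono norm_\<psi>_le) auto
  then show ?thesis using R_geometric[of n i] by linarith
qed

lemma summable_off: "summable (\<lambda>i. C (n + i) / C n * \<psi> (n + i) x)"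
  by (rule summable_comparison_test'[where g="\<lambda>i. 2 * R n * (1 / 4) ^ i" and N=0])
    (intro summable_mult summable_geometric, simp, rule norm_term_le)

lemma norm_off_le: "cmod (off n x) \<le> 3 * R n"
proof -
  have "cmod (off n x) \<le> (\<Sum>i. 2 * R n * (1 / 4) ^ i)"
    unfolding off_def by (rule norm_suminf_le[OF norm_term_le]) (intro summable_mult summable_geometric, simp)
  also have "\<dots> = 2 * R n * (4 / 3)"
    by (subst suminf_mult) (auto simp: suminf_geometric summable_geometric)
  finally show ?thesis using R_pos[of n] by simp
qed

lemma f_eq_F_off: "f x = F n x + C n * off n x"
proof -
  have "summable (\<lambda>i. C i * \<psi> i x)" using summable_off[of 0 x] by simp
  then have "(\<Sum>i. C i * \<psi> i x) = (\<Sum>i. C (i + n) * \<psi> (i + n) x) + (\<Sum>i<n. C i * \<psi> i x)"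
    by (rule suminf_split_initial_segment)
  also have "(\<Sum>i. C (i + n) * \<psi> (i + n) x) = (\<Sum>i. C n * (C (n + i) / C n * \<psi> (n + i) x))"
    using C_nonzero[of n] by (simp add: add.commute)
  also have "\<dots> = C n * off n x"
    unfolding off_def by (rule suminf_mult[OF summable_off])
  finally show ?thesis by (simp add: f_def F_def)
qed

lemma off_nonzero:
  assumes "off n x \<noteq> 0"
  shows "\<exists>w\<in>W n. cmod (x - w) < r n / 4"
proof (rule ccontr)
  assume *: "\<not> ?thesis"
  have "\<psi> (n + j) x = 0" for j using \<psi>_support[of n j x] * by blast
  then show False using assms by (simp add: off_def)
qed

text \<open>The same exchange for all remaining generations at once: their total displacement does
  not leave the disc on which \<open>F n\<close> is affine.\<close>

lemma f_eq_F_perturbed: "f x = F n (x + off n x)"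
proof (cases "off n x = 0")
  case True
  then show ?thesis by (simp add: f_eq_F_off[of x n])
next
  case False
  then obtain w where w: "w \<in> W n" "cmod (x - w) < r n / 4" using off_nonzero by blast
  have "cmod (x + off n x - w) \<le> cmod (x - w) + cmod (off n x)"
    using norm_triangle_ineq[of "x - w" "off n x"] by (simp add: algebra_simps)
  then have "cmod (x + off n x - w) \<le> r n" "cmod (x - w) \<le> r n"
    using w norm_off_le[of n x] R_le_r[of n] R_pos[of n] by linarith+
  from F_affine_diff[OF w(1) this] show ?thesis by (simp add: f_eq_F_off[of x n] algebra_simps)
qed

text \<open>Limits of injective maps need not be injective. Here injectivity of \<open>F n\<close>
  turns equal values into \<open>x + off n x = y + off n y\<close>, so the points are at most
  \<open>6 * R n\<close> apart, for every \<open>n\<close>.\<close>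

lemma f_inj: "inj f"
proof (rule injI)
  fix x y assume eq: "f x = f y"
  have le: "cmod (x - y) \<le> r n" for n
  proof -
    have "x + off n x = y + off n y"
      using eq unfolding f_eq_F_perturbed[of _ n] by (rule F_inj)
    then have "x - y = off n y - off n x" by (simp add: algebra_simps)
    then have "cmod (x - y) \<le> cmod (off n y) + cmod (off n x)" by (metis norm_triangle_ineq4)
    then show ?thesis
      using norm_off_le[of n x] norm_off_le[of n y] R_le_r[of n] R_pos[of n] by linarith
  qed
  have "cmod (x - y) \<le> 0"
    by (rule tendsto_lowerbound[OF r_tendsto_0 always_eventually[OF allI]]) (rule le, simp)
  then show "x = y" by simp
qed

lemma f_id: "1 \<le> cmod x \<Longrightarrow> f x = x"
  using off_nonzero[of 0 x] f_eq_F_off[of x 0] by (auto simp: r_0 F_def)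

lemma f_eq_F:
  assumes "\<And>w. w \<in> W n \<Longrightarrow> r n / 4 \<le> cmod (x - w)"
  shows "f x = F n x"
  using off_nonzero[of n x] f_eq_F_off[of x n] assms by fastforce

text \<open>The displacement of generation \<open>n\<close> has a Lipschitz constant of order
  \<open>1 + k n\<close> but enters with the factor \<open>C n\<close>; the assumption says that the
  accumulated contraction outweighs the growing twists.\<close>

lemma f_lipschitz:
  assumes "summable (\<lambda>n. cmod (C n) * (1 + k n))"
  shows "\<exists>L. \<forall>x y. cmod (f x - f y) \<le> L * cmod (x - y)"
proof (intro exI allI)
  fix x y
  define B where "B = (\<Sum>n. 4 * (cmod (C n) * (1 + k n)))"
  have sm: "summable (\<lambda>i. C i * \<psi> i u)" for u using summable_off[of 0 u] by simp
  have "f x - f y = (x - y) + (\<Sum>i. C i * \<psi> i x - C i * \<psi> i y)"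
    unfolding f_def by (subst suminf_diff[OF sm sm, symmetric]) simp
  moreover have "cmod (\<Sum>i. C i * \<psi> i x - C i * \<psi> i y)
      \<le> (\<Sum>i. 4 * (cmod (C i) * (1 + k i)) * cmod (x - y))"
  proof (rule norm_suminf_le)
    show "summable (\<lambda>i. 4 * (cmod (C i) * (1 + k i)) * cmod (x - y))"
      by (intro summable_mult2 summable_mult assms)
    fix i
    have "cmod (C i * \<psi> i x - C i * \<psi> i y) = cmod (C i) * cmod (\<psi> i x - \<psi> i y)"
      by (metis norm_mult right_diff_distrib)
    also have "\<dots> \<le> cmod (C i) * ((4 + 4 * k i) * cmod (x - y))"
      by (intro mult_left_mono \<psi>_lipschitz) auto
    finally show "cmod (C i * \<psi> i x - C i * \<psi> i y) \<le> 4 * (cmod (C i) * (1 + k i)) * cmod (x - y)"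
      by (simp add: algebra_simps)
  qed
  moreover have "(\<Sum>i. 4 * (cmod (C i) * (1 + k i)) * cmod (x - y)) = B * cmod (x - y)"
    unfolding B_def by (intro suminf_mult2[symmetric] summable_mult assms)
  ultimately have "cmod (f x - f y) \<le> cmod (x - y) + B * cmod (x - y)"
    using norm_triangle_ineq[of "x - y" "\<Sum>i. C i * \<psi> i x - C i * \<psi> i y"] by simp
  then show "cmod (f x - f y) \<le> (1 + B) * cmod (x - y)" by (simp add: algebra_simps)
qed

subsection \<open>Distortion\<close>

text \<open>Whole discs instead of annuli: \<open>S n\<close> then contains \<open>A\<close> as
  well, and a single area bound also makes \<open>A\<close> a null set.\<close>

definition S :: "nat \<Rightarrow> complex set"
  where "S n = (\<Union>w\<in>W (Suc n). cball w (R n))"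

text \<open>Distortions of different generations do not multiply. Inside a disc of generation
  \<open>Suc n\<close> the earlier map is affine with a complex slope, so only the newest twist
  counts; off these discs \<open>F (Suc n)\<close> agrees with \<open>F n\<close> nearby.\<close>

lemma F_has_derivative:
  assumes "\<And>n w. w \<in> W (Suc n) \<Longrightarrow> cmod (z - w) \<noteq> R n \<and> cmod (z - w) \<noteq> r (Suc n)"
  shows "\<exists>D. (F n has_derivative D) (at z) \<and>
      ((onorm D)\<^sup>2 \<le> jacobian_det D \<or> (\<exists>n. z \<in> S n \<and> (onorm D)\<^sup>2 \<le> 2 * (1 + k n) * jacobian_det D))"
proof (induction n)
  case 0
  have "(F 0 has_derivative (\<lambda>e. 1 * e + 0 * cnj e)) (at z)"
    by (simp add: F_def[abs_def])
  moreover have "(onorm (\<lambda>e. 1 * e + 0 * cnj e))\<^sup>2 \<le> jacobian_det (\<lambda>e. 1 * e + 0 * cnj e)"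
    unfolding onorm_wirtinger jacobian_wirtinger by simp
  ultimately show ?case by blast
next
  case (Suc n)
  show ?case
  proof (cases "\<exists>w\<in>W (Suc n). cmod (z - w) < R n")
    case True
    then obtain w where w: "w \<in> W (Suc n)" "cmod (z - w) < R n" by blast
    obtain v where v: "v \<in> W n" "cmod (w - v) \<le> r n / 8" using W_parent w by blast
    have F_loc: "F n w + C n * tw n (x - w) = F (Suc n) x" if "x \<in> ball w (R n)" for x
    proof -
      have x: "cmod (x - w) \<le> R n" using that by (simp add: dist_norm norm_minus_commute)
      have "cmod (w + tw n (x - w) - v) \<le> cmod (tw n (x - w)) + cmod (w - v)"
        using norm_triangle_ineq[of "tw n (x - w)" "w - v"] by (simp add: algebra_simps)
      then have "cmod (w + tw n (x - w) - v) \<le> r n" "cmod (w - v) \<le> r n"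
        using v x norm_tw_le[of n "x - w"] R_le_r[of n] r_pos[of n] by linarith+
      from F_affine_diff[OF v(1) this] show ?thesis
        unfolding F_Suc_step step_in_disc[OF w(1) x] by (simp add: algebra_simps)
    qed
    have tr: "(F (Suc n) has_derivative (\<lambda>e. C n * D e)) (at z)"
      if D: "(tw n has_derivative D) (at (z - w))" for D
    proof -
      have "((\<lambda>x. tw n (x - w)) has_derivative D) (at z)"
        using has_derivative_compose[of "\<lambda>x. x - w" "\<lambda>x. x" z UNIV "tw n" D] D
          has_derivative_diff[OF has_derivative_ident has_derivative_const[of w "at z"]] by simp
      then have "((\<lambda>x. F n w + C n * tw n (x - w)) has_derivative (\<lambda>e. C n * D e)) (at z)"
        by (auto intro!: derivative_eq_intros)
      then show ?thesis
        by (rule has_derivative_transform_within_open[of _ _ _ _ "ball w (R n)"])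
          (use w F_loc in \<open>auto simp: dist_norm norm_minus_commute\<close>)
    qed
    show ?thesis
    proof (cases "cmod (z - w) < r (Suc n)")
      case True
      have "((\<lambda>u. c n * u) has_derivative (\<lambda>e. c n * e)) (at (z - w))"
        by (auto intro!: derivative_eq_intros)
      then have "(tw n has_derivative (\<lambda>e. c n * e)) (at (z - w))"
        by (rule has_derivative_transform_within_open[of _ _ _ _ "ball 0 (r (Suc n))"])
          (use True in \<open>auto simp: tw_inner\<close>)
      from tr[OF this]
      have "(F (Suc n) has_derivative (\<lambda>e. C n * c n * e + 0 * cnj e)) (at z)"
        by (simp add: mult.assoc)
      moreover have "(onorm (\<lambda>e. C n * c n * e + 0 * cnj e))\<^sup>2 \<le> jacobian_det (\<lambda>e. C n * c n * e + 0 * cnj e)"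
        unfolding onorm_wirtinger jacobian_wirtinger by simp
      ultimately show ?thesis by blast
    next
      case False
      then have "r (Suc n) < cmod (z - w)" using assms[OF w(1)] by auto
      from twist_has_derivative[OF tw_params this w(2)]
      obtain \<alpha> \<beta> where D: "(tw n has_derivative (\<lambda>e. \<alpha> * e + \<beta> * cnj e)) (at (z - w))"
        "(cmod \<alpha> + cmod \<beta>)\<^sup>2 \<le> 2 * (1 + k n) * ((cmod \<alpha>)\<^sup>2 - (cmod \<beta>)\<^sup>2)"
        unfolding tw_def by metis
      from tr[OF D(1)]
      have "(F (Suc n) has_derivative (\<lambda>e. (C n * \<alpha>) * e + (C n * \<beta>) * cnj e)) (at z)"
        by (simp add: algebra_simps)
      moreover have "(onorm (\<lambda>e. (C n * \<alpha>) * e + (C n * \<beta>) * cnj e))\<^sup>2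
          \<le> 2 * (1 + k n) * jacobian_det (\<lambda>e. (C n * \<alpha>) * e + (C n * \<beta>) * cnj e)"
      proof -
        have "(cmod (C n))\<^sup>2 * (cmod \<alpha> + cmod \<beta>)\<^sup>2
            \<le> (cmod (C n))\<^sup>2 * (2 * (1 + k n) * ((cmod \<alpha>)\<^sup>2 - (cmod \<beta>)\<^sup>2))"
          by (intro mult_left_mono D) auto
        then show ?thesis
          unfolding onorm_wirtinger jacobian_wirtinger norm_mult
          by (simp add: power2_eq_square algebra_simps)
      qed
      moreover have "z \<in> S n"
        using w by (auto simp: S_def dist_norm norm_minus_commute intro!: bexI[of _ w])
      ultimately show ?thesis by blast
    qed
  next
    case False
    define U where "U = (\<Inter>w\<in>W (Suc n). {x. R n < cmod (x - w)})"
    have "open U"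
      unfolding U_def by (intro open_INT finite_W ballI open_Collect_less continuous_intros)
    moreover have "z \<in> U" using False assms by (force simp: U_def)
    moreover have "F n x = F (Suc n) x" if "x \<in> U" for x
      using \<psi>_outside[of n x] that by (force simp: F_Suc U_def)
    ultimately show ?thesis
      using Suc has_derivative_transform_within_open[of "F n" _ z UNIV U "F (Suc n)"] by blast
  qed
qed

definition G :: "complex set"
  where "G = {z. z \<notin> A \<and> (\<forall>n. \<forall>w\<in>W (Suc n). cmod (z - w) \<noteq> R n \<and> cmod (z - w) \<noteq> r (Suc n))}"

text \<open>Off \<open>A\<close> the discs of some generation are missed by a positive margin, so
  \<open>f\<close> coincides with \<open>F n\<close> near the point and no limit is
  involved.\<close>

lemma f_has_derivative:
  assumes "z \<in> G"
  shows "\<exists>D. (f has_derivative D) (at z) \<and>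
      ((onorm D)\<^sup>2 \<le> jacobian_det D \<or> (\<exists>n. z \<in> S n \<and> (onorm D)\<^sup>2 \<le> 2 * (1 + k n) * jacobian_det D))"
proof -
  obtain n where n: "\<And>w. w \<in> W n \<Longrightarrow> r n / 4 < cmod (z - w)"
    using assms unfolding G_def A_def by (auto simp: not_le)
  define U where "U = (\<Inter>w\<in>W n. {x. r n / 4 < cmod (x - w)})"
  have "open U"
    unfolding U_def by (intro open_INT finite_W ballI open_Collect_less continuous_intros)
  moreover have "z \<in> U" using n by (auto simp: U_def)
  moreover have "F n x = f x" if "x \<in> U" for x
    using that by (intro f_eq_F[symmetric]) (auto simp: U_def)
  ultimately show ?thesis
    using has_derivative_transform_within_open[of "F n" _ z UNIV U f] F_has_derivative[of z n] assms
    unfolding G_def by blast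
qed

lemma S_closed: "closed (S n)"
  unfolding S_def by (intro closed_UN finite_W ballI closed_cball)

lemma A_subset_S: "A \<subseteq> S n"
proof
  fix z assume "z \<in> A"
  then obtain w where "w \<in> W (Suc n)" "cmod (z - w) \<le> r (Suc n) / 4" unfolding A_def by blast
  then show "z \<in> S n"
    using r_Suc_le_R[of n] r_pos[of "Suc n"]
    by (auto simp: S_def dist_norm norm_minus_commute intro!: bexI[of _ w])
qed

lemma A_closed: "closed A"
proof -
  have "A = (\<Inter>n. \<Union>w\<in>W n. cball w (r n / 4))"
    by (auto simp: A_def dist_norm norm_minus_commute)
  then show ?thesis by (simp add: closed_INT closed_UN finite_W)
qed

lemma emeasure_S_le: "emeasure lborel (S n) \<le> ennreal (pi * ((\<Prod>i<Suc n. real (m i))\<^sup>2 * (R n)\<^sup>2))"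
proof -
  have "emeasure lborel (S n) \<le> (\<Sum>w\<in>W (Suc n). emeasure lborel (cball w (R n)))"
    unfolding S_def by (rule emeasure_subadditive_finite) (auto simp: finite_W)
  also have "\<dots> = (\<Sum>w\<in>W (Suc n). ennreal (pi * (R n)\<^sup>2))"
    using R_pos[of n] by (intro sum.cong refl) (simp add: emeasure_cball unit_ball_vol_2)
  also have "\<dots> = ennreal (real (card (W (Suc n))) * (pi * (R n)\<^sup>2))"
    by (simp add: ennreal_mult ennreal_of_nat_eq_real_of_nat)
  also have "\<dots> \<le> ennreal ((\<Prod>i<Suc n. real (m i))\<^sup>2 * (pi * (R n)\<^sup>2))"
  proof (intro ennreal_leI mult_right_mono)
    have "real (card (W (Suc n))) \<le> real ((\<Prod>i<Suc n. m i)\<^sup>2)"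
      using card_W_le[of "Suc n"] by (simp only: of_nat_le_iff)
    then show "real (card (W (Suc n))) \<le> (\<Prod>i<Suc n. real (m i))\<^sup>2" by simp
  qed auto
  finally show ?thesis by (simp add: mult_ac)
qed

lemma f_exp_integrable_distortion:
  assumes p: "0 < p"
    and lip: "summable (\<lambda>n. cmod (C n) * (1 + k n))"
    and area: "summable (\<lambda>n. exp (p * (2 * (1 + k n))) * ((\<Prod>i<Suc n. real (m i))\<^sup>2 * (R n)\<^sup>2))"
  shows "exp_integrable_distortion p f"
proof -
  obtain L where L: "\<And>x y. cmod (f x - f y) \<le> L * cmod (x - y)" using f_lipschitz[OF lip] by blast
  have "0 \<le> L" using order_trans[OF norm_ge_zero L[of 1 0]] by simp
  then have "continuous_on UNIV f"
    by (intro lipschitz_on_continuous_on[of L] lipschitz_onI) (auto simp: dist_norm L)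
  then have homeo: "sense_preserving_homeo f" using f_inj f_id by (rule sense_preserving_homeoI)
  define a where "a = (\<lambda>n. exp (p * (2 * (1 + k n))) * (pi * ((\<Prod>i<Suc n. real (m i))\<^sup>2 * (R n)\<^sup>2)))"
  have "summable (\<lambda>n. pi * (exp (p * (2 * (1 + k n))) * ((\<Prod>i<Suc n. real (m i))\<^sup>2 * (R n)\<^sup>2)))"
    by (rule summable_mult[OF area])
  then have a: "summable a" unfolding a_def by (simp add: mult_ac)
  have a0: "0 \<le> a n" for n by (simp add: a_def)
  have le: "ennreal (exp (p * (2 * (1 + k n)))) * emeasure lborel (S n) \<le> ennreal (a n)" for n
    unfolding a_def using emeasure_S_le[of n] by (subst ennreal_mult) (auto intro: mult_left_mono)
  have sum: "(\<Sum>n. ennreal (exp (p * (2 * (1 + k n)))) * emeasure lborel (S n)) < \<infinity>"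
  proof -
    have "(\<Sum>n. ennreal (exp (p * (2 * (1 + k n)))) * emeasure lborel (S n)) \<le> (\<Sum>n. ennreal (a n))"
      by (intro suminf_le le) auto
    also have "\<dots> = ennreal (\<Sum>n. a n)" by (rule suminf_ennreal2[OF a0 a])
    finally show ?thesis by (simp add: le_less_trans)
  qed
  \<comment> \<open>The exponential weight is at least \<open>1\<close>, so the areas of the
    \<open>S n\<close> tend to zero along with the summable sequence \<open>a\<close>; this makes
    \<open>A\<close> a null set.\<close>
  have Sle: "emeasure lborel (S n) \<le> ennreal (a n)" for n
  proof -
    have "1 \<le> exp (p * (2 * (1 + k n)))" using p k_nonneg[of n] by simp
    then have "1 * emeasure lborel (S n) \<le> ennreal (exp (p * (2 * (1 + k n)))) * emeasure lborel (S n)"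
      by (intro mult_right_mono) auto
    then show ?thesis using le[of n] by simp
  qed
  have "emeasure lborel A \<le> ennreal (a n)" for n
    using emeasure_mono[OF A_subset_S[of n], of lborel] S_closed[of n] Sle[of n]
    by (auto intro: order_trans)
  then have "emeasure lborel A \<le> 0"
    using tendsto_ennrealI[OF summable_LIMSEQ_zero[OF a]]
    by (intro tendsto_lowerbound[of "\<lambda>n. ennreal (a n)"]) auto
  then have Anull: "A \<in> null_sets lborel"
    using A_closed by (auto simp: null_sets_def)
  define Z where "Z = (\<Union>n. \<Union>w\<in>W (Suc n). sphere w (R n) \<union> sphere w (r (Suc n)))"
  have "sphere w \<rho> \<in> null_sets lborel" for w :: complex and \<rho>
    using negligible_sphere[of w \<rho>] by (simp add: negligible_iff_null_sets null_sets_completion_iff)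
  then have "Z \<in> null_sets lborel"
    unfolding Z_def
    by (intro null_sets_UN null_sets_UN' null_sets.Un) (auto intro: countable_finite finite_W)
  moreover have "- G = A \<union> Z"
    by (auto simp: G_def Z_def dist_norm norm_minus_commute)
  ultimately have Gnull: "- G \<in> null_sets lborel" using Anull by (simp add: null_sets.Un)
  then have "- G \<in> sets borel" by auto
  then have G: "G \<in> sets borel" by (metis borel_comp double_compl)
  show ?thesis
  proof (rule exp_integrable_distortionI[OF homeo L G Gnull, of S p "\<lambda>n. 2 * (1 + k n)"])
    show "1 \<le> 2 * (1 + k n)" for n using k_nonneg[of n] by simp
  qed (use p sum S_closed f_has_derivative in auto)
qed

end

subsection \<open>Winding and contraction along rays\<close>

lemma Re_divide_pos:
  assumes "cmod (P - Q) < cmod Q"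
  shows "0 < Re (P / Q)"
proof -
  have Q: "Q \<noteq> 0" using assms by auto
  then have "P / Q - 1 = (P - Q) / Q" by (simp add: field_simps)
  then have "cmod (P / Q - 1) < 1" using assms Q by (simp add: norm_divide)
  then have "\<bar>Re (P / Q - 1)\<bar> < 1" using abs_Re_le_cmod le_less_trans by blast
  then show ?thesis by simp
qed

lemma is_Arg_mult: "is_Arg z a \<Longrightarrow> is_Arg w b \<Longrightarrow> is_Arg (z * w) (a + b)"
  unfolding is_Arg_def by (simp add: norm_mult distrib_left exp_add) (metis mult.commute mult.left_commute)

context twist_tree
begin

text \<open>A quantitative form of the fact that the exterior of a disc stays outside its image.
  After the newest step the point is either in the parent disc, where \<open>F n\<close> is affine,
  or the estimate for the parent applies and loses only the distance \<open>r n / 8\<close> of the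
  two centres.\<close>

lemma F_expanding:
  assumes "w \<in> W n" "r n < cmod (x - w)"
  shows "cmod (C n) * r n \<le> cmod (F n x - F n w)"
  using assms
proof (induction n arbitrary: w x)
  case 0
  then show ?case by (simp add: F_def)
next
  case (Suc n)
  define y where "y = x + \<psi> n x"
  obtain v where v: "v \<in> W n" "cmod (w - v) \<le> r n / 8" using W_parent Suc.prems by blast
  have "w + \<psi> n w = w"
    using step_in_disc[OF Suc.prems(1), of w] R_pos[of n] by simp
  then have F: "F (Suc n) x - F (Suc n) w = F n y - F n w" by (simp add: F_Suc_step y_def)
  have yw: "cmod (c n) * r (Suc n) \<le> cmod (y - w)"
  proof (cases "cmod (x - w) \<le> R n")
    case True
    then have "y - w = tw n (x - w)" using step_in_disc[OF Suc.prems(1) True] by (simp add: y_def)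
    then show ?thesis
      using norm_tw_ge[of n "x - w"] Suc.prems(2) mult_left_mono[of "r (Suc n)" "cmod (x - w)" "cmod (c n)"]
      by simp
  next
    case False
    then have "R n < cmod (y - w)" using step_outside_disc[OF Suc.prems(1), of x] by (simp add: y_def)
    moreover have "cmod (c n) * r (Suc n) \<le> r (Suc n)"
      using norm_c_le[of n] r_pos[of "Suc n"] by (simp add: mult_left_le_one_le)
    ultimately show ?thesis using r_Suc_le_R[of n] by linarith
  qed
  have wv: "cmod (w - v) \<le> r n" using v r_pos[of n] by simp
  show ?case
  proof (cases "cmod (y - v) \<le> r n")
    case True
    have "cmod (C n) * (cmod (c n) * r (Suc n)) \<le> cmod (C n) * cmod (y - w)"
      using yw by (intro mult_left_mono) auto
    then show ?thesis
      unfolding F F_affine_diff[OF v(1) True wv] by (simp add: C_Suc norm_mult mult.assoc)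
  next
    case False
    then have "cmod (C n) * r n \<le> cmod (F n y - F n v)" by (intro Suc.IH[OF v(1)]) simp
    moreover have "cmod (F n w - F n v) \<le> cmod (C n) * (r n / 8)"
      using F_affine[OF v(1) wv] mult_left_mono[OF v(2), of "cmod (C n)"] by (simp add: norm_mult)
    moreover have "cmod (F n y - F n v) \<le> cmod (F n y - F n w) + cmod (F n w - F n v)"
      using norm_triangle_ineq[of "F n y - F n w" "F n w - F n v"] by simp
    ultimately have 1: "cmod (C n) * r n - cmod (C n) * (r n / 8) \<le> cmod (F n y - F n w)" by linarith
    have "cmod (C (Suc n)) * r (Suc n) \<le> cmod (C n) * (r n - r n / 8)"
      using r_Suc_le_r[of n] r_pos[of n] r_pos[of "Suc n"] by (intro mult_mono norm_C_Suc_le) auto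
    then show ?thesis using 1 unfolding F right_diff_distrib by linarith
  qed
qed

text \<open>In the disc of \<open>v\<close> this is affinity of \<open>F n\<close>; outside,
  \<open>F_expanding\<close> loses the quarter by which \<open>z\<close> may be off centre, hence
  the cap \<open>3 / 4 * r n\<close>.\<close>

lemma F_diff_ge:
  assumes v: "v \<in> W n" "cmod (z - v) \<le> r n / 4" and a: "a \<le> cmod (x - z)" "a \<le> 3 / 4 * r n"
  shows "cmod (C n) * a \<le> cmod (F n x - F n z)"
proof -
  have zv: "cmod (z - v) \<le> r n" using v r_pos[of n] by simp
  show ?thesis
  proof (cases "cmod (x - v) \<le> r n")
    case True
    show ?thesis
      unfolding F_affine_diff[OF v(1) True zv] using a by (simp add: norm_mult mult_left_mono)
  next
    case False
    then have 1: "cmod (C n) * r n \<le> cmod (F n x - F n v)" by (intro F_expanding[OF v(1)]) simp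
    have 2: "cmod (F n z - F n v) \<le> cmod (C n) * (r n / 4)"
      using F_affine[OF v(1) zv] mult_left_mono[OF v(2), of "cmod (C n)"] by (simp add: norm_mult)
    have 3: "cmod (F n x - F n v) \<le> cmod (F n x - F n z) + cmod (F n z - F n v)"
      using norm_triangle_ineq[of "F n x - F n z" "F n z - F n v"] by simp
    have "cmod (C n) * a \<le> cmod (C n) * (3 / 4 * r n)" using a by (intro mult_left_mono) auto
    also have "\<dots> = cmod (C n) * r n - cmod (C n) * (r n / 4)" by (simp add: algebra_simps)
    finally show ?thesis using 1 2 3 by linarith
  qed
qed

text \<open>Since a number in the right half-plane has its argument in a bounded range, each generation
  contributes the rotation of its own twist up to a bounded error, whatever the ray.\<close>

lemma ratio_Re_pos:
  assumes w: "w \<in> W (Suc n)" "cmod (z - w) \<le> r (Suc n) / 4"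
    and v: "v \<in> W n" "cmod (z - v) \<le> r n / 4" and xz: "x \<noteq> z"
  shows "0 < Re ((F (Suc n) x - F (Suc n) z) / (tf n (cmod (x - w)) * (F n x - F n z)))"
proof -
  define h where "h = tf n (cmod (x - w))"
  have zw: "cmod (z - w) \<le> R n" using w r_Suc_le_R[of n] r_pos[of "Suc n"] by simp
  have zv: "cmod (z - v) \<le> r n" using v r_pos[of n] by simp
  have xv: "cmod (x - v) \<le> r n" if "cmod (x - w) \<le> R n"
  proof -
    have "cmod (x - v) \<le> cmod (x - w) + (cmod (z - w) + cmod (z - v))"
      using norm_triangle_ineq4[of "x - w" "(z - w) - (z - v)"] norm_triangle_ineq4[of "z - w" "z - v"]
      by simp
    then show ?thesis using that zw v R_le_r[of n] r_pos[of n] by linarith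
  qed
  have Fx: "F n x - F n z \<noteq> 0" using F_inj[of n x z] xz by auto
  have h0: "h \<noteq> 0" unfolding h_def tf_def by (rule twist_factor_nonzero[OF tw_params])
  have split: "(F (Suc n) x - F (Suc n) z) - h * (F n x - F n z)
      = (F n x - F n z) * (1 - h) + C n * (\<psi> n x - \<psi> n z)"
    by (simp add: F_Suc algebra_simps)
  have "cmod ((F (Suc n) x - F (Suc n) z) - h * (F n x - F n z)) < cmod (h * (F n x - F n z))"
  proof (cases "cmod (x - w) \<le> R n")
    case True
    have lin: "F n x - F n z = C n * (x - z)" by (rule F_affine_diff[OF v(1) xv[OF True] zv])
    have z': "\<psi> n z = c n * (z - w) - (z - w)"
      using w r_pos[of "Suc n"] by (subst \<psi>_inside[OF w(1) zw]) (simp add: tw_inner)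
    show ?thesis
    proof (cases "cmod (x - w) \<le> r (Suc n)")
      case inner: True
      \<comment> \<open>Both points lie in the inner disc and undergo the same linear map, so the
        ratio is exactly \<open>1\<close>.\<close>
      have hc: "h = c n"
        unfolding h_def c_def tf_def by (rule twist_factor_inner[OF tw_params inner])
      have x': "\<psi> n x = c n * (x - w) - (x - w)"
        by (subst \<psi>_inside[OF w(1) True]) (simp add: tw_inner[OF inner])
      have "(F (Suc n) x - F (Suc n) z) - h * (F n x - F n z) = 0"
        unfolding split unfolding lin z' x' hc by (simp add: algebra_simps)
      then show ?thesis using Fx h0 by simp
    next
      case False
      \<comment> \<open>In the annulus the only error is that \<open>z\<close> is multiplied by
        \<open>c n\<close> instead of \<open>h\<close>. As \<open>c n\<close> is the smaller factor
        and \<open>z\<close> is within \<open>r (Suc n) / 4\<close> of the centre, the error is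
        below the required bound.\<close>
      have ch: "cmod (c n) \<le> cmod h"
        using False norm_twist_factor_mono[OF tw_params, of "r (Suc n)" "cmod (x - w)" n]
        unfolding h_def c_def tf_def by simp
      have x': "\<psi> n x = h * (x - w) - (x - w)"
        by (subst \<psi>_inside[OF w(1) True]) (simp add: tw_eq h_def mult.commute)
      have eq: "(F (Suc n) x - F (Suc n) z) - h * (F n x - F n z) = C n * ((h - c n) * (z - w))"
        unfolding split unfolding lin z' x' by (simp add: algebra_simps)
      have "cmod ((h - c n) * (z - w)) \<le> (2 * cmod h) * (r (Suc n) / 4)"
        unfolding norm_mult using w ch norm_triangle_ineq4[of h "c n"] by (intro mult_mono) auto
      also have "\<dots> = cmod h * (r (Suc n) / 2)" by simp
      also have "\<dots> < cmod h * cmod (x - z)"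
      proof (rule mult_strict_left_mono)
        have "cmod (x - w) \<le> cmod (x - z) + cmod (z - w)"
          using norm_triangle_ineq[of "x - z" "z - w"] by simp
        then show "r (Suc n) / 2 < cmod (x - z)" using False w r_pos[of "Suc n"] by linarith
      qed (use h0 in simp)
      finally have "cmod (C n) * cmod ((h - c n) * (z - w)) < cmod (C n) * (cmod h * cmod (x - z))"
        using C_nonzero[of n] by simp
      then show ?thesis unfolding eq unfolding lin by (simp add: norm_mult mult_ac)
    qed
  next
    case False
    have h: "h = 1"
      using False unfolding h_def tf_def by (intro twist_factor_outer[OF tw_params]) simp
    have eq: "(F (Suc n) x - F (Suc n) z) - h * (F n x - F n z) = C n * (\<psi> n x - \<psi> n z)"
      unfolding F_Suc h by (simp add: algebra_simps)
    have "\<psi> n z = tw n (z - w) - (z - w)" by (rule \<psi>_inside[OF w(1) zw])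
    then have \<psi>z: "cmod (\<psi> n z) \<le> r (Suc n) / 2" using norm_tw_diff_le[of n "z - w"] w by simp
    have xw: "cmod (x - w) \<le> cmod (x - z) + r (Suc n) / 4"
      using norm_triangle_ineq[of "x - z" "z - w"] w by simp
    \<comment> \<open>A strict bound for the difference of the two displacements that does not
      exceed the distance from \<open>x\<close> to \<open>z\<close>: if \<open>x\<close> is moved at
      all, then by a foreign disc, so it is at least \<open>15 * R n\<close> from \<open>w\<close>
      but moves by at most \<open>2 * R n\<close>.\<close>
    define a where "a = cmod (\<psi> n x) + r (Suc n)"
    have rp: "0 < r (Suc n)" by (rule r_pos)
    have "a \<le> cmod (x - z)"
    proof (cases "\<psi> n x = 0")
      case True
      then show ?thesis using xw False r_Suc_le[of n] rp by (simp add: a_def)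
    next
      case nz: False
      then obtain w' where w': "w' \<in> W (Suc n)" "cmod (x - w') < R n" by (rule \<psi>_nonzero)
      then have "15 * R n \<le> cmod (x - w)" using False w by (intro other_disc_far[of w']) auto
      then show ?thesis using xw norm_\<psi>_le[of n x] r_Suc_le[of n] rp unfolding a_def by linarith
    qed
    moreover have "a \<le> 3 / 4 * r n"
      using norm_\<psi>_le[of n x] r_Suc_le_R[of n] R_le_r[of n] R_pos[of n] unfolding a_def by linarith
    ultimately have 1: "cmod (C n) * a \<le> cmod (F n x - F n z)" by (rule F_diff_ge[OF v])
    have "cmod (\<psi> n x - \<psi> n z) < a"
      using norm_triangle_ineq4[of "\<psi> n x" "\<psi> n z"] \<psi>z rp unfolding a_def by linarith
    then have "cmod (C n) * cmod (\<psi> n x - \<psi> n z) < cmod (C n) * a" using C_nonzero[of n] by simp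
    then show ?thesis using 1 unfolding eq unfolding h by (simp add: norm_mult)
  qed
  then show ?thesis unfolding h_def by (rule Re_divide_pos)
qed

text \<open>All generations from \<open>n\<close> on displace the two points by at most
  \<open>6 * R n\<close> together, far less than \<open>r n / 2\<close>. Passing to the limit thus
  costs one more bounded argument, as long as the ray has not come closer.\<close>

lemma limit_ratio_Re_pos:
  assumes v: "v \<in> W n" "cmod (z - v) \<le> r n / 4" and x: "r n / 2 \<le> cmod (x - z)"
  shows "0 < Re ((f x - f z) / (F n x - F n z))"
proof (rule Re_divide_pos)
  have eq: "(f x - f z) - (F n x - F n z) = C n * (off n x - off n z)"
    by (simp add: f_eq_F_off[of _ n] algebra_simps)
  have "cmod (off n x - off n z) \<le> 6 * R n"
    using norm_triangle_ineq4[of "off n x" "off n z"] norm_off_le[of n x] norm_off_le[of n z] by linarith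
  then have "cmod (off n x - off n z) < r n / 2" using R_le_r[of n] R_pos[of n] by linarith
  then have "cmod (C n) * cmod (off n x - off n z) < cmod (C n) * (r n / 2)" using C_nonzero[of n] by simp
  also have "\<dots> \<le> cmod (F n x - F n z)" using r_pos[of n] x by (intro F_diff_ge[OF v]) auto
  finally show "cmod ((f x - f z) - (F n x - F n z)) < cmod (F n x - F n z)"
    unfolding eq norm_mult .
qed

lemma norm_f_diff_le:
  assumes v: "v \<in> W n" "cmod (z - v) \<le> r n / 4" and x: "cmod (x - z) \<le> r n / 2"
  shows "cmod (f x - f z) \<le> cmod (C n)"
proof -
  have "cmod (x - v) \<le> r n"
    using norm_triangle_ineq[of "x - z" "z - v"] v x r_pos[of n] by simp
  moreover have "cmod (z - v) \<le> r n" using v r_pos[of n] by simp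
  ultimately have "F n x - F n z = C n * (x - z)" by (rule F_affine_diff[OF v(1)])
  then have "f x - f z = C n * ((x - z) + (off n x - off n z))"
    by (simp add: f_eq_F_off[of _ n] algebra_simps)
  moreover have "cmod ((x - z) + (off n x - off n z)) \<le> 1"
    using norm_triangle_ineq[of "x - z" "off n x - off n z"] norm_triangle_ineq4[of "off n x" "off n z"]
      norm_off_le[of n x] norm_off_le[of n z] x R_le_r[of n] R_pos[of n] r_le_1[of n] by linarith
  ultimately show ?thesis by (simp add: norm_mult mult_left_le)
qed

lemma continuous_on_f:
  assumes "summable (\<lambda>n. cmod (C n) * (1 + k n))"
  shows "continuous_on UNIV f"
proof -
  obtain L where L: "\<And>x y. cmod (f x - f y) \<le> L * cmod (x - y)" using f_lipschitz[OF assms] by blast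
  have "0 \<le> L" using order_trans[OF norm_ge_zero L[of 1 0]] by simp
  then show ?thesis
    by (intro lipschitz_on_continuous_on[of L] lipschitz_onI) (auto simp: dist_norm L)
qed

lemma continuous_on_\<psi>: "continuous_on UNIV (\<psi> n)"
  using k_nonneg[of n]
  by (intro lipschitz_on_continuous_on[of "4 + 4 * k n"] lipschitz_onI) (auto simp: dist_norm \<psi>_lipschitz)

lemma continuous_on_F: "continuous_on UNIV (F n)"
  unfolding F_def by (intro continuous_intros continuous_on_\<psi>)

text \<open>An explicit lift is the sum of the twist angles and of principal arguments of numbers in
  the right half-plane, shifted to meet the branch. At the start of the ray all twist angles vanish;
  at its end generation \<open>n\<close> has turned fully, clockwise, and the earlier ones only
  help. The \<open>n + 2\<close> principal arguments, at most \<open>pi\<close> each at both ends,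
  give the linear error.\<close>

lemma ray_arg_le:
  assumes lip: "summable (\<lambda>n. cmod (C n) * (1 + k n))"
    and z: "z \<in> A" and b: "\<And>w. w \<noteq> 0 \<Longrightarrow> is_Arg w (b w) \<and> b w \<le> B"
  shows "ray_arg b f z (of_real (r (Suc n) / 2)) \<le> B + 2 * pi * (real n + 3) - k n * ln (R n / r (Suc n))"
proof -
  define N where "N = Suc n"
  have "\<exists>w. \<forall>i. w i \<in> W i \<and> cmod (z - w i) \<le> r i / 4"
    using z unfolding A_def by (intro choice) blast
  then obtain w where w: "\<And>i. w i \<in> W i" "\<And>i. cmod (z - w i) \<le> r i / 4" by blast
  define x where "x = (\<lambda>t::real. z + of_real t)"
  define tl where "tl = (\<lambda>i t. twist_log (r (Suc i)) (R i) (cmod (x t - w (Suc i))))"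
  define Q where "Q = (\<lambda>i t. (F (Suc i) (x t) - F (Suc i) z)
      / (tf i (cmod (x t - w (Suc i))) * (F i (x t) - F i z)))"
  define Q' where "Q' = (\<lambda>t. (f (x t) - f z) / (F N (x t) - F N z))"
  define a where "a = (\<lambda>t. (\<Sum>i<N. k i * tl i t + Arg (Q i t)) + Arg (Q' t))"
  let ?I = "{r N / 2..1}"
  have xz: "x t \<noteq> z" if "t \<in> ?I" for t using that r_pos[of N] by (auto simp: x_def)
  have Fnz: "F i (x t) - F i z \<noteq> 0" if "t \<in> ?I" for i t
    using F_inj[of i "x t" z] xz[OF that] by auto
  have tfnz: "tf i s \<noteq> 0" for i s unfolding tf_def by (rule twist_factor_nonzero[OF tw_params])
  have Qpos: "0 < Re (Q i t)" if "t \<in> ?I" for i t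
    unfolding Q_def by (rule ratio_Re_pos[OF w(1) w(2) w(1) w(2) xz[OF that]])
  have Q'pos: "0 < Re (Q' t)" if "t \<in> ?I" for t
    unfolding Q'_def using that r_pos[of N] by (intro limit_ratio_Re_pos[OF w(1) w(2)]) (auto simp: x_def)
  have is_arg: "is_Arg (f (x t) - f z) (a t)" if t: "t \<in> ?I" for t
  proof -
    \<comment> \<open>Telescoping: the increment of \<open>F j\<close> is the product of
      \<open>t\<close>, the increment of the identity, with the twist factors and ratios
      \<open>Q\<close> of the generations below \<open>j\<close>.\<close>
    have F_arg: "is_Arg (F j (x t) - F j z) (\<Sum>i<j. k i * tl i t + Arg (Q i t))" for j
    proof (induction j)
      case 0
      have "is_Arg (of_real t) 0" using t r_pos[of N] by (simp add: is_Arg_def)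
      then show ?case by (simp add: F_def x_def)
    next
      case (Suc j)
      define h where "h = tf j (cmod (x t - w (Suc j)))"
      have "is_Arg (exp (of_real s * (1 + \<i>))) s" for s
        unfolding is_Arg_def norm_exp_eq_Re by (simp add: distrib_left exp_add exp_of_real mult.commute)
      then have "is_Arg h (k j * tl j t)"
        unfolding h_def tf_def twist_factor_def tl_def by blast
      moreover have "is_Arg (Q j t) (Arg (Q j t))" using Qpos[OF t, of j] by (intro is_Arg_Arg) auto
      ultimately have "is_Arg ((F j (x t) - F j z) * (h * Q j t))
          ((\<Sum>i<j. k i * tl i t + Arg (Q i t)) + (k j * tl j t + Arg (Q j t)))"
        by (intro is_Arg_mult Suc)
      moreover have "(F j (x t) - F j z) * (h * Q j t) = F (Suc j) (x t) - F (Suc j) z"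
        unfolding Q_def h_def using Fnz[OF t, of j] tfnz by (simp add: field_simps)
      ultimately show ?case by simp
    qed
    have "is_Arg (Q' t) (Arg (Q' t))" using Q'pos[OF t] by (intro is_Arg_Arg) auto
    with F_arg[of N] have "is_Arg ((F N (x t) - F N z) * Q' t) (a t)" unfolding a_def by (rule is_Arg_mult)
    then show ?thesis unfolding Q'_def using Fnz[OF t, of N] by simp
  qed
  have contx: "continuous_on ?I x" unfolding x_def by (intro continuous_intros)
  have cont_comp: "continuous_on ?I (\<lambda>t. g (x t))" if "continuous_on UNIV g" for g :: "complex \<Rightarrow> complex"
    by (rule continuous_on_compose2[OF that contx]) auto
  have cont_tl: "continuous_on ?I (tl i)" for i
    unfolding tl_def by (intro continuous_on_twist_log[OF tw_params] continuous_intros contx)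
  have cont_tf: "continuous_on ?I (\<lambda>t. tf i (cmod (x t - w (Suc i))))" for i
    using cont_tl[of i] unfolding tf_def twist_factor_def tl_def by (intro continuous_intros)
  \<comment> \<open>\<open>Arg\<close> jumps only on the negative real axis, which the right
    half-plane avoids; this makes the sum a continuous lift.\<close>
  have cont_Arg: "continuous_on ?I (\<lambda>t. Arg (g t))"
    if "continuous_on ?I g" "\<And>t. t \<in> ?I \<Longrightarrow> 0 < Re (g t)" for g
  proof -
    have "g t \<notin> \<real>\<^sub>\<le>\<^sub>0" if "t \<in> ?I" for t
      using \<open>\<And>t. t \<in> ?I \<Longrightarrow> 0 < Re (g t)\<close>[OF that] by (auto simp: complex_nonpos_Reals_iff)
    then have "continuous_on ?I (\<lambda>t. Im (Ln (g t)))"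
      using that(1) by (intro continuous_intros) auto
    then show ?thesis
    proof (rule continuous_on_eq)
      fix t assume "t \<in> ?I"
      then have "g t \<noteq> 0" using \<open>\<And>t. t \<in> ?I \<Longrightarrow> 0 < Re (g t)\<close>[of t] by auto
      then show "Im (Ln (g t)) = Arg (g t)" by (simp add: Arg_eq_Im_Ln)
    qed
  qed
  have "continuous_on ?I a"
    unfolding a_def
  proof (intro continuous_on_add continuous_on_sum continuous_on_mult_left cont_tl cont_Arg)
    show "continuous_on ?I (Q i)" for i
      unfolding Q_def using Fnz tfnz by (intro continuous_intros cont_tf cont_comp continuous_on_F) auto
    show "continuous_on ?I Q'"
      unfolding Q'_def using Fnz by (intro continuous_intros cont_comp continuous_on_F continuous_on_f[OF lip]) auto
  qed (use Qpos Q'pos in auto)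
  have Arg_le: "\<bar>Arg u\<bar> \<le> pi" for u using mpi_less_Arg[of u] Arg_le_pi[of u] by simp
  have small: "r N / 2 \<in> ?I" "1 \<in> ?I" using r_le_1[of N] r_pos[of N] by auto
  have a1: "- pi * (real N + 1) \<le> a 1"
  proof -
    have "tl i 1 = 0" for i
      unfolding tl_def
    proof (rule twist_log_outer[OF tw_params])
      have "1 \<le> cmod (x 1 - w (Suc i)) + cmod (z - w (Suc i))"
        using norm_triangle_ineq4[of "x 1 - w (Suc i)" "z - w (Suc i)"] by (simp add: x_def)
      then show "R i \<le> cmod (x 1 - w (Suc i))"
        using w(2)[of "Suc i"] r_le_1[of "Suc i"] r_le_1[of i] R_le_r[of i] by linarith
    qed
    then have "a 1 = (\<Sum>i<N. Arg (Q i 1)) + Arg (Q' 1)" by (simp add: a_def)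
    moreover have "(\<Sum>i<N. - pi) \<le> (\<Sum>i<N. Arg (Q i 1))"
      using Arg_le by (intro sum_mono) (simp add: abs_le_iff minus_le_iff)
    ultimately show ?thesis using Arg_le[of "Q' 1"] by (simp add: algebra_simps abs_le_iff)
  qed
  have aN: "a (r N / 2) \<le> pi * (real N + 1) - k n * ln (R n / r (Suc n))"
  proof -
    let ?t = "r N / 2"
    have "k n * tl n ?t = - (k n * ln (R n / r (Suc n)))"
    proof -
      have "cmod (x ?t - w N) \<le> r N / 2 + cmod (z - w N)"
        using norm_triangle_ineq[of "of_real (r N / 2)" "z - w N"] r_pos[of N]
        by (simp add: x_def algebra_simps)
      then have "cmod (x ?t - w (Suc n)) \<le> r (Suc n)"
        using w(2)[of N] r_pos[of N] by (simp add: N_def)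
      then have "tl n ?t = ln (r (Suc n) / R n)"
        unfolding tl_def by (rule twist_log_inner[OF tw_params])
      also have "\<dots> = - ln (R n / r (Suc n))" using r_pos[of "Suc n"] R_pos[of n] by (simp add: ln_div)
      finally show ?thesis by simp
    qed
    moreover have "(\<Sum>i<N. k i * tl i ?t) \<le> k n * tl n ?t"
    proof -
      have "(\<Sum>i<n. k i * tl i ?t) \<le> 0"
        unfolding tl_def using k_nonneg twist_log_nonpos[OF tw_params]
        by (intro sum_nonpos mult_nonneg_nonpos) auto
      then show ?thesis by (simp add: N_def)
    qed
    moreover have "(\<Sum>i<N. Arg (Q i ?t)) \<le> (\<Sum>i<N. pi)"
      by (intro sum_mono Arg_le_pi)
    moreover have "a ?t = (\<Sum>i<N. k i * tl i ?t) + (\<Sum>i<N. Arg (Q i ?t)) + Arg (Q' ?t)"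
      by (simp add: a_def sum.distrib)
    ultimately show ?thesis using Arg_le_pi[of "Q' ?t"] by (simp add: algebra_simps)
  qed
  have fnz: "f (x 1) - f z \<noteq> 0" using xz[OF small(2)] f_inj by (auto simp: inj_eq)
  obtain j :: int where j: "b (f (x 1) - f z) = a 1 + 2 * of_int j * pi"
    using is_Arg_unique_mod_2pi[OF is_arg[OF small(2)] _ fnz] b[OF fnz] by blast
  define \<phi> where "\<phi> = (\<lambda>t. a t + 2 * of_int j * pi)"
  define l where "l = complex_of_real (r (Suc n) / 2)"
  have l: "cmod l = r N / 2" "sgn l = 1"
    using r_pos[of N] by (auto simp: l_def N_def sgn_div_norm scaleR_conv_of_real)
  have lift: "is_ray_lift b f z (sgn l) (cmod l) \<phi>"
    unfolding is_ray_lift_def l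
  proof (intro conjI ballI)
    show "continuous_on ?I \<phi>" unfolding \<phi>_def by (intro continuous_intros \<open>continuous_on ?I a\<close>)
    show "is_Arg (f (z + of_real t * 1) - f z) (\<phi> t)" if "t \<in> ?I" for t
      using is_arg[OF that] is_Arg_2pi_iff[of "f (x t) - f z" "a t" j]
      by (simp add: \<phi>_def x_def mult_ac)
    show "\<phi> 1 = b (f (z + 1) - f z)" using j by (simp add: \<phi>_def x_def)
  qed
  have "0 < cmod l" "cmod l \<le> 1" using l(1) r_pos[of N] r_le_1[of N] by linarith+
  then have "ray_arg b f z l = \<phi> (cmod l)" by (rule ray_arg_eq[OF f_inj _ _ lift])
  also have "\<dots> = b (f (x 1) - f z) - a 1 + a (r N / 2)" by (simp add: \<phi>_def l j)
  also have "\<dots> \<le> B + 2 * pi * (real n + 3) - k n * ln (R n / r (Suc n))"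
  proof -
    have "b (f (x 1) - f z) \<le> B" using b[OF fnz] by blast
    moreover define P where "P = pi * (real N + 1)"
    moreover have "2 * P \<le> 2 * pi * (real n + 3)"
      unfolding P_def N_def by (simp add: algebra_simps)
    moreover have "- P \<le> a 1" using a1 by (simp add: P_def)
    ultimately show ?thesis using aN by linarith
  qed
  finally show ?thesis by (simp add: l_def)
qed

end

section \<open>Hausdorff dimension of homogeneous Cantor sets\<close>

lemma hausdorff_dim_le:
  assumes "\<And>e. s < e \<Longrightarrow> 0 < e \<and> hausdorff_measure e A = 0"
  shows "hausdorff_dim A \<le> ereal s"
proof (rule ereal_le_epsilon2)
  fix e :: real assume "0 < e"
  then show "hausdorff_dim A \<le> ereal s + ereal e"
    unfolding hausdorff_dim_def using assms[of "s + e"] by (auto intro!: INF_lower2[of "s + e"])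
qed

lemma hausdorff_measure_eq_0I:
  fixes A :: "'a::metric_space set"
  assumes "\<And>\<delta> \<epsilon>. 0 < \<delta> \<Longrightarrow> 0 < \<epsilon> \<Longrightarrow> hausdorff_pre_measure e \<delta> A \<le> ennreal \<epsilon>"
  shows "hausdorff_measure e A = 0"
proof -
  have "hausdorff_pre_measure e \<delta> A = 0" if "0 < \<delta>" for \<delta>
  proof -
    have "hausdorff_pre_measure e \<delta> A \<le> 0 + ennreal \<epsilon>" if "0 < \<epsilon>" for \<epsilon>
      using assms[OF \<open>0 < \<delta>\<close> that] by simp
    then show ?thesis by (metis ennreal_le_epsilon le_zero_eq)
  qed
  then show ?thesis unfolding hausdorff_measure_def by simp
qed

lemma hausdorff_pre_measure_finite_cover:
  fixes A :: "'a::metric_space set"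
  assumes "finite W" "A \<subseteq> (\<Union>w\<in>W. U w)" "\<And>w. w \<in> W \<Longrightarrow> bounded (U w) \<and> diameter (U w) \<le> \<delta>"
    and "0 < \<delta>" "\<And>w. w \<in> W \<Longrightarrow> diameter (U w) powr e \<le> q"
  shows "hausdorff_pre_measure e \<delta> A \<le> ennreal (real (card W) * q)"
proof -
  obtain g :: "nat \<Rightarrow> _" where g: "bij_betw g {..<card W} W"
    using assms(1) by (metis bij_betw_from_nat_into_finite)
  \<comment> \<open>Empty sets fill the finite cover up to a sequence and contribute
    \<open>0 powr e = 0\<close>.\<close>
  define V where "V = (\<lambda>n. if n < card W then U (g n) else {})"
  have gW: "g n \<in> W" if "n < card W" for n using g that by (auto simp: bij_betw_def)
  have "hausdorff_pre_measure e \<delta> A \<le> (\<Sum>n. ennreal (diameter (V n) powr e))"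
    unfolding hausdorff_pre_measure_def
  proof (rule INF_lower, intro CollectI conjI allI)
    show "A \<subseteq> (\<Union>n. V n)"
    proof
      fix x assume "x \<in> A"
      then obtain w where w: "w \<in> W" "x \<in> U w" using assms(2) by blast
      then obtain n where "n \<in> {..<card W}" "g n = w" using g by (metis bij_betw_imp_surj_on imageE)
      then show "x \<in> (\<Union>n. V n)" using w by (auto simp: V_def intro!: exI[of _ n])
    qed
    fix n
    show "bounded (V n)" "diameter (V n) \<le> \<delta>" using assms(3)[OF gW] assms(4) by (auto simp: V_def)
  qed
  also have "\<dots> = (\<Sum>n<card W. ennreal (diameter (V n) powr e))"
    by (rule suminf_finite) (auto simp: V_def)
  also have "\<dots> \<le> (\<Sum>n<card W. ennreal q)"
    using assms(5)[OF gW] by (intro sum_mono ennreal_leI) (auto simp: V_def)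
  also have "\<dots> = ennreal (real (card W) * q)"
    by (cases "0 \<le> q") (auto simp: ennreal_mult ennreal_of_nat_eq_real_of_nat ennreal_neg mult_nonneg_nonpos)
  finally show ?thesis .
qed

text \<open>A set of diameter \<open>\<delta>\<close> meets only the images of points of a square whose side is of
  order \<open>\<delta>\<^bsup>s/2\<^esup>\<close>, so that covers of \<open>A\<close> turn into covers of the unit square.\<close>

lemma hausdorff_dim_ge:
  fixes A :: "complex set" and h :: "real \<Rightarrow> real"
  assumes s: "0 < s" and B: "0 < B"
    and hA: "\<And>x y. x \<in> {0..<1} \<Longrightarrow> y \<in> {0..<1} \<Longrightarrow> Complex (h x) (h y) \<in> A"
    and h: "\<And>x y. x \<in> {0..<1} \<Longrightarrow> y \<in> {0..<1} \<Longrightarrow> \<bar>x - y\<bar> \<le> B * \<bar>h x - h y\<bar> powr (s / 2)"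
  shows "ereal s \<le> hausdorff_dim A"
  unfolding hausdorff_dim_def
proof (rule INF_greatest)
  fix e assume e: "e \<in> {d. 0 < d \<and> hausdorff_measure d A = 0}"
  show "ereal s \<le> ereal e"
  proof (rule ccontr)
    assume "\<not> ereal s \<le> ereal e"
    then have es: "e \<le> s" by simp
    have pos: "0 < e" using e by simp
    define Q where "Q = {z. Re z \<in> {0..<1::real} \<and> Im z \<in> {0..<1::real}}"
    have Qm: "emeasure lborel {z::complex. Re z \<in> {0<..<1} \<and> Im z \<in> {0<..<1}} = 1"
    proof -
      have "{z::complex. Re z \<in> {0<..<1} \<and> Im z \<in> {0<..<1}} = box 0 (Complex 1 1)"
        by (auto simp: in_box_complex_iff)
      then show ?thesis
        by (simp add: emeasure_lborel_box_eq Basis_complex_def inner_complex_def)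
    qed
    \<comment> \<open>Each \<open>U n\<close> accounts for a square of side
      \<open>2 * \<rho>\<close>, that is of area
      \<open>4 * B\<^sup>2 * diameter (U n) powr s\<close>; diameters up to \<open>1\<close> permit
      the smaller exponent \<open>e\<close>. The square stands in for the set \<open>T n\<close>,
      which may fail to be measurable.\<close>
    have bound: "1 \<le> ennreal (4 * B\<^sup>2) * (\<Sum>n. ennreal (diameter (U n) powr e))"
      if U: "A \<subseteq> (\<Union>n. U n)" "\<And>n. bounded (U n) \<and> diameter (U n) \<le> 1" for U :: "nat \<Rightarrow> complex set"
    proof -
      define T where "T = (\<lambda>n. {z \<in> Q. Complex (h (Re z)) (h (Im z)) \<in> U n})"
      have "\<exists>V. T n \<subseteq> V \<and> V \<in> sets lborel \<and> emeasure lborel V \<le> ennreal (4 * B\<^sup>2 * diameter (U n) powr e)" for n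
      proof (cases "T n = {}")
        case True
        then show ?thesis by (intro exI[of _ "{}"]) auto
      next
        case False
        then obtain p where p: "p \<in> T n" by blast
        define \<rho> where "\<rho> = B * diameter (U n) powr (s / 2)"
        have dn: "0 \<le> diameter (U n)" "diameter (U n) \<le> 1" using U(2)[of n] by (auto simp: diameter_ge_0)
        have \<rho>: "0 \<le> \<rho>" unfolding \<rho>_def using B by simp
        have "T n \<subseteq> cbox (p - Complex \<rho> \<rho>) (p + Complex \<rho> \<rho>)"
        proof
          fix z assume z: "z \<in> T n"
          have "dist (Complex (h (Re z)) (h (Im z))) (Complex (h (Re p)) (h (Im p))) \<le> diameter (U n)"
            using U(2)[of n] z p by (intro diameter_bounded_bound) (auto simp: T_def)
          then have le: "cmod (Complex (h (Re z) - h (Re p)) (h (Im z) - h (Im p))) \<le> diameter (U n)"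
            by (simp add: dist_norm minus_complex.ctr)
          have *: "\<bar>x - y\<bar> \<le> \<rho>" if "x \<in> {0..<1}" "y \<in> {0..<1}" "\<bar>h x - h y\<bar> \<le> diameter (U n)" for x y
          proof -
            have "B * \<bar>h x - h y\<bar> powr (s / 2) \<le> \<rho>"
              unfolding \<rho>_def using B s that(3) by (intro mult_left_mono powr_mono2) auto
            then show ?thesis using h[OF that(1,2)] by linarith
          qed
          have "\<bar>h (Re z) - h (Re p)\<bar> \<le> diameter (U n)" "\<bar>h (Im z) - h (Im p)\<bar> \<le> diameter (U n)"
            using abs_Re_le_cmod[of "Complex (h (Re z) - h (Re p)) (h (Im z) - h (Im p))"]
              abs_Im_le_cmod[of "Complex (h (Re z) - h (Re p)) (h (Im z) - h (Im p))"] le by simp_all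
          then have "\<bar>Re z - Re p\<bar> \<le> \<rho>" "\<bar>Im z - Im p\<bar> \<le> \<rho>"
            using z p by (auto intro!: * simp: T_def Q_def)
          then show "z \<in> cbox (p - Complex \<rho> \<rho>) (p + Complex \<rho> \<rho>)"
            by (auto simp: in_cbox_complex_iff abs_le_iff)
        qed
        moreover have "emeasure lborel (cbox (p - Complex \<rho> \<rho>) (p + Complex \<rho> \<rho>)) = ennreal (4 * \<rho>\<^sup>2)"
          using \<rho> by (simp add: emeasure_lborel_cbox_eq Basis_complex_def inner_complex_def power2_eq_square)
        moreover have "4 * \<rho>\<^sup>2 \<le> 4 * B\<^sup>2 * diameter (U n) powr e"
        proof -
          have "\<rho>\<^sup>2 = B\<^sup>2 * (diameter (U n) powr (s / 2) * diameter (U n) powr (s / 2))"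
            by (simp add: \<rho>_def power2_eq_square)
          also have "\<dots> = B\<^sup>2 * diameter (U n) powr s" by (simp flip: powr_add)
          also have "\<dots> \<le> B\<^sup>2 * diameter (U n) powr e"
            using dn es by (intro mult_left_mono powr_mono') auto
          finally show ?thesis by simp
        qed
        ultimately show ?thesis
          by (intro exI[of _ "cbox (p - Complex \<rho> \<rho>) (p + Complex \<rho> \<rho>)"]) (auto intro: ennreal_leI)
      qed
      then obtain V where V: "\<And>n. T n \<subseteq> V n" "\<And>n. V n \<in> sets lborel"
          "\<And>n. emeasure lborel (V n) \<le> ennreal (4 * B\<^sup>2 * diameter (U n) powr e)"
        by metis
      have "{z::complex. Re z \<in> {0<..<1} \<and> Im z \<in> {0<..<1}} \<subseteq> (\<Union>n. V n)"
      proof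
        fix z :: complex assume z: "z \<in> {z. Re z \<in> {0<..<1} \<and> Im z \<in> {0<..<1}}"
        then have "Complex (h (Re z)) (h (Im z)) \<in> A" by (intro hA) auto
        then obtain n where "Complex (h (Re z)) (h (Im z)) \<in> U n" using U(1) by blast
        then have "z \<in> T n" using z by (auto simp: T_def Q_def)
        then show "z \<in> (\<Union>n. V n)" using V(1) by blast
      qed
      then have "1 \<le> emeasure lborel (\<Union>n. V n)"
        unfolding Qm[symmetric] using V(2) by (intro emeasure_mono) auto
      also have "\<dots> \<le> (\<Sum>n. emeasure lborel (V n))"
        using V(2) by (intro emeasure_subadditive_countably) auto
      also have "\<dots> \<le> (\<Sum>n. ennreal (4 * B\<^sup>2) * ennreal (diameter (U n) powr e))"
      proof (intro suminf_le)
        show "emeasure lborel (V n) \<le> ennreal (4 * B\<^sup>2) * ennreal (diameter (U n) powr e)" for n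
          using V(3)[of n] by (simp add: ennreal_mult)
      qed auto
      also have "\<dots> = ennreal (4 * B\<^sup>2) * (\<Sum>n. ennreal (diameter (U n) powr e))" by simp
      finally show ?thesis .
    qed
    have "1 \<le> ennreal (4 * B\<^sup>2) * hausdorff_pre_measure e 1 A"
    proof -
      have "ennreal (1 / (4 * B\<^sup>2)) \<le> hausdorff_pre_measure e 1 A"
        unfolding hausdorff_pre_measure_def
      proof (rule INF_greatest)
        fix U :: "nat \<Rightarrow> complex set"
        assume "U \<in> {U. A \<subseteq> (\<Union>n. U n) \<and> (\<forall>n. bounded (U n) \<and> diameter (U n) \<le> 1)}"
        then have "1 \<le> ennreal (4 * B\<^sup>2) * (\<Sum>n. ennreal (diameter (U n) powr e))"
          by (intro bound) auto
        then have "ennreal (1 / (4 * B\<^sup>2)) * 1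
            \<le> ennreal (1 / (4 * B\<^sup>2)) * (ennreal (4 * B\<^sup>2) * (\<Sum>n. ennreal (diameter (U n) powr e)))"
          by (rule mult_left_mono) simp
        also have "\<dots> = (\<Sum>n. ennreal (diameter (U n) powr e))"
          using B unfolding mult.assoc[symmetric] by (subst ennreal_mult[symmetric]) auto
        finally show "ennreal (1 / (4 * B\<^sup>2)) \<le> (\<Sum>n. ennreal (diameter (U n) powr e))" by simp
      qed
      then have "ennreal (4 * B\<^sup>2) * ennreal (1 / (4 * B\<^sup>2)) \<le> ennreal (4 * B\<^sup>2) * hausdorff_pre_measure e 1 A"
        by (rule mult_left_mono) simp
      then show ?thesis using B by (subst (asm) ennreal_mult[symmetric]) auto
    qed
    moreover have "hausdorff_pre_measure e 1 A \<le> hausdorff_measure e A"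
      unfolding hausdorff_measure_def by (rule SUP_upper) simp
    ultimately show False using e by simp
  qed
qed

context twist_tree
begin

text \<open>The discs of one generation form the cover: their number times \<open>r n powr e\<close>
  is at most \<open>r n powr (e - s)\<close>, which tends to zero.\<close>

lemma hausdorff_dim_A_le:
  assumes card: "\<And>n. (\<Prod>i<n. real (m i))\<^sup>2 * r n powr s \<le> 1" and s: "0 < s"
  shows "hausdorff_dim A \<le> ereal s"
proof (intro hausdorff_dim_le conjI hausdorff_measure_eq_0I)
  fix e assume se: "s < e"
  then show "0 < e" using s by simp
  fix \<delta> \<epsilon> :: real assume \<delta>: "0 < \<delta>" "0 < \<epsilon>"
  have "(\<lambda>n. r n powr (e - s)) \<longlonglongrightarrow> 0 powr (e - s)"
    using se r_pos by (intro tendsto_powr' r_tendsto_0 tendsto_const) (auto intro: always_eventually less_imp_le)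
  then have "\<forall>\<^sub>F n in sequentially. r n powr (e - s) < \<epsilon>"
    using \<delta> by (intro order_tendstoD(2)) auto
  moreover have "\<forall>\<^sub>F n in sequentially. r n < \<delta>" by (rule order_tendstoD(2)[OF r_tendsto_0 \<delta>(1)])
  ultimately have "\<forall>\<^sub>F n in sequentially. r n powr (e - s) < \<epsilon> \<and> r n < \<delta>" by eventually_elim simp
  then obtain n where n: "r n powr (e - s) < \<epsilon>" "r n < \<delta>"
    by (auto simp: eventually_sequentially)
  have diam: "diameter (cball w (r n / 4)) = r n / 2" for w :: complex
    using r_pos[of n] by (simp add: diameter_cball)
  have "hausdorff_pre_measure e \<delta> A \<le> ennreal (real (card (W n)) * r n powr e)"
  proof (rule hausdorff_pre_measure_finite_cover[where U="\<lambda>w. cball w (r n / 4)"])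
    show "A \<subseteq> (\<Union>w\<in>W n. cball w (r n / 4))"
      by (auto simp: A_def dist_norm norm_minus_commute)
    show "bounded (cball w (r n / 4)) \<and> diameter (cball w (r n / 4)) \<le> \<delta>" for w :: complex
      using n r_pos[of n] by (simp add: diam)
    show "diameter (cball w (r n / 4)) powr e \<le> r n powr e" for w :: complex
      unfolding diam using r_pos[of n] se s by (intro powr_mono2) auto
  qed (use finite_W \<delta> in auto)
  also have "\<dots> \<le> ennreal \<epsilon>"
  proof (rule ennreal_leI)
    have "real (card (W n)) \<le> (\<Prod>i<n. real (m i))\<^sup>2"
      using card_W_le[of n] by (metis of_nat_le_iff of_nat_power of_nat_prod)
    then have "real (card (W n)) * r n powr e \<le> (\<Prod>i<n. real (m i))\<^sup>2 * r n powr e"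
      by (rule mult_right_mono) simp
    also have "\<dots> = ((\<Prod>i<n. real (m i))\<^sup>2 * r n powr s) * r n powr (e - s)"
      by (simp add: powr_diff r_pos)
    also have "\<dots> \<le> 1 * r n powr (e - s)" by (intro mult_right_mono card) simp
    finally show "real (card (W n)) * r n powr e \<le> \<epsilon>" using n by simp
  qed
  finally show "hausdorff_pre_measure e \<delta> A \<le> ennreal \<epsilon>" .
qed

section \<open>Mixed-radix digits and the Cantor map\<close>

definition D :: "nat \<Rightarrow> real \<Rightarrow> int"
  where "D n t = \<lfloor>(\<Prod>i<n. real (m i)) * t\<rfloor>"

definition digit :: "nat \<Rightarrow> real \<Rightarrow> nat"
  where "digit n t = nat (D (Suc n) t - int (m n) * D n t)"

text \<open>Digits in the mixed radix \<open>m\<close> are read as coordinates of grid points, so a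
  pair of numbers selects a nested sequence of discs. This is an inverse branch of the Cantor
  function adapted to \<open>m\<close> and \<open>d\<close>.\<close>

definition cantor :: "real \<Rightarrow> real"
  where "cantor t = (\<Sum>i. d i * digit i t)"

lemma D_Suc: "int (m n) * D n t \<le> D (Suc n) t" "D (Suc n) t < int (m n) * (D n t + 1)"
proof -
  define u where "u = (\<Prod>i<n. real (m i)) * t"
  have eq: "D n t = \<lfloor>u\<rfloor>" "D (Suc n) t = \<lfloor>real (m n) * u\<rfloor>"
    unfolding D_def u_def by (simp_all add: mult_ac)
  have "real (m n) * of_int \<lfloor>u\<rfloor> \<le> real (m n) * u" by (intro mult_left_mono) auto
  then have "of_int (int (m n) * \<lfloor>u\<rfloor>) \<le> real (m n) * u" by simp
  then show "int (m n) * D n t \<le> D (Suc n) t" unfolding eq le_floor_iff .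
  have "real (m n) * u < real (m n) * (of_int \<lfloor>u\<rfloor> + 1)"
    using m_pos[of n] by (intro mult_strict_left_mono) linarith+
  then have "real (m n) * u < of_int (int (m n) * (\<lfloor>u\<rfloor> + 1))" by simp
  then show "D (Suc n) t < int (m n) * (D n t + 1)" unfolding eq floor_less_iff .
qed

lemma digit_int: "int (digit n t) = D (Suc n) t - int (m n) * D n t"
  using D_Suc(1)[of n t] by (simp add: digit_def)

lemma digit_less: "digit n t < m n"
  using D_Suc(2)[of n t] digit_int[of n t] by (simp add: distrib_left)

lemma cantor_tail:
  "summable (\<lambda>i. d i * digit i t)"
  "0 \<le> cantor t - (\<Sum>i<n. d i * digit i t)"
  "cantor t - (\<Sum>i<n. d i * digit i t) \<le> r n / 12"
proof -
  have le: "d i * digit i t \<le> r i / 16" for i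
  proof -
    have "d i * digit i t \<le> d i * m i"
      using digit_less[of i t] d_pos[of i] by (intro mult_left_mono) auto
    then show ?thesis using block[of i] by linarith
  qed
  have geo: "r (n + i) \<le> r n * (1 / 4) ^ i" for n i
  proof (induction i)
    case (Suc i)
    then show ?case using r_Suc_le_r[of "n + i"] r_pos[of "Suc (n + i)"] by simp
  qed simp
  have le': "norm (d (i + n) * digit (i + n) t) \<le> r n / 16 * (1 / 4) ^ i" for i n
    using le[of "i + n"] geo[of n i] d_pos[of "i + n"] by (simp add: add.commute)
  have sg: "summable (\<lambda>i. r n / 16 * (1 / 4 :: real) ^ i)" for n
    by (intro summable_mult summable_geometric) simp
  have sm: "summable (\<lambda>i. d (i + n) * digit (i + n) t)" for n
    by (rule summable_comparison_test'[where N=0, OF sg]) (rule le')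
  from sm[of 0] show sm0: "summable (\<lambda>i. d i * digit i t)" by simp
  have eq: "cantor t - (\<Sum>i<n. d i * digit i t) = (\<Sum>i. d (i + n) * digit (i + n) t)"
    unfolding cantor_def using suminf_split_initial_segment[OF sm0, of n] by simp
  show "0 \<le> cantor t - (\<Sum>i<n. d i * digit i t)"
    unfolding eq by (intro suminf_nonneg sm) (simp add: less_imp_le[OF d_pos])
  have "(\<Sum>i. d (i + n) * digit (i + n) t) \<le> (\<Sum>i. r n / 16 * (1 / 4) ^ i)"
    by (intro suminf_le sm sg abs_le_D1[OF le'[unfolded real_norm_def]])
  also have "\<dots> = r n / 16 * (4 / 3)"
    by (subst suminf_mult) (auto simp: suminf_geometric summable_geometric)
  finally show "cantor t - (\<Sum>i<n. d i * digit i t) \<le> r n / 12" unfolding eq by simp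
qed

lemma cantor_in_A: "Complex (cantor x) (cantor y) \<in> A"
  unfolding A_def
proof (intro CollectI allI)
  fix n
  define P where "P = (\<lambda>n t. \<Sum>i<n. d i * digit i t)"
  have "Complex (P n x) (P n y) \<in> W n"
  proof (induction n)
    case 0
    then show ?case by (simp add: P_def zero_complex.code)
  next
    case (Suc n)
    have "Complex (P (Suc n) x) (P (Suc n) y)
        = Complex (P n x) (P n y) + of_real (d n) * Complex (real (digit n x)) (real (digit n y))"
      by (simp add: P_def complex_eq_iff)
    then show ?case
      unfolding W.simps using Suc digit_less
      by (intro image_eqI[of _ _ "(Complex (P n x) (P n y), digit n x, digit n y)"]) auto
  qed
  moreover have "cmod (Complex (cantor x) (cantor y) - Complex (P n x) (P n y)) \<le> r n / 4"
    using cmod_le[of "Complex (cantor x) (cantor y) - Complex (P n x) (P n y)"]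
      cantor_tail(2,3)[where n=n and t=x] cantor_tail(2,3)[where n=n and t=y] r_pos[of n]
    unfolding P_def by simp
  ultimately show "\<exists>w\<in>W n. cmod (Complex (cantor x) (cantor y) - w) \<le> r n / 4" by blast
qed

text \<open>Let the digits first differ at place \<open>n\<close>, by \<open>j\<close>. As the tails
  are tiny, the images are at least \<open>d n * j / 2\<close> apart, while the numbers differ by at
  most \<open>2 * j\<close> cells of generation \<open>Suc n\<close>. The identity
  \<open>d n = r n / (16 * m n)\<close> connects the two; \<open>64\<close> is this \<open>2\<close>
  times the \<open>32\<close> made up of \<open>16\<close> and the halving.\<close>

lemma cantor_inverse_hoelder:
  assumes s: "0 < s" "s \<le> 2" and block_eq: "\<And>n. 16 * d n * m n = r n"
    and count: "\<And>n. 1 / (\<Prod>i<n. real (m i)) \<le> r n powr (s / 2)"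
    and x: "x \<in> {0..<1}" and y: "y \<in> {0..<1}"
  shows "\<bar>x - y\<bar> \<le> 64 * \<bar>cantor x - cantor y\<bar> powr (s / 2)"
proof (cases "x = y")
  case False
  define M where "M = (\<lambda>n. \<Prod>i<n. real (m i))"
  have M: "0 < M n" for n unfolding M_def using m_pos by (intro prod_pos) simp
  have close: "\<bar>x - y\<bar> \<le> (\<bar>D n x - D n y\<bar> + 1) / M n" for n
  proof -
    have "\<bar>M n * x - M n * y\<bar> \<le> of_int \<bar>D n x - D n y\<bar> + 1"
      unfolding D_def M_def by linarith
    moreover have "\<bar>M n * x - M n * y\<bar> = M n * \<bar>x - y\<bar>"
      using M[of n] by (simp add: abs_mult flip: right_diff_distrib)
    ultimately show ?thesis using M[of n] by (simp add: pos_le_divide_eq mult.commute)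
  qed
  have "\<exists>n. D n x \<noteq> D n y"
  proof (rule ccontr)
    assume "\<not> ?thesis"
    then have "\<bar>x - y\<bar> \<le> r n powr (s / 2)" for n
      using close[of n] count[of n] unfolding M_def by simp
    moreover have "(\<lambda>n. r n powr (s / 2)) \<longlonglongrightarrow> 0 powr (s / 2)"
      using s r_pos by (intro tendsto_powr' r_tendsto_0 tendsto_const) (auto intro: always_eventually less_imp_le)
    ultimately have "\<bar>x - y\<bar> \<le> 0"
      using s by (intro tendsto_lowerbound[of "\<lambda>n. r n powr (s / 2)"]) auto
    then show False using False by simp
  qed
  then obtain n' where n': "D n' x \<noteq> D n' y" "\<And>i. i < n' \<Longrightarrow> D i x = D i y"
    using exists_least_iff[of "\<lambda>n. D n x \<noteq> D n y"] by auto
  have "\<lfloor>x\<rfloor> = 0" "\<lfloor>y\<rfloor> = 0" using x y by (auto simp: floor_eq_iff)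
  then have "D 0 x = D 0 y" by (simp add: D_def)
  then obtain n where n: "n' = Suc n" using n'(1) by (cases n') auto
  define j where "j = \<bar>D (Suc n) x - D (Suc n) y\<bar>"
  have j1: "1 \<le> j" using n' n by (simp add: j_def)
  have Dn: "D n x = D n y" using n' n by simp
  have "digit i x = digit i y" if "i < n" for i
    using digit_int[of i x] digit_int[of i y] n'(2)[of i] n'(2)[of "Suc i"] that n by simp
  then have P: "(\<Sum>i<n. d i * digit i x) = (\<Sum>i<n. d i * digit i y)" by simp
  have dd: "\<bar>real (digit n x) - real (digit n y)\<bar> = of_int j"
  proof -
    have "\<bar>int (digit n x) - int (digit n y)\<bar> = j"
      unfolding digit_int j_def using Dn by simp
    then show ?thesis by (metis of_int_abs of_int_diff of_int_of_nat_eq)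
  qed
  then have jm: "of_int j \<le> real (m n)" using digit_less[of n x] digit_less[of n y] by linarith
  have "\<bar>d n * digit n x - d n * digit n y\<bar> = d n * of_int j"
    using dd d_pos[of n] by (simp add: abs_mult flip: right_diff_distrib)
  then have "d n * of_int j - r (Suc n) / 12 \<le> \<bar>cantor x - cantor y\<bar>"
    using cantor_tail(2,3)[where n="Suc n" and t=x] cantor_tail(2,3)[where n="Suc n" and t=y] P
    unfolding sum.lessThan_Suc by linarith
  moreover have "d n * 1 \<le> d n * of_int j" using j1 d_pos[of n] by (intro mult_left_mono) auto
  ultimately have "d n * of_int j / 2 \<le> \<bar>cantor x - cantor y\<bar>"
    using r_Suc_le[of n] R_le[of n] d_pos[of n] by linarith
  moreover have "d n * of_int j / 2 = (of_int j / m n) * (r n * (1 / 32))"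
    using block_eq[of n] m_pos[of n] by (simp add: field_simps)
  ultimately have "((of_int j / m n) * (r n * (1 / 32))) powr (s / 2) \<le> \<bar>cantor x - cantor y\<bar> powr (s / 2)"
    using s j1 r_pos[of n] by (intro powr_mono2) auto
  also have "((of_int j / m n) * (r n * (1 / 32))) powr (s / 2)
      = (of_int j / m n) powr (s / 2) * (r n powr (s / 2) * (1 / 32) powr (s / 2))"
  proof -
    have "(u * (v * w)) powr e = u powr e * (v powr e * w powr e)"
      if "0 \<le> u" "0 \<le> v" "0 \<le> w" for u v w e :: real
      using that by (simp add: powr_mult)
    moreover have "0 \<le> real_of_int j / real (m n)" using j1 by simp
    ultimately show ?thesis using less_imp_le[OF r_pos[of n]] by (metis zero_le_divide_1_iff zero_le_numeral)
  qed
  finally have up: "(of_int j / m n) powr (s / 2) * (r n powr (s / 2) * (1 / 32) powr (s / 2))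
      \<le> \<bar>cantor x - cantor y\<bar> powr (s / 2)" .
  \<comment> \<open>Here \<open>s \<le> 2\<close> enters: \<open>j / m n\<close> and
    \<open>1 / 32\<close> are at most \<open>1\<close>, so dropping their exponent
    \<open>s / 2\<close> can only make them smaller.\<close>
  have pw: "u \<le> u powr (s / 2)" if "0 < u" "u \<le> 1" for u :: real
    using powr_mono'[of "s / 2" 1 u] that s by simp
  have "(of_int j / m n) * ((1 / M n) * (1 / 32))
      \<le> (of_int j / m n) powr (s / 2) * (r n powr (s / 2) * (1 / 32) powr (s / 2))"
    using j1 jm m_pos[of n] M[of n] count[of n] unfolding M_def
    by (intro mult_mono pw) auto
  also note up
  finally have low: "of_int j / M (Suc n) / 32 \<le> \<bar>cantor x - cantor y\<bar> powr (s / 2)"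
    by (simp add: M_def mult_ac)
  have "\<bar>x - y\<bar> \<le> (of_int j + 1) / M (Suc n)" using close[of "Suc n"] by (simp add: j_def)
  also have "\<dots> \<le> (2 * of_int j) / M (Suc n)" using j1 M[of "Suc n"] by (intro divide_right_mono) auto
  finally show ?thesis using low by simp
qed simp

lemma hausdorff_dim_A:
  assumes s: "0 < s" "s \<le> 2" and block_eq: "\<And>n. 16 * d n * m n = r n"
    and count: "\<And>n. r n powr (s / 2) = 1 / (\<Prod>i<n. real (m i))"
  shows "hausdorff_dim A = ereal s"
proof (rule antisym)
  have "(\<Prod>i<n. real (m i))\<^sup>2 * r n powr s \<le> 1" for n
  proof -
    have "r n powr s = r n powr (s / 2) * r n powr (s / 2)" by (simp flip: powr_add)
    moreover have "0 < (\<Prod>i<n. real (m i))" using m_pos by (intro prod_pos) simp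
    ultimately show ?thesis by (simp add: count power2_eq_square)
  qed
  then show "hausdorff_dim A \<le> ereal s" using s by (intro hausdorff_dim_A_le)
  show "ereal s \<le> hausdorff_dim A"
    using cantor_inverse_hoelder[OF s block_eq] count cantor_in_A s
    by (intro hausdorff_dim_ge[of s 64 cantor A]) auto
qed

end

section \<open>The choice of parameters\<close>

text \<open>The exponents of the scales, in powers of two. A large \<open>N\<close> makes earlier
  generations negligible, while the fixed ratio keeps \<open>k (Suc n)\<close> linear in the
  preceding exponent, which makes the Lipschitz series summable.\<close>

primrec level :: "nat \<Rightarrow> nat \<Rightarrow> nat" where
  "level N 0 = 0"
| "level N (Suc n) = N * (level N n + 1)"

lemma level_ge: "0 < N \<Longrightarrow> n \<le> level N n"
proof (induction n)
  case (Suc n)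
  then have "1 * (n + 1) \<le> N * (level N n + 1)" by (intro mult_le_mono) auto
  then show ?case by simp
qed simp

text \<open>Serves the Lipschitz series: the contraction is Gaussian in the exponent, the next twist
  linear. By \<open>exp y \<ge> y\<^sup>2 / 2\<close> at \<open>y = a * X\<^sup>2\<close> the decay
  is of order \<open>X^-4\<close>, of which the linear factor costs at most
  \<open>X^2\<close>.\<close>

lemma summable_gauss_quadratic:
  fixes E :: "nat \<Rightarrow> nat"
  assumes a: "0 < a" and q: "0 \<le> q" and E: "\<And>n. n + 1 \<le> E n"
  shows "summable (\<lambda>n. exp (- (a * (real (E n))\<^sup>2)) * (1 + q * (real (E n) + 1)))"
proof (rule summable_comparison_test'[where N=0])
  show "summable (\<lambda>n. 2 * (1 + 2 * q) / a\<^sup>2 * inverse ((real (Suc n))\<^sup>2))"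
    by (intro summable_mult, subst summable_Suc_iff) (rule inverse_power_summable, simp)
  fix n
  define X where "X = real (E n)"
  have X: "real n + 1 \<le> X" using E[of n] unfolding X_def by linarith
  then have X1: "1 \<le> X" "0 < X" by linarith+
  have "(a * X\<^sup>2)\<^sup>2 / 2 \<le> exp (a * X\<^sup>2)"
    using exp_lower_Taylor_quadratic[of "a * X\<^sup>2"] a by (smt (verit) mult_nonneg_nonneg zero_le_power2)
  then have "exp (- (a * X\<^sup>2)) \<le> inverse ((a * X\<^sup>2)\<^sup>2 / 2)"
    unfolding exp_minus using a X1 by (intro le_imp_inverse_le) auto
  also have "inverse ((a * X\<^sup>2)\<^sup>2 / 2) = 2 / a\<^sup>2 * (inverse (X\<^sup>2) * inverse (X\<^sup>2))"
    using a X1 by (simp add: power2_eq_square field_simps)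
  finally have e: "exp (- (a * X\<^sup>2)) \<le> 2 / a\<^sup>2 * (inverse (X\<^sup>2) * inverse (X\<^sup>2))" .
  have "1 + q * (X + 1) \<le> X\<^sup>2 + q * (2 * X\<^sup>2)"
  proof -
    have "X * 1 \<le> X * X" using X1 by (intro mult_left_mono) auto
    then have XX: "X \<le> X\<^sup>2" by (simp add: power2_eq_square)
    then have "q * (X + 1) \<le> q * (2 * X\<^sup>2)" using X1 q by (intro mult_left_mono) auto
    then show ?thesis using XX X1 by linarith
  qed
  also have "\<dots> = (1 + 2 * q) * X\<^sup>2" by (simp add: algebra_simps)
  finally have p: "1 + q * (X + 1) \<le> (1 + 2 * q) * X\<^sup>2" .
  have "exp (- (a * X\<^sup>2)) * (1 + q * (X + 1))
      \<le> 2 / a\<^sup>2 * (inverse (X\<^sup>2) * inverse (X\<^sup>2)) * ((1 + 2 * q) * X\<^sup>2)"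
    using q X1 a by (intro mult_mono e p) auto
  also have "\<dots> = 2 * (1 + 2 * q) / a\<^sup>2 * inverse (X\<^sup>2) * (inverse (X\<^sup>2) * X\<^sup>2)"
  proof -
    have "2 / A * (i * i) * ((1 + 2 * q) * Y) = 2 * (1 + 2 * q) / A * i * (i * Y)" for A i Y :: real
      by (simp add: algebra_simps)
    then show ?thesis .
  qed
  also have "inverse (X\<^sup>2) * X\<^sup>2 = 1" using X1 by simp
  also have "2 * (1 + 2 * q) / a\<^sup>2 * inverse (X\<^sup>2) * 1 \<le> 2 * (1 + 2 * q) / a\<^sup>2 * inverse ((real (Suc n))\<^sup>2)"
    using X q a unfolding mult_1_right by (intro mult_left_mono le_imp_inverse_le power_mono) auto
  finally show "norm (exp (- (a * (real (E n))\<^sup>2)) * (1 + q * (real (E n) + 1)))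
      \<le> 2 * (1 + 2 * q) / a\<^sup>2 * inverse ((real (Suc n))\<^sup>2)"
    using q unfolding X_def by (simp add: abs_mult)
qed

theorem theorem4:
  shows "\<exists>C1 C2 :: real. 0 < C1 \<and> 0 < C2 \<and>
    (\<forall>(p :: real) (s :: real) (b :: complex \<Rightarrow> real).
      0 < p \<and> 0 < s \<and> s < 2 \<and> arg_branch b \<longrightarrow>
      (\<exists>(f :: complex \<Rightarrow> complex) (A :: complex set).
        exp_integrable_distortion p f \<and>
        hausdorff_dim A = ereal s \<and>
        (\<forall>z\<in>A. \<exists>l :: nat \<Rightarrow> complex.
          (\<forall>n. 0 < cmod (l n) \<and> cmod (l n) \<le> 1) \<and>
          (\<lambda>n. cmod (l n)) \<longlonglongrightarrow> 0 \<and>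
          (\<forall>n. cmod (f (z + l n) - f z)
                 \<le> exp (- (C1 * (2 - s)\<^sup>2 / p * (ln (1 / cmod (l n)))\<^sup>2))) \<and>
          (\<forall>n. \<bar>ray_arg b f z (l n)\<bar>
                 \<ge> C2 * (2 - s)\<^sup>2 / p * (ln (1 / cmod (l n)))\<^sup>2))))"
proof (rule exI[of _ "1 / 256"], rule exI[of _ "1 / 512"], intro conjI allI impI)
  \<comment> \<open>With the \<open>a\<close> defined below, \<open>(2 - s)\<^sup>2 / p\<close>
    times the squared logarithm is at most \<open>256 * (a * X\<^sup>2)\<close> at exponent
    \<open>X\<close>. The modulus gains all of \<open>a * X\<^sup>2\<close>; the argument keeps half
    of it after paying for the branch and the accumulated errors.\<close>
  fix p s :: real and b :: "complex \<Rightarrow> real"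
  assume "0 < p \<and> 0 < s \<and> s < 2 \<and> arg_branch b"
  then have p: "0 < p" and s: "0 < s" "s < 2" and b: "arg_branch b" by auto
  \<comment> \<open>Since \<open>2 / s = 1 + \<sigma>\<close>, dimension \<open>s\<close>
    corresponds to \<open>M\<^sup>2\<close> discs of radius
    \<open>M powr (- (1 + \<sigma>))\<close>; \<open>\<sigma>\<close> measures the distance from
    dimension two.\<close>
  define \<sigma> where "\<sigma> = 2 / s - 1"
  have \<sigma>: "0 < \<sigma>" using s by (simp add: \<sigma>_def)
  have s_eq: "2 / s = 1 + \<sigma>" "(2 - s) / s = \<sigma>" using s by (auto simp: \<sigma>_def field_simps)
  \<comment> \<open>Makes \<open>N * \<sigma>\<close> at least \<open>4 * \<sigma> + 24\<close>,
    from which both \<open>gap\<close> and \<open>half\<close> follow.\<close>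
  define N where "N = nat \<lceil>4 + 24 / \<sigma>\<rceil>"
  have N: "4 + 24 / \<sigma> \<le> real N" unfolding N_def by linarith
  then have "4 < real N" using divide_pos_pos[of 24 \<sigma>] \<sigma> by linarith
  then have N0: "0 < N" by simp
  have "(4 + 24 / \<sigma>) * \<sigma> \<le> real N * \<sigma>" using N \<sigma> by (intro mult_right_mono) auto
  then have N\<sigma>: "4 * \<sigma> + 24 \<le> real N * \<sigma>" using \<sigma> by (simp add: distrib_right)
  define E where "E = level N"
  have E_0: "E 0 = 0" by (simp add: E_def)
  have E_Suc: "real (E (Suc n)) = real N * (real (E n) + 1)" for n
    by (simp add: E_def algebra_simps)
  have E_ge: "n \<le> E n" for n unfolding E_def by (rule level_ge[OF N0])
  \<comment> \<open>\<open>gap\<close> leaves \<open>12 - 4 = 8\<close> binary orders between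
    \<open>d n\<close> and \<open>r (Suc n)\<close>, the factor \<open>256\<close> that the
    geometric mean \<open>R n\<close> divides into \<open>16\<close> on either side.
    \<open>half\<close> says that subtracting \<open>E n\<close> and the \<open>4\<close> costs at
    most half of the exponent.\<close>
  have gap: "12 \<le> \<sigma> * (real (E (Suc n)) - real (E n))"
    and half: "\<sigma> * real (E (Suc n)) / 2 \<le> \<sigma> * (real (E (Suc n)) - real (E n)) - 4" for n
  proof -
    have "(4 * \<sigma> + 24) * (real (E n) + 1) \<le> (real N * \<sigma>) * (real (E n) + 1)"
      using N\<sigma> by (intro mult_right_mono) auto
    then have "4 * (\<sigma> * real (E n)) + 24 * real (E n) + 4 * \<sigma> + 24 \<le> \<sigma> * real (E (Suc n))"
      unfolding E_Suc by (simp add: algebra_simps)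
    moreover have "0 \<le> \<sigma> * real (E n)" using \<sigma> by simp
    ultimately show "12 \<le> \<sigma> * (real (E (Suc n)) - real (E n))"
      "\<sigma> * real (E (Suc n)) / 2 \<le> \<sigma> * (real (E (Suc n)) - real (E n)) - 4"
      unfolding right_diff_distrib using \<sigma> by linarith+
  qed
  have E_mono: "E n \<le> E (Suc n)" for n
  proof -
    have "1 * (E n + 1) \<le> N * (E n + 1)" using N0 by (intro mult_le_mono) auto
    then show ?thesis by (simp add: E_def)
  qed
  \<comment> \<open>Powers of two make the product of the first \<open>m i\<close> equal to
    \<open>2 powr E n\<close>, so \<open>r n powr (s / 2)\<close> is exactly its reciprocal. The
    choice of \<open>k n\<close> gives
    \<open>exp (2 * p * k n) = 2 powr (\<sigma> / 2 * E (Suc n))\<close>, which uses up half of the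
    decay of the area.\<close>
  define m where "m = (\<lambda>n. 2 ^ (E (Suc n) - E n) :: nat)"
  define r where "r = (\<lambda>n. 2 powr (- (1 + \<sigma>) * real (E n)))"
  define d where "d = (\<lambda>n. r n / (16 * real (m n)))"
  define R where "R = (\<lambda>n. sqrt (d n * r (Suc n)))"
  define k where "k = (\<lambda>n. \<sigma> * ln 2 * real (E (Suc n)) / (4 * p))"
  have r0: "0 < r n" for n by (simp add: r_def)
  have m_powr: "real (m n) = 2 powr (real (E (Suc n)) - real (E n))" for n
    unfolding m_def using E_mono[of n] by (simp add: powr_realpow[symmetric] of_nat_diff)
  have m0: "0 < m n" for n by (simp add: m_def)
  have d0: "0 < d n" for n using r0[of n] m0[of n] by (simp add: d_def)
  have d_powr: "d n = 2 powr (- \<sigma> * real (E n) - real (E (Suc n)) - 4)" for n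
  proof -
    have "d n = 2 powr (- (1 + \<sigma>) * real (E n)) / (2 powr 4 * 2 powr (real (E (Suc n)) - real (E n)))"
      unfolding d_def r_def m_powr by simp
    also have "\<dots> = 2 powr (- (1 + \<sigma>) * real (E n) - (4 + (real (E (Suc n)) - real (E n))))"
      by (simp only: powr_diff powr_add)
    finally show ?thesis by (simp add: algebra_simps)
  qed
  have dr: "d n / r (Suc n) = 2 powr (\<sigma> * (real (E (Suc n)) - real (E n)) - 4)" for n
    unfolding d_powr r_def by (simp add: powr_diff[symmetric] algebra_simps)
  have rd: "256 * r (Suc n) \<le> d n" for n
  proof -
    have "2 powr 8 \<le> d n / r (Suc n)" unfolding dr using gap[of n] by (intro powr_mono) auto
    then show ?thesis using r0[of "Suc n"] by (simp add: pos_le_divide_eq)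
  qed
  have R2: "(R n)\<^sup>2 = d n * r (Suc n)" and R0: "0 < R n" for n
    using d0[of n] r0[of "Suc n"] by (auto simp: R_def)
  interpret T: twist_tree m d R r k
  proof
    fix n
    show "0 < m n" by (rule m0)
    show "0 \<le> k n" using \<sigma> p by (simp add: k_def)
    show "0 < r n" by (rule r0)
    show "r 0 = 1" by (simp add: r_def E_0)
    show "16 * d n * real (m n) \<le> r n" using m0[of n] by (simp add: d_def)
    show "16 * R n \<le> d n"
    proof (rule power2_le_imp_le)
      have "256 * (d n * r (Suc n)) \<le> d n * d n"
        using mult_left_mono[OF rd[of n], of "d n"] d0[of n] by simp
      then show "(16 * R n)\<^sup>2 \<le> (d n)\<^sup>2"
        unfolding power_mult_distrib R2 by (simp add: power2_eq_square)
    qed (use d0[of n] in simp)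
    show "16 * r (Suc n) \<le> R n"
    proof (rule power2_le_imp_le)
      have "256 * r (Suc n) * r (Suc n) \<le> d n * r (Suc n)"
        using mult_right_mono[OF rd[of n], of "r (Suc n)"] r0[of "Suc n"] by simp
      then show "(16 * r (Suc n))\<^sup>2 \<le> (R n)\<^sup>2"
        unfolding power_mult_distrib R2 by (simp add: power2_eq_square)
    qed (use R0[of n] in simp)
  qed
  \<comment> \<open>The product of \<open>\<sigma> * ln 2 / (4 * p)\<close> from \<open>k n\<close>
    and \<open>\<sigma> * ln 2 / 4\<close> from the logarithm of \<open>R n / r (Suc n)\<close>; the
    latter \<open>4\<close> combines \<open>half\<close> with the square root in
    \<open>R\<close>.\<close>
  define a where "a = (\<sigma> * ln 2)\<^sup>2 / (16 * p)"
  have a: "0 < a" using \<sigma> p by (simp add: a_def)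
  have twist_ge: "a * (real (E (Suc n)))\<^sup>2 \<le> k n * ln (R n / r (Suc n))" for n
  proof -
    have "R n / r (Suc n) = sqrt (d n / r (Suc n))"
      unfolding R_def using r0[of "Suc n"] d0[of n]
      by (simp add: real_sqrt_mult real_sqrt_divide field_simps)
    then have "ln (R n / r (Suc n)) = ln (d n / r (Suc n)) / 2"
      using d0[of n] r0[of "Suc n"] by (simp add: ln_sqrt)
    also have "\<dots> = (\<sigma> * (real (E (Suc n)) - real (E n)) - 4) * ln 2 / 2"
      unfolding dr by (simp add: ln_powr)
    also have "\<dots> \<ge> (\<sigma> * real (E (Suc n)) / 2) * ln 2 / 2"
      using half[of n] by (intro divide_right_mono mult_right_mono) auto
    finally have "k n * ((\<sigma> * real (E (Suc n)) / 2) * ln 2 / 2) \<le> k n * ln (R n / r (Suc n))"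
      using T.k_nonneg[of n] by (intro mult_left_mono) auto
    moreover have "k n * ((\<sigma> * real (E (Suc n)) / 2) * ln 2 / 2) = a * (real (E (Suc n)))\<^sup>2"
      by (simp add: k_def a_def power2_eq_square)
    ultimately show ?thesis by simp
  qed
  have C_le: "cmod (T.C (Suc n)) \<le> exp (- (a * (real (E (Suc n)))\<^sup>2))" for n
  proof -
    have "cmod (T.C (Suc n)) \<le> cmod (T.c n)" by (rule T.norm_C_Suc_le_c)
    also have "\<dots> \<le> exp (- (a * (real (E (Suc n)))\<^sup>2))"
      unfolding T.norm_c using twist_ge[of n] by simp
    finally show ?thesis .
  qed
  have lip: "summable (\<lambda>n. cmod (T.C n) * (1 + k n))"
  proof -
    define q where "q = \<sigma> * ln 2 / (4 * p) * real N"
    have q: "0 \<le> q" using \<sigma> p by (simp add: q_def)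
    have kq: "k (Suc n) = q * (real (E (Suc n)) + 1)" for n
      unfolding k_def q_def E_Suc[of "Suc n"] by (simp add: field_simps)
    have "summable (\<lambda>n. exp (- (a * (real (E (Suc n)))\<^sup>2)) * (1 + q * (real (E (Suc n)) + 1)))"
      using E_ge[of "Suc _"] by (intro summable_gauss_quadratic a q) simp
    then have "summable (\<lambda>n. cmod (T.C (Suc n)) * (1 + k (Suc n)))"
    proof (rule summable_comparison_test'[where N=0])
      fix n
      have "cmod (T.C (Suc n)) * (1 + k (Suc n))
          \<le> exp (- (a * (real (E (Suc n)))\<^sup>2)) * (1 + k (Suc n))"
        using T.k_nonneg[of "Suc n"] by (intro mult_right_mono C_le) auto
      then show "norm (cmod (T.C (Suc n)) * (1 + k (Suc n)))
          \<le> exp (- (a * (real (E (Suc n)))\<^sup>2)) * (1 + q * (real (E (Suc n)) + 1))"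
        using T.k_nonneg[of "Suc n"] unfolding kq by (simp add: abs_mult)
    qed
    then show ?thesis using summable_Suc_iff[of "\<lambda>n. cmod (T.C n) * (1 + k n)"] by blast
  qed
  have prod_m: "(\<Prod>i<n. real (m i)) = 2 powr real (E n)" for n
  proof (induction n)
    case (Suc n)
    then show ?case by (simp add: m_powr flip: powr_add)
  qed (simp add: E_0)
  have area: "summable (\<lambda>n. exp (p * (2 * (1 + k n))) * ((\<Prod>i<Suc n. real (m i))\<^sup>2 * (R n)\<^sup>2))"
  proof (rule summable_comparison_test'[where N=0])
    \<comment> \<open>The half of the area exponent left over by the weight is compared with a
      geometric series through \<open>n \<le> E (Suc n)\<close>.\<close>
    have "2 powr (- \<sigma> / 2) < 2 powr 0" using \<sigma> by (intro powr_less_mono) auto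
    then show "summable (\<lambda>n. exp (2 * p) * (2 powr (- \<sigma> / 2)) ^ n)"
      by (intro summable_mult summable_geometric) simp
    fix n
    have "exp (p * (2 * (1 + k n))) = exp (2 * p) * exp (2 * p * k n)"
      by (simp add: algebra_simps flip: exp_add)
    also have "exp (2 * p * k n) = 2 powr (\<sigma> / 2 * real (E (Suc n)))"
      unfolding powr_def k_def using p by (simp add: field_simps)
    finally have "exp (p * (2 * (1 + k n))) * ((\<Prod>i<Suc n. real (m i))\<^sup>2 * (R n)\<^sup>2)
        = exp (2 * p) * (2 powr (\<sigma> / 2 * real (E (Suc n))) * (2 powr real (E (Suc n)) * 2 powr real (E (Suc n))
          * (2 powr (- \<sigma> * real (E n) - real (E (Suc n)) - 4) * 2 powr (- (1 + \<sigma>) * real (E (Suc n))))))"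
      unfolding R2 prod_m d_powr r_def by (simp add: power2_eq_square)
    also have "\<dots> = exp (2 * p) * 2 powr (- \<sigma> / 2 * real (E (Suc n)) - (\<sigma> * real (E n) + 4))"
    proof -
      have "\<sigma> / 2 * real (E (Suc n)) + (real (E (Suc n)) + real (E (Suc n))
          + (- \<sigma> * real (E n) - real (E (Suc n)) - 4 + - (1 + \<sigma>) * real (E (Suc n))))
          = - \<sigma> / 2 * real (E (Suc n)) - (\<sigma> * real (E n) + 4)"
        by (simp add: field_simps)
      then show ?thesis by (simp only: powr_add[symmetric])
    qed
    also have "\<dots> \<le> exp (2 * p) * 2 powr (- \<sigma> / 2 * real n)"
    proof (intro mult_left_mono powr_mono)
      have "\<sigma> * real n \<le> \<sigma> * real (E (Suc n))"
        using E_ge[of "Suc n"] \<sigma> by (intro mult_left_mono) auto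
      moreover have "0 \<le> \<sigma> * real (E n)" using \<sigma> by simp
      ultimately show "- \<sigma> / 2 * real (E (Suc n)) - (\<sigma> * real (E n) + 4) \<le> - \<sigma> / 2 * real n" by simp
    qed auto
    also have "\<dots> = exp (2 * p) * (2 powr (- \<sigma> / 2)) ^ n"
      using powr_realpow[of "2 powr (- \<sigma> / 2)" n] by (simp add: powr_powr)
    finally show "norm (exp (p * (2 * (1 + k n))) * ((\<Prod>i<Suc n. real (m i))\<^sup>2 * (R n)\<^sup>2))
        \<le> exp (2 * p) * (2 powr (- \<sigma> / 2)) ^ n" by (simp add: abs_mult)
  qed
  obtain \<alpha> where \<alpha>: "\<And>w. w \<noteq> 0 \<Longrightarrow> is_Arg w (b w) \<and> b w \<le> \<alpha> + 2 * pi"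
    using b unfolding arg_branch_def by blast
  define B where "B = \<alpha> + 2 * pi"
  \<comment> \<open>The estimates are claimed for every index, so the sequence starts late enough
    for half of the quadratic term to absorb the branch bound \<open>B\<close> and the errors linear
    in the generation.\<close>
  define n0 where "n0 = nat \<lceil>2 / a * (\<bar>B\<bar> + 6 * pi)\<rceil>"
  define l where "l = (\<lambda>n. complex_of_real (r (Suc (n + n0)) / 2))"
  have cl: "cmod (l n) = r (Suc (n + n0)) / 2" for n
    using r0[of "Suc (n + n0)"] by (simp add: l_def)
  have log_le: "(2 - s)\<^sup>2 / p * (ln (1 / cmod (l n)))\<^sup>2 \<le> 256 * (a * (real (E (Suc (n + n0))))\<^sup>2)" for n
  proof -
    define X where "X = real (E (Suc (n + n0)))"
    have X: "1 \<le> X" using E_ge[of "Suc (n + n0)"] by (simp add: X_def)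
    have "ln (1 / cmod (l n)) = ln 2 - ln (r (Suc (n + n0)))"
      unfolding cl using r0[of "Suc (n + n0)"] by (simp add: ln_div)
    also have "ln (r (Suc (n + n0))) = - ((1 + \<sigma>) * X * ln 2)"
      unfolding r_def X_def by (simp add: ln_powr algebra_simps)
    finally have ln_eq: "ln (1 / cmod (l n)) = ln 2 + (1 + \<sigma>) * X * ln 2" by simp
    \<comment> \<open>The \<open>ln 2\<close> from halving the radius is at most the main term,
      which costs a factor \<open>2\<close>; then
      \<open>(2 - s) * (1 + \<sigma>) = 2 * \<sigma>\<close> brings out
      \<open>256 * (a * X\<^sup>2)\<close>.\<close>
    have "1 * 1 \<le> (1 + \<sigma>) * X" using X \<sigma> by (intro mult_mono) auto
    then have "1 * ln 2 \<le> (1 + \<sigma>) * X * ln (2::real)" by (intro mult_right_mono) auto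
    moreover have "(0::real) < ln 2" by simp
    ultimately have "(ln (1 / cmod (l n)))\<^sup>2 \<le> (2 * ((1 + \<sigma>) * X * ln 2))\<^sup>2"
      unfolding ln_eq by (intro power_mono) linarith+
    then have "(2 - s)\<^sup>2 / p * (ln (1 / cmod (l n)))\<^sup>2 \<le> (2 - s)\<^sup>2 / p * (2 * ((1 + \<sigma>) * X * ln 2))\<^sup>2"
      using p by (intro mult_left_mono) auto
    also have "\<dots> = (2 * ((2 - s) * (1 + \<sigma>)) * X * ln 2)\<^sup>2 / p"
      by (simp add: power_mult_distrib)
    also have "(2 - s) * (1 + \<sigma>) = 2 * \<sigma>"
      unfolding \<sigma>_def using s by (simp add: field_simps)
    also have "(2 * (2 * \<sigma>) * X * ln 2)\<^sup>2 / p = 256 * (a * X\<^sup>2)"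
      using p by (simp add: a_def power_mult_distrib)
    finally show ?thesis by (simp add: X_def)
  qed
  have z_est: "cmod (T.f (z + l n) - T.f z) \<le> exp (- (1 / 256 * (2 - s)\<^sup>2 / p * (ln (1 / cmod (l n)))\<^sup>2))"
    "\<bar>ray_arg b T.f z (l n)\<bar> \<ge> 1 / 512 * (2 - s)\<^sup>2 / p * (ln (1 / cmod (l n)))\<^sup>2"
    if z: "z \<in> T.A" for z n
  proof -
    define j where "j = n + n0"
    define q where "q = a * (real (E (Suc j)))\<^sup>2"
    have log: "(2 - s)\<^sup>2 / p * (ln (1 / cmod (l n)))\<^sup>2 \<le> 256 * q"
      using log_le[of n] by (simp add: q_def j_def)
    obtain v where v: "v \<in> T.W (Suc j)" "cmod (z - v) \<le> r (Suc j) / 4"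
      using z unfolding T.A_def by blast
    have "cmod (T.f (z + l n) - T.f z) \<le> cmod (T.C (Suc j))"
      by (rule T.norm_f_diff_le[OF v]) (simp add: cl j_def)
    also have "\<dots> \<le> exp (- q)" unfolding q_def by (rule C_le)
    also have "\<dots> \<le> exp (- (1 / 256 * (2 - s)\<^sup>2 / p * (ln (1 / cmod (l n)))\<^sup>2))" using log by simp
    finally show "cmod (T.f (z + l n) - T.f z) \<le> exp (- (1 / 256 * (2 - s)\<^sup>2 / p * (ln (1 / cmod (l n)))\<^sup>2))" .
    have "ray_arg b T.f z (l n) \<le> B + 2 * pi * (real j + 3) - k j * ln (R j / r (Suc j))"
      using T.ray_arg_le[OF lip z, of b B j] \<alpha> by (simp add: l_def j_def B_def)
    also have "\<dots> \<le> B + 2 * pi * (real j + 3) - q" using twist_ge[of j] by (simp add: q_def)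
    also have "\<dots> \<le> - q / 2"
    proof -
      \<comment> \<open>Since \<open>1 \<le> X\<close>, the constant and linear errors together are
        at most \<open>(\<bar>B\<bar> + 6 * pi) * X\<close>, and the choice of \<open>n0\<close>
        bounds this by \<open>a * X\<^sup>2 / 2\<close>.\<close>
      define X where "X = real j + 1"
      have X: "1 \<le> X" "2 / a * (\<bar>B\<bar> + 6 * pi) \<le> X"
        unfolding X_def j_def n0_def by linarith+
      have "\<bar>B\<bar> + 6 * pi \<le> X * a / 2" using X(2) a by (simp add: field_simps)
      then have "(\<bar>B\<bar> + 6 * pi) * X \<le> X * a / 2 * X" using X by (intro mult_right_mono) auto
      also have "\<dots> = a * X\<^sup>2 / 2" by (simp add: power2_eq_square)
      also have "\<dots> \<le> q / 2"
      proof -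
        have "X \<le> real (E (Suc j))" using E_ge[of "Suc j"] by (simp add: X_def)
        then have "X\<^sup>2 \<le> (real (E (Suc j)))\<^sup>2" using X by (intro power_mono) auto
        then show ?thesis using a by (simp add: q_def)
      qed
      finally have 1: "\<bar>B\<bar> * X + 6 * pi * X \<le> q / 2" by (simp add: distrib_right)
      have "\<bar>B\<bar> * 1 \<le> \<bar>B\<bar> * X" "4 * pi * 1 \<le> 4 * pi * X" 
        by (rule mult_left_mono[OF X(1)], simp)+
      moreover have "2 * pi * (real j + 3) = 2 * pi * X + 4 * pi" by (simp add: X_def algebra_simps)
      ultimately show ?thesis using 1 abs_ge_self[of B] by linarith
    qed
    finally have "q / 2 \<le> \<bar>ray_arg b T.f z (l n)\<bar>" by linarith
    then show "\<bar>ray_arg b T.f z (l n)\<bar> \<ge> 1 / 512 * (2 - s)\<^sup>2 / p * (ln (1 / cmod (l n)))\<^sup>2"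
      using log by simp
  qed
  have l_lim: "(\<lambda>n. cmod (l n)) \<longlonglongrightarrow> 0"
  proof -
    have "(\<lambda>n. r (n + Suc n0)) \<longlonglongrightarrow> 0" by (rule LIMSEQ_ignore_initial_segment[OF T.r_tendsto_0])
    then have "(\<lambda>n. r (n + Suc n0) / 2) \<longlonglongrightarrow> 0 / 2" by (intro tendsto_intros) auto
    then show ?thesis by (simp add: cl)
  qed
  have l_bounds: "0 < cmod (l n)" "cmod (l n) \<le> 1" for n
    unfolding cl using r0[of "Suc (n + n0)"] T.r_le_1[of "Suc (n + n0)"] by linarith+
  have dim: "hausdorff_dim T.A = ereal s"
  proof (rule T.hausdorff_dim_A)
    show "16 * d n * real (m n) = r n" for n using m0[of n] by (simp add: d_def)
    show "r n powr (s / 2) = 1 / (\<Prod>i<n. real (m i))" for n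
      unfolding prod_m r_def powr_powr using s unfolding s_eq(1)[symmetric] by (simp add: powr_minus_divide)
  qed (use s in auto)
  show "\<exists>f A. exp_integrable_distortion p f \<and> hausdorff_dim A = ereal s \<and>
        (\<forall>z\<in>A. \<exists>l :: nat \<Rightarrow> complex.
          (\<forall>n. 0 < cmod (l n) \<and> cmod (l n) \<le> 1) \<and>
          (\<lambda>n. cmod (l n)) \<longlonglongrightarrow> 0 \<and>
          (\<forall>n. cmod (f (z + l n) - f z)
                 \<le> exp (- (1 / 256 * (2 - s)\<^sup>2 / p * (ln (1 / cmod (l n)))\<^sup>2))) \<and>
          (\<forall>n. \<bar>ray_arg b f z (l n)\<bar>
                 \<ge> 1 / 512 * (2 - s)\<^sup>2 / p * (ln (1 / cmod (l n)))\<^sup>2))"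
    using T.f_exp_integrable_distortion[OF p lip area] dim l_bounds l_lim z_est by blast
qed auto

end
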